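(* Let $0<a<1$ and let $P=(1-\Delta)^a$ on $\mathbb{R}^n$. For $f\in\overline H^{-a}(\mathbb{R}^n_+)$, let $u\in\dot H^{a}(\overline{\mathbb{R}}^n_+)$ be the solution of the homogeneous Dirichlet problem $$r^+(1-\Delta)^a u=f\ \text{ on }\mathbb{R}^n_+,\qquad \operatorname{supp}u\subset\overline{\mathbb{R}}^n_+ .$$ Let $s\ge -a$. Then $$f\in\overline H^{s}(\mathbb{R}^n_+)\iff u\in H^{a(s+2a)}(\overline{\mathbb{R}}^n_+).$$ In particular (the case $s=0$), the domain of the $L_2$ Dirichlet realization $P_D$ of $P$ on $\mathbb{R}^n_+$ is $D(P_D)=H^{a(2a)}(\overline{\mathbb{R}}^n_+)$.
   Context: Notation: $\mathbb{R}^n_+=\{x=(x',x_n)\in\mathbb{R}^n\mid x_n>0\}$, $x'=(x_1,\dots,x_{n-1})$; $\hat u=\mathcal F u$ with $\mathcal F u(\xi)=\int_{\mathbb{R}^n}e^{-ix\cdot\xi}u(x)\,dx$, extended to the tempered distributions $\mathcal S'(\mathbb{R}^n)$; $\operatorname{Op}(p(\xi))u=\mathcal F^{-1}(p(\xi)\hat u(\xi))$; $\langle\xi\rangle=(1+|\xi|^2)^{1/2}$ and $\langle\xi'\rangle=(1+|\xi'|^2)^{1/2}$ with $\xi=(\xi',\xi_n)$. The operator $(1-\Delta)^a$ is $\operatorname{Op}(\langle\xi\rangle^{2a})$. $r^+$ denotes restriction from $\mathbb{R}^n$ to $\mathbb{R}^n_+$, and $e^+$ denotes extension by zero from $\mathbb{R}^n_+$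 to $\mathbb{R}^n$. Sobolev spaces, for $s\in\mathbb{R}$: $H^s(\mathbb{R}^n)=\{u\in\mathcal S'(\mathbb{R}^n)\mid\langle\xi\rangle^s\hat u\in L_2(\mathbb{R}^n)\}$; the restricted space $\overline H^s(\mathbb{R}^n_+)=r^+H^s(\mathbb{R}^n)$; the supported space $\dot H^s(\overline{\mathbb{R}}^n_+)=\{u\in H^s(\mathbb{R}^n)\mid\operatorname{supp}u\subset\overline{\mathbb{R}}^n_+\}$. Order-reducing operator: for $t\in\mathbb{R}$, $\Xi_+^t=\operatorname{Op}\big((\langle\xi'\rangle+i\xi_n)^t\big)$, the power being defined by the principal branch (cut along the negative real axis). The $a$-transmission spaces are $H^{a(t)}(\overline{\mathbb{R}}^n_+)=\Xi_+^{-a}e^+\overline H^{t-a}(\mathbb{R}^n_+)$ for $t>a-\tfrac12$ (here, with $t=s+2a$ and $s\ge -a$, one has $t-a\ge 0$, so $e^+$ acts on functions in $L_2(\mathbb{R}^n_+)$). The Dirichlet problem has for each $f\in\overline H^{-a}(\mathbb{R}^n_+)$ a unique solution $u\in\dot H^a(\overline{\mathbb{R}}^n_+)$. The $L_2$ Dirichlet realization $P_D$ is the operator in $L_2(\mathbb{R}^n_+)$ acting like $r^+P$ with domain $D(P_D)=\{u\in\dot H^a(\overline{\mathbb{R}}^n_+)\mid r^+Pu\in L_2(\mathbb{R}^n_+)\}$. *)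

theory Defs
  imports "HOL-Analysis.Analysis"
begin

text \<open>
  The space \<open>\<real>\<^sup>n\<close> is \<open>real ^ 'n\<close> with \<open>'n\<close> finite and linearly ordered, so that \<open>n = CARD('n) \<ge> 1\<close>
  is arbitrary and the last coordinate \<open>x\<^sub>n\<close> is the one at the largest index.

  A distribution is a functional on functions \<open>real ^ 'n \<Rightarrow> complex\<close>, set to zero outside its space
  of test functions (Schwartz functions for tempered distributions, \<open>C\<^sub>c\<^sup>\<infinity>(\<Omega>)\<close> for distributions
  on an open set \<open>\<Omega>\<close>). With this convention equality of distributions is equality of functionals.
\<close>

type_synonym 'n dist = "(real ^ 'n \<Rightarrow> complex) \<Rightarrow> complex"

subsection \<open>Test functions and tempered distributions\<close>

definition partial :: "'n::finite \<Rightarrow> (real ^ 'n \<Rightarrow> complex) \<Rightarrow> real ^ 'n \<Rightarrow> complex" where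
  "partial i f x = frechet_derivative f (at x) (axis i 1)"

text \<open>A multi-index derivative is encoded by a list of coordinate indices; different orderings of
  the list give the same derivative of a smooth function.\<close>

definition partials :: "'n::finite list \<Rightarrow> (real ^ 'n \<Rightarrow> complex) \<Rightarrow> real ^ 'n \<Rightarrow> complex" where
  "partials js f = foldr partial js f"

definition smooth :: "(real ^ 'n::finite \<Rightarrow> complex) \<Rightarrow> bool" where
  "smooth f \<longleftrightarrow> (\<forall>js x. partials js f differentiable (at x))"

definition schwartz_space :: "(real ^ 'n::finite \<Rightarrow> complex) set" where
  "schwartz_space =
     {\<phi>. smooth \<phi> \<and> (\<forall>k js. bdd_above (range (\<lambda>x. norm x ^ k * norm (partials js \<phi> x))))}"

definition schwartz_seminorm :: "nat \<Rightarrow> 'n::finite list \<Rightarrow> (real ^ 'n \<Rightarrow> complex) \<Rightarrow> real" where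
  "schwartz_seminorm k js \<phi> = (SUP x. norm x ^ k * norm (partials js \<phi> x))"

definition test_functions :: "(real ^ 'n::finite) set \<Rightarrow> (real ^ 'n \<Rightarrow> complex) set" where
  "test_functions U =
     {\<phi>. smooth \<phi> \<and> compact (closure {x. \<phi> x \<noteq> 0}) \<and> closure {x. \<phi> x \<noteq> 0} \<subseteq> U}"

text \<open>Continuity with respect to the Schwartz topology is boundedness by finitely many of the
  defining seminorms.\<close>

definition tempered :: "'n::finite dist set" where
  "tempered =
     {u. (\<forall>\<phi>. \<phi> \<notin> schwartz_space \<longrightarrow> u \<phi> = 0)
       \<and> (\<forall>\<phi>\<in>schwartz_space. \<forall>\<psi>\<in>schwartz_space. u (\<lambda>x. \<phi> x + \<psi> x) = u \<phi> + u \<psi>)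
       \<and> (\<forall>c. \<forall>\<phi>\<in>schwartz_space. u (\<lambda>x. c * \<phi> x) = c * u \<phi>)
       \<and> (\<exists>C N. \<forall>\<phi>\<in>schwartz_space.
             norm (u \<phi>) \<le> C * (\<Sum>k\<le>N. \<Sum>js\<in>{js. length js \<le> N}. schwartz_seminorm k js \<phi>))}"

definition dist_support :: "'n::finite dist \<Rightarrow> (real ^ 'n) set" where
  "dist_support u = - \<Union>{U. open U \<and> (\<forall>\<phi>\<in>test_functions U. u \<phi> = 0)}"

subsection \<open>Functions as distributions\<close>

definition square_integrable_on :: "(real ^ 'n::finite) set \<Rightarrow> (real ^ 'n \<Rightarrow> complex) \<Rightarrow> bool" where
  "square_integrable_on \<Omega> g \<longleftrightarrow>
     g \<in> borel_measurable lborel \<and> set_integrable lborel \<Omega> (\<lambda>x. (norm (g x))\<^sup>2)"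

text \<open>The distribution \<open>\<phi> \<mapsto> \<integral>\<^sub>\<Omega> g \<phi>\<close> on the space \<open>X\<close> of test functions.\<close>

definition regular_dist ::
    "(real ^ 'n::finite \<Rightarrow> complex) set \<Rightarrow> (real ^ 'n) set \<Rightarrow> (real ^ 'n \<Rightarrow> complex) \<Rightarrow> 'n dist" where
  "regular_dist X \<Omega> g = (\<lambda>\<phi>. if \<phi> \<in> X then (LINT x:\<Omega>|lborel. g x * \<phi> x) else 0)"

definition L2_Rn :: "'n::finite dist set" where
  "L2_Rn = {regular_dist schwartz_space UNIV g | g. square_integrable_on UNIV g}"

subsection \<open>Fourier transform and Fourier multipliers\<close>

definition fourier :: "(real ^ 'n::finite \<Rightarrow> complex) \<Rightarrow> real ^ 'n \<Rightarrow> complex" where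
  "fourier \<phi> \<xi> = (LINT x|lborel. exp (- \<i> * of_real (x \<bullet> \<xi>)) * \<phi> x)"

definition fourier_inv :: "(real ^ 'n::finite \<Rightarrow> complex) \<Rightarrow> real ^ 'n \<Rightarrow> complex" where
  "fourier_inv \<phi> x =
     (LINT \<xi>|lborel. exp (\<i> * of_real (x \<bullet> \<xi>)) * \<phi> \<xi>) / (2 * of_real pi) ^ CARD('n)"

definition dist_fourier :: "'n::finite dist \<Rightarrow> 'n dist" where
  "dist_fourier u = (\<lambda>\<phi>. if \<phi> \<in> schwartz_space then u (fourier \<phi>) else 0)"

definition dist_fourier_inv :: "'n::finite dist \<Rightarrow> 'n dist" where
  "dist_fourier_inv u = (\<lambda>\<phi>. if \<phi> \<in> schwartz_space then u (fourier_inv \<phi>) else 0)"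

text \<open>Multiplication by \<open>p\<close> is meaningful for smooth \<open>p\<close> all of whose derivatives are polynomially
  bounded, as these multiply the Schwartz space into itself. All symbols below are of this kind.\<close>

definition dist_mult :: "(real ^ 'n::finite \<Rightarrow> complex) \<Rightarrow> 'n dist \<Rightarrow> 'n dist" where
  "dist_mult p u = (\<lambda>\<phi>. if \<phi> \<in> schwartz_space then u (\<lambda>\<xi>. p \<xi> * \<phi> \<xi>) else 0)"

definition Op :: "(real ^ 'n::finite \<Rightarrow> complex) \<Rightarrow> 'n dist \<Rightarrow> 'n dist" where
  "Op p u = dist_fourier_inv (dist_mult p (dist_fourier u))"

definition last_coord :: "real ^ 'n::{finite,linorder} \<Rightarrow> real" where
  "last_coord x = x $ Max UNIV"

definition bracket :: "real ^ 'n::finite \<Rightarrow> real" where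
  "bracket \<xi> = sqrt (1 + (norm \<xi>)\<^sup>2)"

definition bracket' :: "real ^ 'n::{finite,linorder} \<Rightarrow> real" where
  "bracket' \<xi> = sqrt (1 + (\<Sum>i\<in>UNIV - {Max UNIV}. (\<xi> $ i)\<^sup>2))"

text \<open>\<open>P = (1 - \<Delta>)\<^sup>a\<close>\<close>

definition bessel_op :: "real \<Rightarrow> 'n::finite dist \<Rightarrow> 'n dist" where
  "bessel_op a = Op (\<lambda>\<xi>. of_real (bracket \<xi> powr (2 * a)))"

text \<open>\<open>\<Xi>\<^sub>+\<^sup>t\<close>; complex \<open>powr\<close> uses the principal branch of the logarithm.\<close>

definition Xi_plus :: "real \<Rightarrow> 'n::{finite,linorder} dist \<Rightarrow> 'n dist" where
  "Xi_plus t =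
     Op (\<lambda>\<xi>. (of_real (bracket' \<xi>) + \<i> * of_real (last_coord \<xi>)) powr (of_real t :: complex))"

subsection \<open>Half-space, restriction and extension by zero\<close>

definition half_space :: "(real ^ 'n::{finite,linorder}) set" where
  "half_space = {x. last_coord x > 0}"

definition r_plus :: "'n::{finite,linorder} dist \<Rightarrow> 'n dist" where
  "r_plus u = (\<lambda>\<phi>. if \<phi> \<in> test_functions half_space then u \<phi> else 0)"

definition L2_half :: "'n::{finite,linorder} dist set" where
  "L2_half = {regular_dist (test_functions half_space) half_space g | g.
                square_integrable_on half_space g}"

text \<open>Only used for \<open>v \<in> L2_half\<close>, where the function representing \<open>v\<close> exists and is unique up to
  null sets, so that the value does not depend on the choice.\<close>

definition e_plus :: "'n::{finite,linorder} dist \<Rightarrow> 'n dist" where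
  "e_plus v =
     (let g = (SOME g. square_integrable_on half_space g
                  \<and> v = regular_dist (test_functions half_space) half_space g)
      in regular_dist schwartz_space UNIV (\<lambda>x. if x \<in> half_space then g x else 0))"

subsection \<open>Function spaces\<close>

definition sobolev :: "real \<Rightarrow> 'n::finite dist set" where
  "sobolev s =
     {u \<in> tempered. dist_mult (\<lambda>\<xi>. of_real (bracket \<xi> powr s)) (dist_fourier u) \<in> L2_Rn}"

definition sobolev_bar :: "real \<Rightarrow> 'n::{finite,linorder} dist set" where
  "sobolev_bar s = r_plus ` sobolev s"

definition sobolev_dot :: "real \<Rightarrow> 'n::{finite,linorder} dist set" where
  "sobolev_dot s = {u \<in> sobolev s. dist_support u \<subseteq> {x. last_coord x \<ge> 0}}"

text \<open>The \<open>a\<close>-transmission space \<open>H\<^sup>a\<^sup>(\<^sup>t\<^sup>)\<close> of the closed half-space. Meaningful for \<open>t \<ge> a\<close>: then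
  \<open>sobolev_bar (t - a) \<subseteq> L2_half\<close>, as required by \<open>e_plus\<close>.\<close>

definition transmission :: "real \<Rightarrow> real \<Rightarrow> 'n::{finite,linorder} dist set" where
  "transmission a t = Xi_plus (- a) ` e_plus ` sobolev_bar (t - a)"

text \<open>The graph of the \<open>L\<^sub>2\<close> Dirichlet realization; its domain consists of distributions on \<open>\<real>\<^sup>n\<close>
  supported in the closed half-space, the usual identification of \<open>u\<close> with \<open>r\<^sup>+ u\<close> being left
  implicit.\<close>

definition dirichlet_realization ::
    "real \<Rightarrow> ('n::{finite,linorder} dist \<Rightarrow> 'n dist) \<Rightarrow> ('n dist \<times> 'n dist) set" where
  "dirichlet_realization a P =
     {(u, r_plus (P u)) | u. u \<in> sobolev_dot a \<and> r_plus (P u) \<in> L2_half}"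

end

theory Submission
  imports Defs "HOL-Probability.Characteristic_Functions" "HOL-Real_Asymp.Real_Asymp"
begin

text \<open>
  Let \<open>\<Xi>\<^sub>-\<^sup>t\<close> have the symbol \<open>(\<langle>\<xi>'\<rangle> - i \<xi>\<^sub>n)\<^sup>t\<close>, so that \<open>(1 - \<Delta>)\<^sup>a = \<Xi>\<^sub>-\<^sup>a \<Xi>\<^sub>+\<^sup>a\<close>. The operators \<open>\<Xi>\<^sub>+\<^sup>t\<close>
  preserve support in the closed half-space, and the \<open>\<Xi>\<^sub>-\<^sup>t\<close> preserve vanishing on the open half-space, so
  that they act on restrictions. Hence \<open>u\<close> in the supported space of order \<open>a\<close> corresponds to the square
  integrable \<open>v = \<Xi>\<^sub>+\<^sup>a u\<close> supported in the closed half-space, with \<open>v = e\<^sup>+ r\<^sup>+ v\<close> and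
  \<open>f = r\<^sup>+ \<Xi>\<^sub>-\<^sup>a v\<close>. Thus \<open>f\<close> has order \<open>s\<close> if and only if \<open>r\<^sup>+ v\<close> has order \<open>s + a\<close>, that is, if and
  only if \<open>u = \<Xi>\<^sub>+\<^sup>-\<^sup>a e\<^sup>+ r\<^sup>+ v\<close> lies in the transmission space of order \<open>s + 2 a\<close>.

  The support properties need no Paley-Wiener theorem: both families of symbols are iterated pointwise limits, under
  uniform polynomial bounds, of linear combinations of exponentials \<open>exp (- i y \<bullet> \<xi>)\<close> with \<open>y\<close> in the closed
  upper (respectively lower) half-space, and these act as translations.
\<close>

text \<open>All arguments run on the frequency side: a Sobolev distribution is
  \<open>spectral h\<close> with \<open>h\<close> measurable and square integrable against a weight,
  operators become pointwise products, and support conditions become the vanishing of integrals.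
  There dominated convergence carries support properties through pointwise limits, so the
  approximating multipliers are controlled by their size alone. The obstacle is a bound uniform
  along the approximation. For t < 0 the binomial coefficients of order t, with alternating signs
  removed, are nonnegative, which bounds all partial sums at once. Other orders are reached by
  multiplying with integer powers of the symbol of order 1, itself a limit of difference quotients.
  Extension by zero is defined through functions, Sobolev order through transforms, so Plancherel is
  needed in both directions. That extension by zero recovers v rests on v being a function and the
  boundary a null set. The condition s \<ge> -a makes s + a \<ge> 0, so that extension by zero acts
  on square integrable functions.\<close>

section \<open>The weight \<open>bracket\<close> and its integrability\<close>

lemma one_le_bracket: "1 \<le> bracket x"
  by (simp add: bracket_def)

lemma bracket_pos [simp]: "0 < bracket x"
  using one_le_bracket[of x] by linarith

lemma bracket_nonzero [simp]: "bracket x \<noteq> 0"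
  using bracket_pos[of x] by linarith

lemma bracket_nonneg [simp]: "0 \<le> bracket x"
  using bracket_pos[of x] by linarith

lemma norm_le_bracket: "norm x \<le> bracket x"
  by (simp add: bracket_def real_le_rsqrt)

lemma component_le_bracket: "\<bar>x $ i\<bar> \<le> bracket x"
  using component_le_norm_cart[of x i] norm_le_bracket[of x] by linarith

lemma bracket_sq: "(bracket x)\<^sup>2 = 1 + (norm x)\<^sup>2"
  by (simp add: bracket_def)

text \<open>A crude Peetre inequality: the bracket is subadditive, and each summand is at most the
  product because both brackets are at least 1. It compares weights at neighbouring points.\<close>

lemma bracket_add_le: "bracket (x + y) \<le> 2 * bracket x * bracket y"
proof -
  have "(bracket (x+y))\<^sup>2 \<le> 1 + (norm x + norm y)\<^sup>2"
    by (simp add: bracket_sq norm_triangle_ineq power_mono)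
  also have "\<dots> \<le> (bracket x + bracket y)\<^sup>2"
    using mult_mono[OF norm_le_bracket[of x] norm_le_bracket[of y]]
    by (simp add: power2_sum bracket_sq)
  finally have "bracket (x+y) \<le> bracket x + bracket y"
    by (rule power2_le_imp_le) (simp add: add_nonneg_nonneg)
  also have "\<dots> \<le> bracket x * bracket y + bracket x * bracket y"
    using one_le_bracket[of x] one_le_bracket[of y]
    by (intro add_mono) (simp_all add: mult_le_cancel_left1 mult_le_cancel_right1 )
  finally show ?thesis by simp
qed

lemma bracket_le_one_plus_norm: "bracket x \<le> 1 + norm x"
  unfolding bracket_def by (rule real_le_lsqrt) (auto simp: power2_sum)

lemma bracket_minus [simp]: "bracket (- x) = bracket x"
  by (simp add: bracket_def)

lemma bracket_mono: "norm x \<le> norm y \<Longrightarrow> bracket x \<le> bracket y"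
  by (simp add: bracket_def power_mono)

lemma continuous_bracket [continuous_intros]: "continuous_on A bracket"
  unfolding bracket_def by (intro continuous_intros)

lemma measurable_bracket [measurable]: "bracket \<in> borel_measurable borel"
  by (intro borel_measurable_continuous_onI continuous_intros)

lemma measurable_vec_nth [measurable]: "(\<lambda>x::real^'n::finite. x $ i) \<in> borel_measurable borel"
  by (intro borel_measurable_continuous_onI continuous_intros)

text \<open>\<open>lborel\<close> is the image of a product measure indexed by \<open>Basis\<close>;
  the bijection \<open>i \<mapsto> axis i 1\<close>, with inverse \<open>axis_index\<close>, turns
  products over basis vectors into products over coordinates.\<close>

lemma prod_integral_cart:
  fixes f :: "'n::finite \<Rightarrow> real \<Rightarrow> 'b::{real_normed_field,banach,second_countable_topology}"
  assumes f: "\<And>i. integrable lborel (f i)"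
  shows "integrable lborel (\<lambda>x::real^'n. \<Prod>i\<in>UNIV. f i (x $ i))"
    and "(LINT x|lborel. (\<Prod>i\<in>UNIV. f i ((x::real^'n) $ i))) = (\<Prod>i\<in>UNIV. LINT t|lborel. f i t)"
proof -
  interpret product_sigma_finite "\<lambda>b::real^'n. lborel :: real measure"
    by standard
  define g where "g b = f (axis_index b)" for b :: "real^'n"
  have inj: "inj (\<lambda>i::'n. axis i (1::real))"
    by (auto simp: inj_on_def axis_eq_axis)
  have B: "(Basis :: (real^'n) set) = (\<lambda>i. axis i 1) ` UNIV"
    by (auto simp: Basis_vec_def)
  have ga: "g (axis i 1) = f i" for i
    unfolding g_def using inj by (simp add: axis_index_def axis_eq_axis)
  have P: "(\<Prod>b\<in>Basis. h (axis_index b) b) = (\<Prod>i\<in>UNIV. h i (axis i 1))"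
    for h :: "'n \<Rightarrow> real^'n \<Rightarrow> 'b"
    unfolding B by (subst prod.reindex[OF inj]) (simp add: axis_index_def axis_eq_axis)
  have m[measurable]: "f i \<in> borel_measurable borel" for i
    using borel_measurable_integrable[OF f[of i]] by simp
  have nth: "(\<Sum>b\<in>Basis. y b *\<^sub>R b) $ i = y (axis i 1)" for y :: "real^'n \<Rightarrow> real" and i
  proof -
    have "(\<Sum>b\<in>Basis. y b *\<^sub>R b) $ i = (\<Sum>b\<in>Basis. y b *\<^sub>R b) \<bullet> axis i 1"
      by (simp add: inner_axis)
    also have "\<dots> = y (axis i 1)"
      by (subst inner_sum_left_Basis) (auto simp: B)
    finally show ?thesis .
  qed
  have eq: "(\<Prod>i\<in>UNIV. f i ((\<Sum>b\<in>Basis. y b *\<^sub>R b) $ i)) = (\<Prod>b\<in>Basis. g b (y b))" for y :: "real^'n \<Rightarrow> real"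
    unfolding nth using P[of "\<lambda>i b. f i (y b)"] by (simp add: g_def)
  have gi: "integrable lborel (g b)" for b
    by (simp add: g_def f)
  have ms: "(\<lambda>x::real^'n. \<Prod>i\<in>UNIV. f i (x $ i)) \<in> borel_measurable borel"
    by measurable
  have ms2: "(\<lambda>y. \<Sum>b\<in>Basis. y b *\<^sub>R b) \<in> (\<Pi>\<^sub>M b\<in>Basis. lborel) \<rightarrow>\<^sub>M (borel :: (real^'n) measure)"
    by measurable
  show "integrable lborel (\<lambda>x::real^'n. \<Prod>i\<in>UNIV. f i (x $ i))"
    apply (subst lborel_eq, subst integrable_distr_eq[OF ms2 ms])
    unfolding eq by (rule product_integrable_prod) (auto simp: gi)
  show "(LINT x|lborel. (\<Prod>i\<in>UNIV. f i ((x::real^'n) $ i))) = (\<Prod>i\<in>UNIV. LINT t|lborel. f i t)"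
    apply (subst lborel_eq, subst integral_distr[OF ms2 ms])
    unfolding eq
    apply (subst product_integral_prod)
    using P[of "\<lambda>i b. LINT t|lborel. f i t"] by (auto simp: f g_def)
qed

lemma integrable_inverse_one_plus_sq: "integrable lborel (\<lambda>t::real. 1 / (1 + t\<^sup>2))"
proof -
  have "set_integrable lborel (einterval (-\<infinity>) \<infinity>) (\<lambda>t::real. 1 / (1 + t\<^sup>2))"
  proof (rule interval_integral_FTC_nonneg[where F=arctan and A="-pi/2" and B="pi/2"])
    show "DERIV arctan x :> 1 / (1 + x\<^sup>2)" for x :: real
      using DERIV_arctan[of x] by (simp add: inverse_eq_divide)
    show "isCont (\<lambda>t. 1 / (1 + t\<^sup>2)) x" for x :: real
      by (intro continuous_intros) (metis add_nonneg_eq_0_iff zero_le_one zero_le_power2 zero_neq_one)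
    show "((arctan \<circ> real_of_ereal) \<longlongrightarrow> - pi / 2) (at_right (- \<infinity>))"
      unfolding ereal_tendsto_simps using tendsto_arctan_at_bot by simp
    show "((arctan \<circ> real_of_ereal) \<longlongrightarrow> pi / 2) (at_left \<infinity>)"
      unfolding ereal_tendsto_simps using tendsto_arctan_at_top by simp
  qed auto
  then show ?thesis
    by (simp add: set_integrable_def)
qed

text \<open>Each factor \<open>1 + (x $ i)\<^sup>2\<close> is at most
  \<open>(bracket x)\<^sup>2\<close>, so with the exponent \<open>2 * CARD('n)\<close> the weight is
  dominated by a product of one-dimensional integrable functions. This is the origin of
  \<open>2 * CARD('n)\<close> in the decay estimates below.\<close>

lemma integrable_bracket_weight:
  "integrable lborel (\<lambda>x::real^'n::finite. 1 / bracket x ^ (2 * CARD('n)))"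
proof (rule Bochner_Integration.integrable_bound)
  show "integrable lborel (\<lambda>x::real^'n. \<Prod>i\<in>UNIV. 1 / (1 + (x $ i)\<^sup>2))"
    by (rule prod_integral_cart(1)) (rule integrable_inverse_one_plus_sq)
  show "(\<lambda>x::real^'n. 1 / bracket x ^ (2 * CARD('n))) \<in> borel_measurable lborel"
    by measurable
  show "AE x in lborel. norm (1 / bracket x ^ (2 * CARD('n))) \<le> norm (\<Prod>i\<in>UNIV. 1 / (1 + ((x::real^'n) $ i)\<^sup>2))"
  proof (rule AE_I2)
    fix x :: "real^'n"
    have "(\<Prod>i\<in>(UNIV::'n set). 1 / (bracket x)\<^sup>2) \<le> (\<Prod>i\<in>UNIV. 1 / (1 + (x $ i)\<^sup>2))"
      by (intro prod_mono)
        (auto simp: bracket_sq field_simps add_pos_nonneg intro!: power2_le_iff_abs_le[THEN iffD2] component_le_norm_cart )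
    then show "norm (1 / bracket x ^ (2 * CARD('n))) \<le> norm (\<Prod>i\<in>UNIV. 1 / (1 + (x $ i)\<^sup>2))"
      by (simp add: power_mult power_one_over prod_nonneg abs_of_nonneg)
  qed
qed

lemma integrable_bracket_decay:
  fixes f :: "real^'n::finite \<Rightarrow> complex"
  assumes [measurable]: "f \<in> borel_measurable borel"
    and C: "\<And>x. norm (f x) * bracket x ^ (2 * CARD('n)) \<le> C"
  shows "integrable lborel f"
    "norm (LINT x|lborel. f x) \<le> C * (LINT x|lborel. 1 / bracket (x::real^'n) ^ (2 * CARD('n)))"
proof -
  have b: "norm (f x) \<le> C * (1 / bracket x ^ (2 * CARD('n)))" for x
    using C[of x] by (simp add: field_simps)
  have i: "integrable lborel (\<lambda>x::real^'n. C * (1 / bracket x ^ (2 * CARD('n))))"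
    by (intro integrable_mult_right integrable_bracket_weight)
  have b': "norm (f x) \<le> norm (C * (1 / bracket x ^ (2 * CARD('n))))" for x
    using b[of x] by (metis abs_ge_self order_trans real_norm_def)
  show "integrable lborel f"
    by (rule Bochner_Integration.integrable_bound[OF i]) (use b' in \<open>auto simp del: norm_mult\<close>)
  then have "(LINT x|lborel. norm (f x)) \<le> (LINT x|lborel. C * (1 / bracket (x::real^'n) ^ (2 * CARD('n))))"
    by (intro integral_mono i integrable_norm b)
  with integral_norm_bound[of lborel f]
  have "norm (LINT x|lborel. f x) \<le> (LINT x|lborel. C * (1 / bracket (x::real^'n) ^ (2 * CARD('n))))"
    by linarith
  then show "norm (LINT x|lborel. f x) \<le> C * (LINT x|lborel. 1 / bracket (x::real^'n) ^ (2 * CARD('n)))"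
    by (simp only: Bochner_Integration.integral_mult_right_zero)
qed

section \<open>Square integrable functions\<close>

lemma square_integrable_UNIV:
  "square_integrable_on UNIV g \<longleftrightarrow> g \<in> borel_measurable borel \<and> integrable lborel (\<lambda>x. (norm (g x))\<^sup>2)"
  by (simp add: square_integrable_on_def set_integrable_def)

lemma square_integrable_bound:
  assumes "square_integrable_on UNIV g" "f \<in> borel_measurable borel"
    and "\<And>x. norm (f x) \<le> C * norm (g x)"
  shows "square_integrable_on UNIV f"
proof -
  have [measurable]: "f \<in> borel_measurable borel" by fact
  have "integrable lborel (\<lambda>x. (norm (f x))\<^sup>2)"
  proof (rule Bochner_Integration.integrable_bound)
    show "integrable lborel (\<lambda>x. C\<^sup>2 * (norm (g x))\<^sup>2)"
      using assms(1) by (simp add: square_integrable_UNIV)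
    show "AE x in lborel. norm ((norm (f x))\<^sup>2) \<le> norm (C\<^sup>2 * (norm (g x))\<^sup>2)"
      using assms(3) power_mono[OF assms(3), of _ 2] by (auto simp: power_mult_distrib)
  qed simp
  with assms show ?thesis by (simp add: square_integrable_UNIV)
qed

lemma square_integrable_add:
  assumes "square_integrable_on UNIV f" "square_integrable_on UNIV g"
  shows "square_integrable_on UNIV (\<lambda>x. f x + g x)"
proof -
  have [measurable]: "f \<in> borel_measurable borel" "g \<in> borel_measurable borel"
    using assms by (auto simp: square_integrable_UNIV)
  have "integrable lborel (\<lambda>x. (norm (f x + g x))\<^sup>2)"
  proof (rule Bochner_Integration.integrable_bound)
    show "integrable lborel (\<lambda>x. 2 * (norm (f x))\<^sup>2 + 2 * (norm (g x))\<^sup>2)"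
      using assms by (simp add: square_integrable_UNIV)
    have "(norm (f x + g x))\<^sup>2 \<le> 2 * (norm (f x))\<^sup>2 + 2 * (norm (g x))\<^sup>2" for x
    proof -
      have "(norm (f x + g x))\<^sup>2 \<le> (norm (f x) + norm (g x))\<^sup>2"
        by (simp add: norm_triangle_ineq power_mono)
      also have "\<dots> \<le> 2 * (norm (f x))\<^sup>2 + 2 * (norm (g x))\<^sup>2"
        using sum_squares_bound[of "norm (f x)" "norm (g x)"] by (simp add: power2_sum)
      finally show ?thesis .
    qed
    then show "AE x in lborel. norm ((norm (f x + g x))\<^sup>2) \<le> norm (2 * (norm (f x))\<^sup>2 + 2 * (norm (g x))\<^sup>2)"
      by (auto intro!: AE_I2)
  qed simp
  then show ?thesis by (simp add: square_integrable_UNIV)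
qed

lemma square_integrable_mult:
  assumes "square_integrable_on UNIV f" "square_integrable_on UNIV g"
  shows "integrable lborel (\<lambda>x. f x * g x)"
proof (rule Bochner_Integration.integrable_bound)
  have [measurable]: "f \<in> borel_measurable borel" "g \<in> borel_measurable borel"
    using assms by (auto simp: square_integrable_UNIV)
  show "integrable lborel (\<lambda>x. (norm (f x))\<^sup>2 + (norm (g x))\<^sup>2)"
    using assms by (simp add: square_integrable_UNIV)
  show "(\<lambda>x. f x * g x) \<in> borel_measurable lborel" by measurable
  have "norm (f x * g x) \<le> (norm (f x))\<^sup>2 + (norm (g x))\<^sup>2" for x
    using sum_squares_bound[of "norm (f x)" "norm (g x)"]
      mult_nonneg_nonneg[OF norm_ge_zero[of "f x"] norm_ge_zero[of "g x"]]
    unfolding norm_mult by linarith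
  then show "AE x in lborel. norm (f x * g x) \<le> norm ((norm (f x))\<^sup>2 + (norm (g x))\<^sup>2)"
    by (auto intro!: AE_I2)
qed

lemma square_integrable_cmult:
  assumes "square_integrable_on UNIV f"
  shows "square_integrable_on UNIV (\<lambda>x. c * f x)"
  by (rule square_integrable_bound[OF assms, of _ "norm c"])
    (use assms in \<open>auto simp: square_integrable_UNIV norm_mult\<close>)

lemma square_integrable_decay:
  fixes f :: "real^'n::finite \<Rightarrow> complex"
  assumes [measurable]: "f \<in> borel_measurable borel"
    and C: "\<And>x. norm (f x) * bracket x ^ CARD('n) \<le> C"
  shows "square_integrable_on UNIV f"
proof -
  have "norm (of_real ((norm (f x))\<^sup>2) :: complex) * bracket x ^ (2 * CARD('n)) \<le> C\<^sup>2" for x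
    using power_mono[OF C[of x], of 2]
    by (simp add: power_mult_distrib power_mult[symmetric] mult.commute del: of_real_power)
  then have "integrable lborel (\<lambda>x. of_real ((norm (f x))\<^sup>2) :: complex)"
    by (intro integrable_bracket_decay(1)) auto
  then show ?thesis by (simp add: square_integrable_UNIV complex_of_real_integrable_eq del: of_real_power)
qed

section \<open>Affine substitutions in Lebesgue integrals\<close>

lemma nn_integral_affine:
  fixes f :: "'a::euclidean_space \<Rightarrow> ennreal"
  assumes [measurable]: "f \<in> borel_measurable borel" and c: "c \<noteq> 0"
  shows "(\<integral>\<^sup>+x. f x \<partial>lborel) = ennreal (\<bar>c\<bar> ^ DIM('a)) * (\<integral>\<^sup>+x. f (t + c *\<^sub>R x) \<partial>lborel)"
  by (subst lborel_affine[OF c, of t]) (simp add: nn_integral_density nn_integral_distr nn_integral_cmult)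

lemma integrable_affine:
  fixes f :: "'a::euclidean_space \<Rightarrow> 'b::{banach,second_countable_topology}"
  assumes "integrable lborel f" and "c \<noteq> 0"
  shows "integrable lborel (\<lambda>x. f (t + c *\<^sub>R x))"
  using assms(1) assms(1)[THEN borel_measurable_integrable] \<open>c \<noteq> 0\<close> unfolding integrable_iff_bounded
  by (subst (asm) nn_integral_affine[where c=c and t=t]) (auto simp: ennreal_mult_less_top)

lemma integral_affine:
  fixes f :: "'a::euclidean_space \<Rightarrow> 'b::{banach,second_countable_topology}"
  assumes c: "c \<noteq> 0"
  shows "integrable lborel (\<lambda>x. f (t + c *\<^sub>R x)) \<longleftrightarrow> integrable lborel f"
    and "(LINT x|lborel. f x) = \<bar>c\<bar> ^ DIM('a) *\<^sub>R (LINT x|lborel. f (t + c *\<^sub>R x))"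
proof -
  show i: "integrable lborel (\<lambda>x. f (t + c *\<^sub>R x)) \<longleftrightarrow> integrable lborel f"
    using integrable_affine[of f c t] integrable_affine[of "\<lambda>x. f (t + c *\<^sub>R x)" "1/c" "- t /\<^sub>R c"] c
    by (auto simp: algebra_simps inverse_eq_divide)
  show "(LINT x|lborel. f x) = \<bar>c\<bar> ^ DIM('a) *\<^sub>R (LINT x|lborel. f (t + c *\<^sub>R x))"
  proof (cases "integrable lborel f")
    case True
    then have [measurable]: "f \<in> borel_measurable borel" by auto
    show ?thesis
      by (subst lborel_affine[OF c, of t]) (simp add: integral_density integral_distr)
  next
    \<comment> \<open>The integral of a non-integrable function is 0 by default, so both sides
      vanish and the substitution rule holds for every \<open>f\<close>.\<close>
    case False
    with i show ?thesis by (simp add: not_integrable_integral_eq)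
  qed
qed

subsection \<open>Schwartz functions and symbols\<close>

lemma partial_eqI: "(f has_derivative D) (at x) \<Longrightarrow> partial i f x = D (axis i 1)"
  unfolding partial_def using frechet_derivative_at by metis

lemma differentiable_has_derivative: "f differentiable (at x) \<Longrightarrow> (f has_derivative frechet_derivative f (at x)) (at x)"
  using frechet_derivative_works by blast

lemma partial_const [simp]: "partial i (\<lambda>x. c) = (\<lambda>x. 0)"
  by (rule ext, rule partial_eqI[THEN trans]) (auto intro!: derivative_eq_intros)

lemma partial_add:
  assumes "\<And>x. f differentiable (at x)" "\<And>x. g differentiable (at x)"
  shows "partial i (\<lambda>x. f x + g x) = (\<lambda>x. partial i f x + partial i g x)"
  by (rule ext, rule partial_eqI[THEN trans])
    (auto intro!: derivative_eq_intros differentiable_has_derivative assms simp: partial_def)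

lemma partial_mult:
  assumes "\<And>x. f differentiable (at x)" "\<And>x. g differentiable (at x)"
  shows "partial i (\<lambda>x. f x * g x) = (\<lambda>x. partial i f x * g x + f x * partial i g x)"
  by (rule ext, rule partial_eqI[THEN trans])
    (auto intro!: derivative_eq_intros differentiable_has_derivative assms simp: partial_def)

lemma has_derivative_coord [derivative_intros]:
  "((\<lambda>x. complex_of_real (x $ j)) has_derivative (\<lambda>h. complex_of_real (h $ j))) (at x within s)"
  by (intro bounded_linear_imp_has_derivative bounded_linear_compose[OF bounded_linear_of_real bounded_linear_vec_nth])

lemma partials_Nil [simp]: "partials [] f = f"
  and partials_Cons [simp]: "partials (i # js) f = partial i (partials js f)"
  and partials_append: "partials (is @ js) f = partials is (partials js f)"
  by (simp_all add: partials_def)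

lemma partials_snoc: "partials (js @ [i]) f = partials js (partial i f)"
  by (simp add: partials_append)

lemma smooth_differentiable: "smooth f \<Longrightarrow> f differentiable (at x)"
  unfolding smooth_def using partials_Nil by metis

lemma smooth_partial: "smooth f \<Longrightarrow> smooth (partial i f)"
  unfolding smooth_def partials_snoc[symmetric] by blast

text \<open>Smoothness quantifies over all iterated partial derivatives; a set that is closed under
  \<open>partial\<close> contains them all. This replaces closed formulas for iterated
  derivatives.\<close>

lemma smooth_coinduct:
  assumes "f \<in> A" and d: "\<And>g x. g \<in> A \<Longrightarrow> g differentiable (at x)"
    and p: "\<And>g i. g \<in> A \<Longrightarrow> partial i g \<in> A"
  shows "smooth f"
proof -
  have "partials js f \<in> A" for js
    by (induction js) (auto simp: assms)
  then show ?thesis using d by (auto simp: smooth_def)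
qed

text \<open>As for \<open>smooth_coinduct\<close>. Decay is asked of the members of \<open>A\<close>
  themselves, since their derivatives are members again.\<close>

lemma schwartz_coinduct:
  assumes "f \<in> A" and d: "\<And>g x. g \<in> A \<Longrightarrow> g differentiable (at x)"
    and p: "\<And>g i. g \<in> A \<Longrightarrow> partial i g \<in> A"
    and b: "\<And>g m. g \<in> A \<Longrightarrow> \<exists>C. \<forall>x. norm (g x) * bracket x ^ m \<le> C"
  shows "f \<in> schwartz_space"
proof -
  have A: "partials js f \<in> A" for js
    by (induction js) (auto simp: assms)
  have "bdd_above (range (\<lambda>x. norm x ^ k * norm (partials js f x)))" for k js
  proof -
    obtain C where C: "\<And>x. norm (partials js f x) * bracket x ^ k \<le> C"
      using b[OF A] by blast
    have "norm x ^ k * norm (partials js f x) \<le> C" for x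
    proof -
      have "norm x ^ k * norm (partials js f x) \<le> bracket x ^ k * norm (partials js f x)"
        by (intro mult_right_mono power_mono norm_le_bracket) auto
      with C[of x] show ?thesis by (simp add: mult.commute)
    qed
    then show ?thesis by (auto intro!: bdd_aboveI2)
  qed
  moreover have "smooth f" by (rule smooth_coinduct[OF assms(1-3)])
  ultimately show ?thesis by (simp add: schwartz_space_def)
qed

lemma schwartz_differentiable: "f \<in> schwartz_space \<Longrightarrow> f differentiable (at x)"
  by (simp add: schwartz_space_def smooth_differentiable)

lemma schwartz_partial: "f \<in> schwartz_space \<Longrightarrow> partial i f \<in> schwartz_space"
  unfolding schwartz_space_def by (simp add: smooth_partial partials_snoc[symmetric])

lemma schwartz_partials: "f \<in> schwartz_space \<Longrightarrow> partials js f \<in> schwartz_space"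
  by (induction js) (auto simp: schwartz_partial)

lemma schwartz_continuous: "f \<in> schwartz_space \<Longrightarrow> continuous_on A f"
  by (intro continuous_at_imp_continuous_on) (simp add: schwartz_differentiable differentiable_imp_continuous_within)

lemma schwartz_measurable: "f \<in> schwartz_space \<Longrightarrow> f \<in> borel_measurable borel"
  by (intro borel_measurable_continuous_onI schwartz_continuous)

lemma schwartz_seminorm_bound:
  assumes "f \<in> schwartz_space"
  shows "norm x ^ k * norm (partials js f x) \<le> schwartz_seminorm k js f"
  unfolding schwartz_seminorm_def using assms by (intro cSUP_upper) (auto simp: schwartz_space_def)

lemma schwartz_seminorm_nonneg:
  assumes "f \<in> schwartz_space"
  shows "0 \<le> schwartz_seminorm k js f"
  using schwartz_seminorm_bound[OF assms, of 0 k js] by (meson mult_nonneg_nonneg norm_ge_zero order_trans zero_le_power)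

lemma schwartz_decay_seminorm:
  assumes "f \<in> schwartz_space"
  shows "norm (partials js f x) * bracket x ^ m \<le> 2 ^ m * (schwartz_seminorm 0 js f + schwartz_seminorm m js f)"
proof -
  \<comment> \<open>\<open>1 + norm x\<close> is at most twice the larger of 1 and
    \<open>norm x\<close>; this splits the power into the two seminorms at the cost of
    \<open>2 ^ m\<close>.\<close>
  have "bracket x ^ m \<le> (2 * max 1 (norm x)) ^ m"
    using bracket_le_one_plus_norm[of x] by (intro power_mono) auto
  also have "\<dots> \<le> 2 ^ m * (1 + norm x ^ m)"
    by (auto simp: max_def power_mult_distrib)
  finally have "norm (partials js f x) * bracket x ^ m \<le> norm (partials js f x) * (2 ^ m * (1 + norm x ^ m))"
    by (intro mult_left_mono) auto
  also have "\<dots> = 2 ^ m * (norm x ^ 0 * norm (partials js f x) + norm x ^ m * norm (partials js f x))"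
    by (simp add: algebra_simps)
  also have "\<dots> \<le> 2 ^ m * (schwartz_seminorm 0 js f + schwartz_seminorm m js f)"
    by (intro mult_left_mono add_mono schwartz_seminorm_bound assms) auto
  finally show ?thesis .
qed

lemma schwartz_decay:
  assumes "f \<in> schwartz_space"
  obtains C where "\<And>x. norm (f x) * bracket x ^ m \<le> C"
  using schwartz_decay_seminorm[OF assms, of "[]" _ m] by auto

lemma schwartz_integrable: "f \<in> schwartz_space \<Longrightarrow> integrable lborel f"
  by (meson integrable_bracket_decay(1) schwartz_decay schwartz_measurable)

lemma schwartz_square_integrable: "f \<in> schwartz_space \<Longrightarrow> square_integrable_on UNIV f"
  by (meson square_integrable_decay schwartz_decay schwartz_measurable)

section \<open>A class of symbols that multiply the Schwartz space\<close>

text \<open>The rules generate all symbols in use and give a class closed under partial derivatives.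
  Requiring real part at least 1 in \<open>powr\<close> keeps the base off the branch cut, where the
  principal power is differentiable, and its modulus at least 1, where real exponents can be rounded
  up.\<close>

inductive_set symbols :: "(real ^ 'n::finite \<Rightarrow> complex) set" where
  const: "(\<lambda>x. c) \<in> symbols"
| coord: "(\<lambda>x. complex_of_real (x $ i)) \<in> symbols"
| add: "f \<in> symbols \<Longrightarrow> g \<in> symbols \<Longrightarrow> (\<lambda>x. f x + g x) \<in> symbols"
| mult: "f \<in> symbols \<Longrightarrow> g \<in> symbols \<Longrightarrow> (\<lambda>x. f x * g x) \<in> symbols"
| powr: "f \<in> symbols \<Longrightarrow> (\<And>x. 1 \<le> Re (f x)) \<Longrightarrow> (\<lambda>x. f x powr complex_of_real s) \<in> symbols"

lemma has_derivative_powr_of_real: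
  fixes f :: "'a::real_normed_vector \<Rightarrow> complex"
  assumes "(f has_derivative D) (at x)" "0 < Re (f x)"
  shows "((\<lambda>x. f x powr s) has_derivative (\<lambda>h. s * f x powr (s - 1) * D h)) (at x)"
proof -
  have "((\<lambda>z. z powr s) has_field_derivative s * f x powr (s - 1)) (at (f x))"
    using assms(2) by (intro has_field_derivative_powr) (auto simp: complex_nonpos_Reals_iff)
  from has_derivative_compose[OF assms(1) this[unfolded has_field_derivative_def]] show ?thesis
    by simp
qed

lemma symbol_differentiable: "f \<in> symbols \<Longrightarrow> f differentiable (at x)"
proof (induction rule: symbols.induct)
  case (coord i)
  show ?case using has_derivative_coord differentiable_def by blast
next
  case (powr f s)
  have "0 < Re (f x)" using powr(2)[of x] by linarith
  with powr show ?case
    using has_derivative_powr_of_real differentiable_def by blast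
qed auto

lemma symbol_partial: "f \<in> symbols \<Longrightarrow> partial i f \<in> symbols"
proof (induction rule: symbols.induct)
  case (const c)
  show ?case by (simp add: symbols.const)
next
  case (coord j)
  have "partial i (\<lambda>x::real^'a. complex_of_real (x $ j)) = (\<lambda>x. of_real (axis i 1 $ j))"
    by (rule ext, rule partial_eqI[THEN trans, OF has_derivative_coord]) simp
  then show ?case by (simp add: symbols.const)
next
  case (add f g)
  then show ?case by (simp add: partial_add symbol_differentiable symbols.add)
next
  case (mult f g)
  then show ?case by (simp add: partial_mult symbol_differentiable symbols.add symbols.mult)
next
  case (powr f s)
  have p: "0 < Re (f x)" for x using powr(2)[of x] by linarith
  have "partial i (\<lambda>x. f x powr complex_of_real s) = (\<lambda>x. (of_real s * f x powr of_real (s - 1)) * partial i f x)"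
    by (rule ext, rule partial_eqI[THEN trans, OF has_derivative_powr_of_real[OF differentiable_has_derivative]])
      (auto simp: symbol_differentiable powr p partial_def)
  then show ?case
    using powr symbols.powr[OF powr(1,2), of "s - 1"]
    by (simp add: symbols.mult symbols.const del: of_real_diff)
qed

lemma symbol_bound: "f \<in> symbols \<Longrightarrow> \<exists>C m. \<forall>x. norm (f x) \<le> C * bracket x ^ m"
proof (induction rule: symbols.induct)
  case (const c)
  show ?case by (intro exI[of _ "norm c"] exI[of _ 0]) auto
next
  case (coord i)
  show ?case by (intro exI[of _ 1]) (auto simp: component_le_bracket)
next
  case (add f g)
  from add.IH(1) obtain C m where C: "\<And>x. norm (f x) \<le> C * bracket x ^ m" by blast
  from add.IH(2) obtain D k where D: "\<And>x. norm (g x) \<le> D * bracket x ^ k" by blast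
  have "norm (f x + g x) \<le> (\<bar>C\<bar> + \<bar>D\<bar>) * bracket x ^ (m + k)" for x
  proof -
    have "norm (f x + g x) \<le> norm (f x) + norm (g x)" by (rule norm_triangle_ineq)
    also have "\<dots> \<le> \<bar>C\<bar> * bracket x ^ m + \<bar>D\<bar> * bracket x ^ k"
      by (intro add_mono order_trans[OF C] order_trans[OF D] mult_right_mono) auto
    also have "\<dots> \<le> \<bar>C\<bar> * bracket x ^ (m + k) + \<bar>D\<bar> * bracket x ^ (m + k)"
      by (intro add_mono mult_left_mono power_increasing one_le_bracket) auto
    finally show ?thesis by (simp add: algebra_simps)
  qed
  then show ?case by blast
next
  case (mult f g)
  from mult.IH(1) obtain C m where C: "\<And>x. norm (f x) \<le> C * bracket x ^ m" by blast
  from mult.IH(2) obtain D k where D: "\<And>x. norm (g x) \<le> D * bracket x ^ k" by blast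
  have "norm (f x * g x) \<le> (\<bar>C\<bar> * \<bar>D\<bar>) * bracket x ^ (m + k)" for x
  proof -
    have "norm (f x * g x) \<le> (\<bar>C\<bar> * bracket x ^ m) * (\<bar>D\<bar> * bracket x ^ k)"
      unfolding norm_mult
      by (intro mult_mono order_trans[OF C] order_trans[OF D] mult_right_mono) auto
    then show ?thesis by (simp add: algebra_simps power_add)
  qed
  then show ?case by blast
next
  case (powr f s)
  then obtain C m where C: "\<And>x. norm (f x) \<le> C * bracket x ^ m" by blast
  \<comment> \<open>Since \<open>norm (f x)\<close> is at least 1, its power \<open>s\<close> is at
    most its power \<open>k\<close>, also for negative \<open>s\<close>.\<close>
  define k where "k = nat \<lceil>\<bar>s\<bar>\<rceil>"
  have "norm (f x powr complex_of_real s) \<le> \<bar>C\<bar> ^ k * bracket x ^ (m * k)" for x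
  proof -
    have 1: "1 \<le> norm (f x)" using powr(2)[of x] complex_Re_le_cmod[of "f x"] by linarith
    have "norm (f x powr complex_of_real s) = norm (f x) powr s"
      by (simp add: norm_powr_real_powr' )
    also have "\<dots> \<le> norm (f x) powr real k"
      using 1 by (intro powr_mono) (auto simp: k_def abs_le_iff intro: order_trans[OF abs_ge_self le_of_int_ceiling])
    also have "\<dots> = norm (f x) ^ k" using 1 by (intro powr_realpow) linarith
    also have "\<dots> \<le> (\<bar>C\<bar> * bracket x ^ m) ^ k"
      by (intro power_mono order_trans[OF C] mult_right_mono) auto
    finally show ?thesis by (simp add: power_mult_distrib power_mult)
  qed
  then show ?case by blast
qed

text \<open>Sums are included since the coinduction needs a set closed under partial derivatives.\<close>

inductive_set symbol_schwartz :: "(real ^ 'n::finite \<Rightarrow> complex) set" where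
  prod: "p \<in> symbols \<Longrightarrow> f \<in> schwartz_space \<Longrightarrow> (\<lambda>x. p x * f x) \<in> symbol_schwartz"
| sum: "f \<in> symbol_schwartz \<Longrightarrow> g \<in> symbol_schwartz \<Longrightarrow> (\<lambda>x. f x + g x) \<in> symbol_schwartz"

lemma symbol_schwartz_differentiable: "f \<in> symbol_schwartz \<Longrightarrow> f differentiable (at x)"
  by (induction rule: symbol_schwartz.induct) (auto simp: symbol_differentiable schwartz_differentiable)

lemma symbol_schwartz_subset: "f \<in> symbol_schwartz \<Longrightarrow> f \<in> schwartz_space"
proof (rule schwartz_coinduct[of _ symbol_schwartz])
  fix g i assume "g \<in> symbol_schwartz"
  then show "partial i g \<in> symbol_schwartz"
  proof (induction rule: symbol_schwartz.induct)
    case (prod p f)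
    then show ?case
      by (subst partial_mult)
       (auto intro!: symbol_schwartz.sum[OF symbol_schwartz.prod symbol_schwartz.prod] symbol_partial schwartz_partial
          simp: symbol_differentiable schwartz_differentiable)
  next
    case (sum f g)
    then show ?case by (subst partial_add) (auto intro!: symbol_schwartz.sum symbol_schwartz_differentiable)
  qed
next
  fix g m assume "g \<in> symbol_schwartz"
  then show "\<exists>C. \<forall>x. norm (g x) * bracket x ^ m \<le> C"
  proof (induction rule: symbol_schwartz.induct)
    case (prod p f)
    then obtain C k where C: "\<And>x. norm (p x) \<le> C * bracket x ^ k" using symbol_bound by blast
    from prod obtain D where D: "\<And>x. norm (f x) * bracket x ^ (k + m) \<le> D"
      using schwartz_decay[of f "k + m"] by blast
    have "norm (p x * f x) * bracket x ^ m \<le> \<bar>C\<bar> * D" for x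
    proof -
      have "norm (p x * f x) * bracket x ^ m \<le> \<bar>C\<bar> * bracket x ^ k * norm (f x) * bracket x ^ m"
        unfolding norm_mult by (intro mult_right_mono order_trans[OF C]) auto
      also have "\<dots> = \<bar>C\<bar> * (norm (f x) * bracket x ^ (k + m))" by (simp add: power_add)
      also have "\<dots> \<le> \<bar>C\<bar> * D" by (intro mult_left_mono D) auto
      finally show ?thesis .
    qed
    then show ?case by blast
  next
    case (sum f g)
    from sum.IH(1) obtain C where C: "\<And>x. norm (f x) * bracket x ^ m \<le> C" by blast
    from sum.IH(2) obtain D where D: "\<And>x. norm (g x) * bracket x ^ m \<le> D" by blast
    have "norm (f x + g x) * bracket x ^ m \<le> C + D" for x
    proof -
      have "norm (f x + g x) * bracket x ^ m \<le> (norm (f x) + norm (g x)) * bracket x ^ m"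
        by (intro mult_right_mono norm_triangle_ineq) auto
      with C[of x] D[of x] show ?thesis by (simp add: distrib_right)
    qed
    then show ?case by blast
  qed
qed (auto simp: symbol_schwartz_differentiable)

lemma schwartz_symbol_mult: "p \<in> symbols \<Longrightarrow> f \<in> schwartz_space \<Longrightarrow> (\<lambda>x. p x * f x) \<in> schwartz_space"
  by (rule symbol_schwartz_subset[OF symbol_schwartz.prod])

lemma schwartz_cmult: "f \<in> schwartz_space \<Longrightarrow> (\<lambda>x. c * f x) \<in> schwartz_space"
  by (rule schwartz_symbol_mult[OF symbols.const])

lemma schwartz_coord_mult: "f \<in> schwartz_space \<Longrightarrow> (\<lambda>x. of_real (x $ i) * f x) \<in> schwartz_space"
  by (rule schwartz_symbol_mult[OF symbols.coord])

lemma schwartz_add: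
  assumes "f \<in> schwartz_space" "g \<in> schwartz_space"
  shows "(\<lambda>x. f x + g x) \<in> schwartz_space"
  using symbol_schwartz_subset[OF symbol_schwartz.sum[OF symbol_schwartz.prod[OF symbols.const assms(1)] symbol_schwartz.prod[OF symbols.const assms(2)], of 1 1]]
  by simp

lemma symbol_measurable: "f \<in> symbols \<Longrightarrow> f \<in> borel_measurable borel"
  by (intro borel_measurable_continuous_onI continuous_at_imp_continuous_on)
     (simp add: symbol_differentiable differentiable_imp_continuous_within)

section \<open>Affine changes of variables\<close>

lemma partial_affine:
  assumes "\<And>x. f differentiable (at x)"
  shows "partial i (\<lambda>x. f (t + c *\<^sub>R x)) = (\<lambda>x. of_real c * partial i f (t + c *\<^sub>R x))"
    and "(\<lambda>x. f (t + c *\<^sub>R x)) differentiable (at x)"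
proof -
  have d: "((\<lambda>x. f (t + c *\<^sub>R x)) has_derivative (\<lambda>h. frechet_derivative f (at (t + c *\<^sub>R x)) (c *\<^sub>R h))) (at x)" for x
    by (rule has_derivative_compose[OF _ differentiable_has_derivative[OF assms]])
       (auto intro!: derivative_eq_intros)
  then show "(\<lambda>x. f (t + c *\<^sub>R x)) differentiable (at x)" using differentiable_def by blast
  show "partial i (\<lambda>x. f (t + c *\<^sub>R x)) = (\<lambda>x. of_real c * partial i f (t + c *\<^sub>R x))"
    by (rule ext, rule partial_eqI[THEN trans, OF d])
      (simp add: partial_def linear_cmul[OF linear_frechet_derivative[OF assms]] scaleR_conv_of_real[where 'a=complex])
qed

text \<open>The set in the coinduction carries a scalar because every derivative produces a factor
  \<open>c\<close>.\<close>

lemma smooth_affine: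
  assumes "smooth f"
  shows "smooth (\<lambda>x. f (t + c *\<^sub>R x))"
proof (rule smooth_coinduct[of _ "{(\<lambda>x. of_real d * g (t + c *\<^sub>R x)) | d g. smooth g}"])
  show "(\<lambda>x. f (t + c *\<^sub>R x)) \<in> {(\<lambda>x. of_real d * g (t + c *\<^sub>R x)) | d g. smooth g}"
    by (intro CollectI exI[of _ 1] exI[of _ f] conjI assms) simp
next
  fix h x assume "h \<in> {(\<lambda>x. of_real d * g (t + c *\<^sub>R x)) | d g. smooth g}"
  then obtain d g where h: "h = (\<lambda>x. of_real d * g (t + c *\<^sub>R x))" "smooth g" by blast
  show "h differentiable (at x)"
    unfolding h by (intro differentiable_mult differentiable_const partial_affine(2) smooth_differentiable h)
next
  fix h i assume "h \<in> {(\<lambda>x. of_real d * g (t + c *\<^sub>R x)) | d g. smooth g}"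
  then obtain d g where h: "h = (\<lambda>x. of_real d * g (t + c *\<^sub>R x))" "smooth g" by blast
  have "partial i h = (\<lambda>x. of_real (d * c) * partial i g (t + c *\<^sub>R x))"
    unfolding h
    by (subst partial_mult) (simp_all add: partial_affine[OF smooth_differentiable[OF h(2)]] mult.assoc)
  then show "partial i h \<in> {(\<lambda>x. of_real d * g (t + c *\<^sub>R x)) | d g. smooth g}"
    by (intro CollectI exI[of _ "d * c"] exI[of _ "partial i g"] conjI smooth_partial h)
qed

lemma schwartz_reflect:
  assumes "f \<in> schwartz_space"
  shows "(\<lambda>x. f (- x)) \<in> schwartz_space"
proof (rule schwartz_coinduct[of _ "{(\<lambda>x. of_real d * g (- x)) | d g. g \<in> schwartz_space}"])
  show "(\<lambda>x. f (- x)) \<in> {(\<lambda>x. of_real d * g (- x)) | d g. g \<in> schwartz_space}"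
    by (intro CollectI exI[of _ 1] exI[of _ f] conjI assms) simp
next
  fix h x assume "h \<in> {(\<lambda>x. of_real d * g (- x)) | d g. g \<in> schwartz_space}"
  then obtain d g where h: "h = (\<lambda>x. of_real d * g (- x))" "g \<in> schwartz_space" by blast
  have "(\<lambda>x. g (- x)) differentiable (at x)"
    using partial_affine(2)[where t=0 and c="-1" and f=g, OF schwartz_differentiable[OF h(2)]] by simp
  then show "h differentiable (at x)" unfolding h by (intro differentiable_mult differentiable_const)
next
  fix h i assume "h \<in> {(\<lambda>x. of_real d * g (- x)) | d g. g \<in> schwartz_space}"
  then obtain d g where h: "h = (\<lambda>x. of_real d * g (- x))" "g \<in> schwartz_space" by blast
  have "partial i h = (\<lambda>x. of_real (- d) * partial i g (- x))"
    unfolding h using partial_affine[where t=0 and c="-1" and f=g, OF schwartz_differentiable[OF h(2)]]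
    by (subst partial_mult) simp_all
  then show "partial i h \<in> {(\<lambda>x. of_real d * g (- x)) | d g. g \<in> schwartz_space}"
    by (intro CollectI exI[of _ "- d"] exI[of _ "partial i g"] conjI schwartz_partial h)
next
  fix h m assume "h \<in> {(\<lambda>x. of_real d * g (- x)) | d g. g \<in> schwartz_space}"
  then obtain d g where h: "h = (\<lambda>x. of_real d * g (- x))" "g \<in> schwartz_space" by blast
  then obtain C where C: "\<And>x. norm (g x) * bracket x ^ m \<le> C" using schwartz_decay by blast
  have "norm (h x) * bracket x ^ m \<le> \<bar>d\<bar> * C" for x
    using mult_left_mono[OF C[of "- x"], of "\<bar>d\<bar>"] by (simp add: h norm_mult mult.assoc)
  then show "\<exists>C. \<forall>x. norm (h x) * bracket x ^ m \<le> C" by blast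
qed

section \<open>Test functions are Schwartz functions\<close>

lemma partial_support: "closure {x. partial i f x \<noteq> 0} \<subseteq> closure {x. f x \<noteq> 0}"
proof (rule closure_minimal)
  show "{x. partial i f x \<noteq> 0} \<subseteq> closure {x. f x \<noteq> 0}"
  proof (rule subsetI, rule ccontr)
    fix x assume x: "x \<in> {x. partial i f x \<noteq> 0}" "x \<notin> closure {x. f x \<noteq> 0}"
    have "(f has_derivative (\<lambda>h. 0)) (at x)"
    proof (rule has_derivative_transform_within_open[of "\<lambda>x. 0"])
      show "open (- closure {x. f x \<noteq> 0})" by auto
      show "x \<in> - closure {x. f x \<noteq> 0}" using x by auto
      show "0 = f y" if "y \<in> - closure {x. f x \<noteq> 0}" for y
        using that closure_subset[of "{x. f x \<noteq> 0}"] by auto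
    qed simp
    from partial_eqI[OF this] x show False by simp
  qed
qed simp

lemma test_functions_schwartz: "test_functions U \<subseteq> schwartz_space"
proof
  fix f assume f: "f \<in> test_functions U"
  show "f \<in> schwartz_space"
  proof (rule schwartz_coinduct[of _ "test_functions UNIV"])
    show "f \<in> test_functions UNIV" using f by (auto simp: test_functions_def)
  next
    fix g :: "real^'a \<Rightarrow> complex" and x assume "g \<in> test_functions UNIV"
    then show "g differentiable (at x)" by (auto simp: test_functions_def smooth_differentiable)
  next
    fix g :: "real^'a \<Rightarrow> complex" and i assume "g \<in> test_functions UNIV"
    then show "partial i g \<in> test_functions UNIV"
      using compact_Int_closed[of "closure {x. g x \<noteq> 0}" "closure {x. partial i g x \<noteq> 0}"] partial_support[of i g]
      by (auto simp: test_functions_def smooth_partial inf.absorb2)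
  next
    fix g :: "real^'a \<Rightarrow> complex" and m assume g: "g \<in> test_functions UNIV"
    let ?K = "closure {x. g x \<noteq> 0}"
    have "continuous_on ?K (\<lambda>x. norm (g x) * bracket x ^ m)"
      using g by (intro continuous_intros continuous_at_imp_continuous_on)
        (auto simp: test_functions_def smooth_differentiable differentiable_imp_continuous_within)
    then have "compact ((\<lambda>x. norm (g x) * bracket x ^ m) ` ?K)"
      using g by (intro compact_continuous_image) (auto simp: test_functions_def)
    then have "bdd_above ((\<lambda>x. norm (g x) * bracket x ^ m) ` ?K)"
      by (intro bounded_imp_bdd_above compact_imp_bounded)
    then obtain C where C: "\<And>x. x \<in> ?K \<Longrightarrow> norm (g x) * bracket x ^ m \<le> C"
      by (auto simp: bdd_above_def)
    have "norm (g x) * bracket x ^ m \<le> max C 0" for x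
      using C[of x] closure_subset[of "{x. g x \<noteq> 0}"] by (cases "g x = 0") auto
    then show "\<exists>C. \<forall>x. norm (g x) * bracket x ^ m \<le> C" by blast
  qed
qed

subsection \<open>The Fourier transform of Schwartz functions\<close>

lemma integrable_product_bound:
  fixes F :: "real^'n::finite \<Rightarrow> real^'n \<Rightarrow> complex" and f g :: "real^'n \<Rightarrow> real"
  assumes F: "case_prod F \<in> borel_measurable (borel \<Otimes>\<^sub>M borel)"
    and f: "integrable lborel f" and g: "integrable lborel g"
    and b: "\<And>x y. norm (F x y) \<le> f x * g y"
  shows "integrable (lborel \<Otimes>\<^sub>M lborel) (case_prod F)"
proof -
  have [measurable]: "f \<in> borel_measurable borel" "g \<in> borel_measurable borel"
    using f g by auto
  have "integrable (lborel \<Otimes>\<^sub>M lborel) (\<lambda>(x,y). f x * g y)"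
    by (rule lborel_pair.Fubini_integrable) (use f g in \<open>auto simp: abs_mult\<close>)
  then show ?thesis
  proof (rule Bochner_Integration.integrable_bound)
    show "case_prod F \<in> borel_measurable (lborel \<Otimes>\<^sub>M lborel)"
      using F by (simp cong: measurable_cong_sets)
    show "AE x in lborel \<Otimes>\<^sub>M lborel. norm (case_prod F x) \<le> norm (case x of (x, y) \<Rightarrow> f x * g y)"
      using b by (auto intro!: AE_I2 order_trans[OF b])
  qed
qed

lemma Fubini_product_bound:
  fixes F :: "real^'n::finite \<Rightarrow> real^'n \<Rightarrow> complex" and f g :: "real^'n \<Rightarrow> real"
  assumes "case_prod F \<in> borel_measurable (borel \<Otimes>\<^sub>M borel)"
    and "integrable lborel f" and "integrable lborel g"
    and "\<And>x y. norm (F x y) \<le> f x * g y"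
  shows "(LINT y|lborel. LINT x|lborel. F x y) = (LINT x|lborel. LINT y|lborel. F x y)"
proof -
  show ?thesis by (rule lborel_pair.Fubini_integral[OF integrable_product_bound[OF assms]])
qed

lemma norm_exp_i [simp]: "norm (exp (\<i> * complex_of_real t)) = 1" "norm (exp (- (\<i> * complex_of_real t))) = 1"
  using norm_exp_i_times[of t] norm_exp_i_times[of "- t"] by simp_all

lemma integrable_exp_mult:
  fixes f :: "real^'n::finite \<Rightarrow> complex"
  assumes "integrable lborel f"
  shows "integrable lborel (\<lambda>x. exp (- (\<i> * of_real (x \<bullet> y))) * f x)"
proof -
  have [measurable]: "f \<in> borel_measurable borel" using assms by auto
  show ?thesis by (rule Bochner_Integration.integrable_bound[OF assms]) (auto simp: norm_mult)
qed

lemma fourier_norm_le: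
  assumes "integrable lborel f"
  shows "norm (fourier f \<xi>) \<le> (LINT x|lborel. norm (f x))"
proof -
  have "norm (fourier f \<xi>) \<le> (LINT x|lborel. norm (exp (- \<i> * of_real (x \<bullet> \<xi>)) * f x))"
    unfolding fourier_def by (rule integral_norm_bound)
  then show ?thesis by (simp add: norm_mult)
qed

lemma fourier_cmult: "fourier (\<lambda>x. c * f x) \<xi> = c * fourier f \<xi>"
  unfolding fourier_def by (simp add: mult.left_commute[of _ c])

lemma fourier_add: "integrable lborel f \<Longrightarrow> integrable lborel g \<Longrightarrow> fourier (\<lambda>x. f x + g x) \<xi> = fourier f \<xi> + fourier g \<xi>"
  unfolding fourier_def by (simp add: distrib_left integrable_exp_mult)

lemma fourier_inv_eq: "fourier_inv f x = fourier f (- x) / (2 * of_real pi) ^ CARD('n)" for x :: "real^'n::finite"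
  by (simp add: fourier_inv_def fourier_def inner_commute)

text \<open>Differentiation under the integral with an explicit remainder: linearising the
  exponential costs at most \<open>(x \<bullet> h)\<^sup>2 / 2\<close>, and Schwartz decay keeps
  \<open>(norm x)\<^sup>2 * norm (f x)\<close> below an integrable weight.\<close>

lemma fourier_has_derivative:
  fixes f :: "real^'n::finite \<Rightarrow> complex"
  assumes f: "f \<in> schwartz_space"
  shows "(fourier f has_derivative (\<lambda>h. \<Sum>i\<in>UNIV. of_real (h $ i) * fourier (\<lambda>x. - \<i> * (of_real (x $ i) * f x)) \<xi>)) (at \<xi>)"
proof -
  have [measurable]: "f \<in> borel_measurable borel" using f by (rule schwartz_measurable)
  \<comment> \<open>Two of the powers pay for \<open>(norm x)\<^sup>2\<close>, the others for
    integrability.\<close>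
  obtain C where C: "\<And>x. norm (f x) * bracket x ^ (2 * CARD('n) + 2) \<le> C"
    using schwartz_decay[OF f] by blast
  define W where "W = (\<lambda>x::real^'n. C * (1 / bracket x ^ (2 * CARD('n))))"
  have W: "integrable lborel W" unfolding W_def by (intro integrable_mult_right integrable_bracket_weight)
  have fW: "(norm x)\<^sup>2 * norm (f x) \<le> W x" for x
  proof -
    have "(norm x)\<^sup>2 * norm (f x) * bracket x ^ (2 * CARD('n)) \<le> (bracket x)\<^sup>2 * norm (f x) * bracket x ^ (2 * CARD('n))"
      by (intro mult_right_mono power_mono norm_le_bracket) auto
    also have "\<dots> \<le> C" using C[of x] by (simp add: power_add power2_eq_square mult_ac)
    finally show ?thesis by (simp add: W_def field_simps)
  qed
  have i0: "integrable lborel (\<lambda>x. exp (- (\<i> * of_real (x \<bullet> y))) * f x)" for y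
    by (intro integrable_exp_mult schwartz_integrable f)
  have i1: "integrable lborel (\<lambda>x. exp (- (\<i> * of_real (x \<bullet> \<xi>))) * (of_real (x $ i) * f x))" for i
    by (intro integrable_exp_mult schwartz_integrable schwartz_coord_mult f)
  show ?thesis
  proof (rule has_derivativeI_sandwich[where e=1 and H="\<lambda>\<eta>. norm (\<eta> - \<xi>) * ((LINT x|lborel. W x) / 2)"])
  show "bounded_linear (\<lambda>h. \<Sum>i\<in>UNIV. of_real (h $ i) * fourier (\<lambda>x. - \<i> * (of_real (x $ i) * f x)) \<xi>)"
    by (intro bounded_linear_sum bounded_linear_compose[OF bounded_linear_mult_left]
        bounded_linear_compose[OF bounded_linear_of_real bounded_linear_vec_nth])
  fix \<eta> :: "real^'n" assume "\<eta> \<noteq> \<xi>"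
  define h where "h = \<eta> - \<xi>"
  let ?R = "\<lambda>x. exp (- (\<i> * of_real (x \<bullet> \<eta>))) * f x - exp (- (\<i> * of_real (x \<bullet> \<xi>))) * f x
    - exp (- \<i> * of_real (x \<bullet> \<xi>)) * (- \<i> * of_real (x \<bullet> h) * f x)"
  have S: "(\<Sum>i\<in>UNIV. of_real (h $ i) * fourier (\<lambda>x. - \<i> * (of_real (x $ i) * f x)) \<xi>)
     = (LINT x|lborel. exp (- \<i> * of_real (x \<bullet> \<xi>)) * (- \<i> * of_real (x \<bullet> h) * f x))"
    and Si: "integrable lborel (\<lambda>x. exp (- \<i> * of_real (x \<bullet> \<xi>)) * (- \<i> * of_real (x \<bullet> h) * f x))"
  proof -
    have e: "exp (- \<i> * of_real (x \<bullet> \<xi>)) * (- \<i> * of_real (x \<bullet> h) * f x)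
      = (\<Sum>i\<in>UNIV. (- \<i> * of_real (h $ i)) * (exp (- (\<i> * of_real (x \<bullet> \<xi>))) * (of_real (x $ i) * f x)))" for x
    proof -
      have "complex_of_real (x \<bullet> h) = (\<Sum>i\<in>UNIV. of_real (h $ i) * of_real (x $ i))"
        by (simp add: inner_vec_def mult.commute)
      then show ?thesis by (simp add: sum_distrib_left sum_distrib_right mult_ac)
    qed
    show "integrable lborel (\<lambda>x. exp (- \<i> * of_real (x \<bullet> \<xi>)) * (- \<i> * of_real (x \<bullet> h) * f x))"
      unfolding e by (intro Bochner_Integration.integrable_sum integrable_mult_right i1)
    show "(\<Sum>i\<in>UNIV. of_real (h $ i) * fourier (\<lambda>x. - \<i> * (of_real (x $ i) * f x)) \<xi>)
     = (LINT x|lborel. exp (- \<i> * of_real (x \<bullet> \<xi>)) * (- \<i> * of_real (x \<bullet> h) * f x))"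
      unfolding e fourier_cmult
      by (subst Bochner_Integration.integral_sum)
         (auto intro!: integrable_mult_right i1 sum.cong simp: fourier_def)
  qed
  have Fe: "fourier f y = (LINT x|lborel. exp (- (\<i> * of_real (x \<bullet> y))) * f x)" for y
    by (simp add: fourier_def)
  have "norm (fourier f \<eta> - fourier f \<xi> - (\<Sum>i\<in>UNIV. of_real (h $ i) * fourier (\<lambda>x. - \<i> * (of_real (x $ i) * f x)) \<xi>))
    = norm (LINT x|lborel. ?R x)"
    unfolding S Fe
    by (subst Bochner_Integration.integral_diff, intro Bochner_Integration.integrable_diff i0, rule Si,
        subst Bochner_Integration.integral_diff, rule i0, rule i0, rule refl)
  also have "\<dots> \<le> (LINT x|lborel. norm (?R x))"
    by (rule integral_norm_bound)
  also have "\<dots> \<le> (LINT x|lborel. (norm h)\<^sup>2 / 2 * W x)"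
  proof (intro integral_mono)
    show "integrable lborel (\<lambda>x. (norm h)\<^sup>2 / 2 * W x)" using W by simp
    show "integrable lborel (\<lambda>x. norm (?R x))"
      by (intro integrable_norm Bochner_Integration.integrable_diff i0 Si)
    fix x :: "real^'n"
    \<comment> \<open>Factoring out the exponential at \<xi> leaves the first-order Taylor remainder
      at \<open>- (x \<bullet> h)\<close>, to which \<open>iexp_approx1\<close> applies.\<close>
    have "?R x
       = exp (- (\<i> * of_real (x \<bullet> \<xi>))) * ((iexp (- (x \<bullet> h)) - (\<Sum>k\<le>1. (\<i> * of_real (- (x \<bullet> h))) ^ k / fact k)) * f x)"
      by (simp add: h_def inner_diff_right algebra_simps exp_diff exp_minus)
         (simp add: exp_add[symmetric] exp_minus field_simps)
    then have "norm (?R x)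
       = norm (iexp (- (x \<bullet> h)) - (\<Sum>k\<le>1. (\<i> * of_real (- (x \<bullet> h))) ^ k / fact k)) * norm (f x)"
      by (simp add: norm_mult)
    also have "\<dots> \<le> (\<bar>- (x \<bullet> h)\<bar> ^ Suc 1 / fact (Suc 1)) * norm (f x)"
      by (intro mult_right_mono iexp_approx1) auto
    also have "\<dots> = (\<bar>x \<bullet> h\<bar>)\<^sup>2 / 2 * norm (f x)" by (simp add: numeral_2_eq_2)
    also have "\<dots> \<le> (norm x * norm h)\<^sup>2 / 2 * norm (f x)"
      by (intro mult_right_mono divide_right_mono power_mono Cauchy_Schwarz_ineq2) auto
    also have "\<dots> = (norm h)\<^sup>2 / 2 * ((norm x)\<^sup>2 * norm (f x))" by (simp add: power_mult_distrib)
    also have "\<dots> \<le> (norm h)\<^sup>2 / 2 * W x" by (intro mult_left_mono fW) auto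
    finally show "norm (?R x) \<le> (norm h)\<^sup>2 / 2 * W x" .
  qed
  also have "\<dots> = norm h * (norm h * ((LINT x|lborel. W x) / 2))" by (simp add: power2_eq_square)
  finally show "norm (fourier f \<eta> - fourier f \<xi> - (\<Sum>i\<in>UNIV. of_real ((\<eta> - \<xi>) $ i) * fourier (\<lambda>x. - \<i> * (of_real (x $ i) * f x)) \<xi>))
     / norm (\<eta> - \<xi>) \<le> norm (\<eta> - \<xi>) * ((LINT x|lborel. W x) / 2)"
    using \<open>\<eta> \<noteq> \<xi>\<close> unfolding h_def by (simp add: pos_divide_le_eq mult.commute)
next
  show "((\<lambda>\<eta>. norm (\<eta> - \<xi>) * ((LINT x|lborel. W x) / 2)) \<longlongrightarrow> 0) (at \<xi>)"
    by (auto intro!: tendsto_eq_intros)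
  qed simp
qed

lemma partial_fourier:
  assumes f: "f \<in> schwartz_space"
  shows "partial i (fourier f) = fourier (\<lambda>x. - \<i> * (of_real (x $ i) * f x))"
proof (rule ext, rule partial_eqI[OF fourier_has_derivative[OF f], THEN trans])
  fix \<xi> :: "real^'a"
  have "(\<Sum>j\<in>UNIV. of_real (axis i 1 $ j) * fourier (\<lambda>x. - \<i> * (of_real (x $ j) * f x)) \<xi>)
     = (\<Sum>j\<in>UNIV. if j = i then fourier (\<lambda>x. - \<i> * (of_real (x $ j) * f x)) \<xi> else 0)"
    by (intro sum.cong) (auto simp: axis_def)
  then show "(\<Sum>j\<in>UNIV. of_real (axis i 1 $ j) * fourier (\<lambda>x. - \<i> * (of_real (x $ j) * f x)) \<xi>)
     = fourier (\<lambda>x. - \<i> * (of_real (x $ i) * f x)) \<xi>" by simp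
qed

text \<open>Provides the integrable majorant for difference quotients. It is the mean value
  inequality along a segment of length at most 1, on which the weight changes by at most a factor 4
  per power by \<open>bracket_add_le\<close>.\<close>

lemma schwartz_difference_bound:
  fixes f :: "real^'n::finite \<Rightarrow> complex"
  assumes f: "f \<in> schwartz_space"
  obtains C where "\<And>x t. \<bar>t\<bar> \<le> 1 \<Longrightarrow> norm (f (x + t *\<^sub>R axis i 1) - f x) \<le> \<bar>t\<bar> * (C * (1 / bracket x ^ (2 * CARD('n))))"
proof -
  define m where "m = 2 * CARD('n)"
  obtain C where C: "\<And>x. norm (partial i f x) * bracket x ^ m \<le> C"
    using schwartz_decay[OF schwartz_partial[OF f]] by blast
  have C0: "0 \<le> C" using C[of 0] by (meson bracket_nonneg mult_nonneg_nonneg norm_ge_zero order_trans zero_le_power)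
  have "norm (f (x + t *\<^sub>R axis i 1) - f x) \<le> \<bar>t\<bar> * ((4 ^ m * C) * (1 / bracket x ^ m))" if t: "\<bar>t\<bar> \<le> 1" for x t
  proof -
    define g where "g s = f (x + s *\<^sub>R axis i 1)" for s
    have d: "(g has_derivative (\<lambda>h. h *\<^sub>R partial i f (x + s *\<^sub>R axis i 1))) (at s within A)" for s A
    proof -
      have "(g has_derivative (\<lambda>h. frechet_derivative f (at (x + s *\<^sub>R axis i 1)) (h *\<^sub>R axis i 1))) (at s)"
        unfolding g_def
        by (rule has_derivative_compose[OF _ differentiable_has_derivative[OF schwartz_differentiable[OF f]]])
           (auto intro!: derivative_eq_intros)
      then have "(g has_derivative (\<lambda>h. h *\<^sub>R partial i f (x + s *\<^sub>R axis i 1))) (at s)"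
        by (simp only: partial_def linear_cmul[OF linear_frechet_derivative[OF schwartz_differentiable[OF f]]])
      then show ?thesis by (rule has_derivative_at_withinI)
    qed
    have b: "norm (partial i f (x + s *\<^sub>R axis i 1)) \<le> 4 ^ m * C * (1 / bracket x ^ m)" if s: "\<bar>s\<bar> \<le> 1" for s
    proof -
      define y where "y = x + s *\<^sub>R axis i 1"
      have "bracket (- (s *\<^sub>R (axis i 1 :: real^'n))) \<le> 2"
        using bracket_le_one_plus_norm[of "s *\<^sub>R (axis i 1 :: real^'n)"] s by (simp add: norm_axis_1)
      then have "2 * bracket y * bracket (- (s *\<^sub>R (axis i 1 :: real^'n))) \<le> 2 * bracket y * 2"
        by (intro mult_left_mono) auto
      moreover have "bracket x \<le> 2 * bracket y * bracket (- (s *\<^sub>R (axis i 1 :: real^'n)))"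
        using bracket_add_le[of y "- (s *\<^sub>R axis i 1)"] by (simp add: y_def del: bracket_minus)
      ultimately have "bracket x \<le> 4 * bracket y" by linarith
      then have "bracket x ^ m \<le> 4 ^ m * bracket y ^ m"
        by (metis power_mono power_mult_distrib bracket_nonneg)
      then have "norm (partial i f y) * bracket x ^ m \<le> norm (partial i f y) * (4 ^ m * bracket y ^ m)"
        by (intro mult_left_mono) auto
      also have "\<dots> \<le> 4 ^ m * C" using C[of y] by (simp add: mult.left_commute)
      finally show ?thesis by (simp add: y_def field_simps)
    qed
    have "norm (g t - g 0) \<le> (4 ^ m * C * (1 / bracket x ^ m)) * norm (t - 0)"
    proof (rule differentiable_bound[of "{-1..1}" g "\<lambda>s h. h *\<^sub>R partial i f (x + s *\<^sub>R axis i 1)"])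
      show "onorm (\<lambda>h. h *\<^sub>R partial i f (x + s *\<^sub>R axis i 1)) \<le> 4 ^ m * C * (1 / bracket x ^ m)" if "s \<in> {-1..1}" for s
      proof (rule onorm_bound)
        show "norm (h *\<^sub>R partial i f (x + s *\<^sub>R axis i 1)) \<le> 4 ^ m * C * (1 / bracket x ^ m) * norm h" for h
          using mult_right_mono[OF b[of s], of "norm h"] that by (simp add: mult.commute abs_le_iff)
      qed (use C0 in simp)
    qed (use t d in auto)
    then show ?thesis by (simp add: g_def mult_ac)
  qed
  then show ?thesis using that unfolding m_def by blast
qed

lemma has_vector_derivative_quotient_seq:
  fixes g :: "real \<Rightarrow> complex"
  assumes "(g has_vector_derivative D) (at 0)" "t \<longlonglongrightarrow> 0" "\<And>k. t k \<noteq> 0"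
  shows "(\<lambda>k. (g (t k) - g 0) / of_real (t k)) \<longlonglongrightarrow> D"
proof -
  have "((\<lambda>h. norm (g (0 + h) - g 0 - h *\<^sub>R D) / norm h) \<longlongrightarrow> 0) (at 0)"
    using assms(1) unfolding has_vector_derivative_def has_derivative_at by blast
  moreover have "filterlim t (at 0) sequentially"
    using assms(2,3) by (simp add: filterlim_at)
  ultimately have "(\<lambda>k. norm (g (0 + t k) - g 0 - t k *\<^sub>R D) / norm (t k)) \<longlonglongrightarrow> 0"
    by (rule filterlim_compose)
  moreover have "norm (g (0 + t k) - g 0 - t k *\<^sub>R D) / norm (t k) = norm ((g (t k) - g 0) / of_real (t k) - D)" for k
  proof -
    have "(g (t k) - g 0) / of_real (t k) - D = (g (0 + t k) - g 0 - t k *\<^sub>R D) / of_real (t k)"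
      using assms(3)[of k] by (simp add: diff_divide_distrib scaleR_conv_of_real)
    then show ?thesis by (simp add: norm_divide)
  qed
  ultimately show ?thesis
    by (simp add: tendsto_norm_zero_iff LIM_zero_iff)
qed

text \<open>In place of integration by parts, the transform of a difference quotient is computed in
  two ways: translating the integrand gives the factor
  \<open>(iexp (t k * (\<xi> $ i)) - 1) / of_real (t k)\<close>, and dominated convergence gives the
  transform of the derivative.\<close>

lemma fourier_partial:
  fixes f :: "real^'n::finite \<Rightarrow> complex"
  assumes f: "f \<in> schwartz_space"
  shows "fourier (partial i f) \<xi> = \<i> * of_real (\<xi> $ i) * fourier f \<xi>"
proof -
  have fm[measurable]: "f \<in> borel_measurable borel" using f by (rule schwartz_measurable)
  have pm[measurable]: "partial i f \<in> borel_measurable borel"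
    using f by (intro schwartz_measurable schwartz_partial)
  obtain C where C: "\<And>x t. \<bar>t\<bar> \<le> 1 \<Longrightarrow> norm (f (x + t *\<^sub>R axis i 1) - f x) \<le> \<bar>t\<bar> * (C * (1 / bracket x ^ (2 * CARD('n))))"
    using schwartz_difference_bound[OF f] by blast
  define e where "e x = exp (- \<i> * complex_of_real (x \<bullet> \<xi>))" for x
  have [measurable]: "e \<in> borel_measurable borel" unfolding e_def by measurable
  have ne[simp]: "norm (e x) = 1" for x by (simp add: e_def)
  define t where "t k = 1 / real (Suc k)" for k
  have t0: "t \<longlonglongrightarrow> 0" unfolding t_def using LIMSEQ_inverse_real_of_nat by (simp add: inverse_eq_divide)
  have tp: "0 < t k" "t k \<le> 1" for k by (auto simp: t_def)
  define I where "I k = (LINT x|lborel. e x * ((f (x + t k *\<^sub>R axis i 1) - f x) / of_real (t k)))" for k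
  have I: "I k = ((iexp (t k * (\<xi> $ i)) - 1) / of_real (t k)) * fourier f \<xi>" for k
  proof -
    have i0: "integrable lborel (\<lambda>x. e x * f x)"
      unfolding e_def using integrable_exp_mult[OF schwartz_integrable[OF f]] by simp
    have eq: "e x * f (x + t k *\<^sub>R axis i 1) = iexp (t k * (\<xi> $ i)) * (e (x + t k *\<^sub>R axis i 1) * f (x + t k *\<^sub>R axis i 1))" for x
    proof -
      have "e x = iexp (t k * (\<xi> $ i)) * e (x + t k *\<^sub>R axis i 1)"
        unfolding e_def exp_add[symmetric] by (simp add: inner_add_left inner_axis' algebra_simps)
      then show ?thesis by simp
    qed
    have a: "integrable lborel (\<lambda>x. e (x + y) * f (x + y))"
      "(LINT x|lborel. e (x + y) * f (x + y)) = fourier f \<xi>" for y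
      using i0 integral_affine[where c=1 and t=y and f="\<lambda>x. e x * f x"] by (simp_all add: add.commute fourier_def e_def)
    have "I k = (LINT x|lborel. (iexp (t k * (\<xi> $ i)) * (e (x + t k *\<^sub>R axis i 1) * f (x + t k *\<^sub>R axis i 1)) - e x * f x) / of_real (t k))"
      unfolding I_def by (intro Bochner_Integration.integral_cong refl) (simp only: right_diff_distrib eq times_divide_eq_right)
    also have "\<dots> = (iexp (t k * (\<xi> $ i)) * fourier f \<xi> - fourier f \<xi>) / of_real (t k)"
      using a[of "t k *\<^sub>R axis i 1"] a[of 0] by simp
    finally show ?thesis by (simp add: left_diff_distrib)
  qed
  have "I \<longlonglongrightarrow> (LINT x|lborel. e x * partial i f x)"
    unfolding I_def
  proof (rule integral_dominated_convergence)
    show "integrable lborel (\<lambda>x::real^'n. C * (1 / bracket x ^ (2 * CARD('n))))"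
      by (intro integrable_mult_right integrable_bracket_weight)
    show "AE x in lborel. norm (e x * ((f (x + t k *\<^sub>R axis i 1) - f x) / of_real (t k))) \<le> C * (1 / bracket x ^ (2 * CARD('n)))" for k
      using C[of "t k"] tp[of k] by (auto simp: norm_mult norm_divide pos_divide_le_eq mult.commute)
    show "AE x in lborel. (\<lambda>k. e x * ((f (x + t k *\<^sub>R axis i 1) - f x) / of_real (t k))) \<longlonglongrightarrow> e x * partial i f x"
    proof (rule AE_I2, rule tendsto_mult[OF tendsto_const])
      fix x
      have "((\<lambda>s. f (x + s *\<^sub>R axis i 1)) has_derivative (\<lambda>h. frechet_derivative f (at (x + 0 *\<^sub>R axis i 1)) (h *\<^sub>R axis i 1))) (at 0)"
        by (rule has_derivative_compose[OF _ differentiable_has_derivative[OF schwartz_differentiable[OF f]]])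
           (auto intro!: derivative_eq_intros)
      then have "((\<lambda>s. f (x + s *\<^sub>R axis i 1)) has_vector_derivative partial i f x) (at 0)"
        by (simp add: has_vector_derivative_def partial_def linear_cmul[OF linear_frechet_derivative[OF schwartz_differentiable[OF f]]])
      then show "(\<lambda>k. (f (x + t k *\<^sub>R axis i 1) - f x) / of_real (t k)) \<longlonglongrightarrow> partial i f x"
        using has_vector_derivative_quotient_seq[OF _ t0, of "\<lambda>s. f (x + s *\<^sub>R axis i 1)"] tp(1)
        by (simp add: less_imp_neq[THEN not_sym])
    qed
  qed measurable
  moreover have "I \<longlonglongrightarrow> \<i> * of_real (\<xi> $ i) * fourier f \<xi>"
  proof -
    have "((\<lambda>z. exp (\<i> * (z * of_real (\<xi> $ i)))) has_field_derivative \<i> * of_real (\<xi> $ i)) (at (of_real 0))"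
      by (auto intro!: derivative_eq_intros)
    from has_vector_derivative_real_field[OF this]
    have "((\<lambda>s. iexp (s * (\<xi> $ i))) has_vector_derivative \<i> * of_real (\<xi> $ i)) (at 0)"
      by simp
    from has_vector_derivative_quotient_seq[OF this t0] tp(1)
    have "(\<lambda>k. (iexp (t k * (\<xi> $ i)) - 1) / of_real (t k)) \<longlonglongrightarrow> \<i> * of_real (\<xi> $ i)"
      by (simp add: less_imp_neq[THEN not_sym])
    then show ?thesis unfolding I by (intro tendsto_mult tendsto_const)
  qed
  ultimately show ?thesis
    using LIMSEQ_unique unfolding fourier_def e_def by blast
qed

lemma fourier_partial_power:
  assumes "f \<in> schwartz_space"
  shows "fourier (partials (replicate m i) f) \<xi> = (\<i> * of_real (\<xi> $ i)) ^ m * fourier f \<xi>"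
  by (induction m) (simp_all add: fourier_partial schwartz_partials assms)

lemma bracket_power_le:
  fixes \<xi> :: "real^'n::finite"
  shows "bracket \<xi> ^ m \<le> (1 + real CARD('n)) ^ m * (1 + (\<Sum>i\<in>UNIV. \<bar>\<xi> $ i\<bar> ^ m))"
proof -
  have "Max (range (\<lambda>i. \<bar>\<xi> $ i\<bar>)) \<in> range (\<lambda>i. \<bar>\<xi> $ i\<bar>)" by (intro Max_in) auto
  then obtain j where "Max (range (\<lambda>i. \<bar>\<xi> $ i\<bar>)) = \<bar>\<xi> $ j\<bar>" by blast
  then have j: "\<bar>\<xi> $ i\<bar> \<le> \<bar>\<xi> $ j\<bar>" for i
    using Max_ge[of "range (\<lambda>i. \<bar>\<xi> $ i\<bar>)" "\<bar>\<xi> $ i\<bar>"] by simp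
  have "bracket \<xi> \<le> 1 + (\<Sum>i\<in>UNIV. \<bar>\<xi> $ i\<bar>)"
    using bracket_le_one_plus_norm[of \<xi>] norm_le_l1_cart[of \<xi>] by linarith
  also have "\<dots> \<le> 1 + real CARD('n) * \<bar>\<xi> $ j\<bar>"
    using sum_bounded_above[of UNIV "\<lambda>i. \<bar>\<xi> $ i\<bar>" "\<bar>\<xi> $ j\<bar>"] j by simp
  also have "\<dots> \<le> (1 + real CARD('n)) * max 1 \<bar>\<xi> $ j\<bar>"
    unfolding distrib_right by (intro add_mono mult_left_mono) auto
  finally have "bracket \<xi> ^ m \<le> ((1 + real CARD('n)) * max 1 \<bar>\<xi> $ j\<bar>) ^ m"
    by (intro power_mono) auto
  also have "\<dots> \<le> (1 + real CARD('n)) ^ m * (1 + \<bar>\<xi> $ j\<bar> ^ m)"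
    by (auto simp: power_mult_distrib max_def)
  also have "\<dots> \<le> (1 + real CARD('n)) ^ m * (1 + (\<Sum>i\<in>UNIV. \<bar>\<xi> $ i\<bar> ^ m))"
    by (intro mult_left_mono add_left_mono member_le_sum) auto
  finally show ?thesis .
qed

lemma finite_lists_length_le_UNIV: "finite {js :: 'n::finite list. length js \<le> N}"
  using finite_lists_length_le[of "UNIV :: 'n set" N] by simp

text \<open>The constant is uniform in \<open>f\<close> and the seminorms are those in
  \<open>tempered\<close>, so the bound yields both the invariance of the Schwartz space and the
  continuity of \<open>spectral h\<close>. Powers of \<xi> come from up to \<open>m\<close>
  derivatives of \<open>f\<close>, and the integrals from a weight of order
  \<open>2 * CARD('n)\<close>; hence the maximum.\<close>

lemma fourier_decay_seminorm:
  obtains C where "\<And>(f :: real^'n::finite \<Rightarrow> complex) \<xi>. f \<in> schwartz_space \<Longrightarrow>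
    norm (fourier f \<xi>) * bracket \<xi> ^ m
      \<le> C * (\<Sum>k\<le>max m (2 * CARD('n)). \<Sum>js\<in>{js. length js \<le> max m (2 * CARD('n))}. schwartz_seminorm k js f)"
proof -
  define N where "N = max m (2 * CARD('n))"
  define I where "I = (LINT x|lborel. 1 / bracket (x::real^'n) ^ (2 * CARD('n)))"
  have I0: "0 \<le> I" unfolding I_def by (intro integral_nonneg_AE) auto
  define K where "K = 2 ^ (2 * CARD('n)) * 2 * I"
  have "norm (fourier f \<xi>) * bracket \<xi> ^ m
     \<le> (1 + real CARD('n)) ^ m * (1 + real CARD('n)) * K * (\<Sum>k\<le>N. \<Sum>js\<in>{js. length js \<le> N}. schwartz_seminorm k js f)"
    if f: "f \<in> schwartz_space" for f :: "real^'n \<Rightarrow> complex" and \<xi>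
  proof -
    define Q where "Q = (\<Sum>k\<le>N. \<Sum>js\<in>{js. length js \<le> N}. schwartz_seminorm k js f)"
    have Q: "schwartz_seminorm k js f \<le> Q" if "k \<le> N" "length js \<le> N" for k js
    proof -
      have "schwartz_seminorm k js f \<le> (\<Sum>js\<in>{js. length js \<le> N}. schwartz_seminorm k js f)"
        using that by (intro member_le_sum finite_lists_length_le_UNIV) (auto simp: schwartz_seminorm_nonneg[OF f])
      also have "\<dots> \<le> Q"
        unfolding Q_def using that by (intro member_le_sum) (auto intro!: sum_nonneg schwartz_seminorm_nonneg[OF f])
      finally show ?thesis .
    qed
    have b: "norm (fourier (partials js f) \<xi>) \<le> K * Q" if js: "length js \<le> m" for js
    proof -
      have g: "partials js f \<in> schwartz_space" by (rule schwartz_partials[OF f])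
      have "norm (partials js f x) * bracket x ^ (2 * CARD('n)) \<le> 2 ^ (2 * CARD('n)) * (Q + Q)" for x
      proof -
        have "norm (partials js f x) * bracket x ^ (2 * CARD('n))
          \<le> 2 ^ (2 * CARD('n)) * (schwartz_seminorm 0 js f + schwartz_seminorm (2 * CARD('n)) js f)"
          by (rule schwartz_decay_seminorm[OF f])
        also have "\<dots> \<le> 2 ^ (2 * CARD('n)) * (Q + Q)"
          using js by (intro mult_left_mono add_mono Q) (auto simp: N_def)
        finally show ?thesis .
      qed
      then have "norm (exp (- \<i> * of_real (x \<bullet> \<xi>)) * partials js f x) * bracket x ^ (2 * CARD('n)) \<le> 2 ^ (2 * CARD('n)) * (Q + Q)" for x
        by (simp add: norm_mult)
      then have "norm (fourier (partials js f) \<xi>) \<le> 2 ^ (2 * CARD('n)) * (Q + Q) * I"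
        unfolding fourier_def I_def using schwartz_measurable[OF g]
        by (intro integrable_bracket_decay(2)) auto
      then show ?thesis by (simp add: K_def algebra_simps)
    qed
    have 1: "norm (fourier f \<xi>) * \<bar>\<xi> $ i\<bar> ^ m \<le> K * Q" for i
      using b[of "replicate m i"] by (simp add: fourier_partial_power[OF f] norm_mult norm_power mult.commute)
    have "norm (fourier f \<xi>) * bracket \<xi> ^ m
       \<le> norm (fourier f \<xi>) * ((1 + real CARD('n)) ^ m * (1 + (\<Sum>i\<in>UNIV. \<bar>\<xi> $ i\<bar> ^ m)))"
      by (intro mult_left_mono bracket_power_le) auto
    also have "\<dots> = (1 + real CARD('n)) ^ m * (norm (fourier f \<xi>) + (\<Sum>i\<in>UNIV. norm (fourier f \<xi>) * \<bar>\<xi> $ i\<bar> ^ m))"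
      by (simp add: sum_distrib_left algebra_simps)
    also have "\<dots> \<le> (1 + real CARD('n)) ^ m * (K * Q + real CARD('n) * (K * Q))"
      using b[of "[]"] sum_bounded_above[of UNIV "\<lambda>i. norm (fourier f \<xi>) * \<bar>\<xi> $ i\<bar> ^ m", OF 1]
      by (intro mult_left_mono add_mono) auto
    finally show ?thesis unfolding Q_def[symmetric] by (simp add: algebra_simps)
  qed
  then show ?thesis using that unfolding N_def by blast
qed

lemma fourier_schwartz:
  assumes "f \<in> schwartz_space"
  shows "fourier f \<in> schwartz_space"
proof (rule schwartz_coinduct[of _ "fourier ` schwartz_space"])
  show "fourier f \<in> fourier ` schwartz_space" using assms by blast
next
  fix g :: "real^'a \<Rightarrow> complex" and x assume "g \<in> fourier ` schwartz_space"
  then show "g differentiable (at x)" using fourier_has_derivative differentiable_def by blast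
next
  fix g :: "real^'a \<Rightarrow> complex" and i assume "g \<in> fourier ` schwartz_space"
  then obtain f where f: "g = fourier f" "f \<in> schwartz_space" by blast
  show "partial i g \<in> fourier ` schwartz_space"
    unfolding f partial_fourier[OF f(2)] by (intro imageI schwartz_cmult schwartz_coord_mult f)
next
  fix g :: "real^'a \<Rightarrow> complex" and m assume "g \<in> fourier ` schwartz_space"
  then obtain f where f: "g = fourier f" "f \<in> schwartz_space" by blast
  obtain C where "\<And>(f :: real^'a::finite \<Rightarrow> complex) \<xi>. f \<in> schwartz_space \<Longrightarrow>
    norm (fourier f \<xi>) * bracket \<xi> ^ m
      \<le> C * (\<Sum>k\<le>max m (2 * CARD('a)). \<Sum>js\<in>{js. length js \<le> max m (2 * CARD('a))}. schwartz_seminorm k js f)"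
    using fourier_decay_seminorm[where m=m and 'n='a] by auto
  from this[OF f(2)] show "\<exists>C. \<forall>x. norm (g x) * bracket x ^ m \<le> C" unfolding f(1) by blast
qed

lemma fourier_inv_schwartz:
  assumes "f \<in> schwartz_space"
  shows "fourier_inv f \<in> schwartz_space"
proof -
  have "(\<lambda>x. (1 / (2 * of_real pi) ^ CARD('a)) * fourier f (- x)) \<in> schwartz_space"
    by (intro schwartz_cmult schwartz_reflect fourier_schwartz assms)
  then show ?thesis by (simp add: fourier_inv_eq[abs_def])
qed

subsection \<open>Gaussians and Fourier inversion\<close>

definition gauss :: "real \<Rightarrow> real^'n::finite \<Rightarrow> real" where
  "gauss \<epsilon> x = exp (- (\<epsilon> * norm x)\<^sup>2 / 2)"

text \<open>The Fourier transform of \<open>gauss \<epsilon>\<close>, left unnormalised: for every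
  positive \<epsilon> its total mass is \<open>(2 * pi) ^ CARD('n)\<close>, and it concentrates at 0
  as \<epsilon> tends to 0.\<close>

definition gauss_kernel :: "real \<Rightarrow> real^'n::finite \<Rightarrow> real" where
  "gauss_kernel \<epsilon> x = (sqrt (2 * pi) / \<epsilon>) ^ CARD('n) * gauss (1 / \<epsilon>) x"

lemma measurable_gauss [measurable]: "gauss \<epsilon> \<in> borel_measurable borel"
  unfolding gauss_def by measurable

lemma measurable_gauss_kernel [measurable]: "gauss_kernel \<epsilon> \<in> borel_measurable borel"
  unfolding gauss_kernel_def by measurable

lemma gauss_nonneg [simp]: "0 \<le> gauss \<epsilon> x" and gauss_le_one: "gauss \<epsilon> x \<le> 1"
  by (auto simp: gauss_def)

lemma gauss_kernel_nonneg: "0 < \<epsilon> \<Longrightarrow> 0 \<le> gauss_kernel \<epsilon> x"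
  by (auto simp: gauss_kernel_def)

text \<open>Read off from the characteristic function of the standard normal distribution.\<close>

lemma fourier_gauss_1D:
  "integrable lborel (\<lambda>t. iexp (s * t) * of_real (exp (- t\<^sup>2 / 2)))"
  "(LINT t|lborel. iexp (s * t) * of_real (exp (- t\<^sup>2 / 2))) = of_real (sqrt (2 * pi) * exp (- s\<^sup>2 / 2))"
proof -
  have e: "iexp (s * t) * of_real (exp (- t\<^sup>2 / 2)) = of_real (sqrt (2 * pi)) * (std_normal_density t *\<^sub>R iexp (s * t))" for t
  proof -
    have "exp (- t\<^sup>2 / 2) = sqrt (2 * pi) * std_normal_density t" by (simp add: std_normal_density_def)
    then show ?thesis by (simp add: scaleR_conv_of_real mult_ac)
  qed
  have i: "integrable lborel (\<lambda>t. std_normal_density t *\<^sub>R iexp (s * t))"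
  proof (rule Bochner_Integration.integrable_bound)
    show "integrable lborel std_normal_density" by simp
  qed (auto simp: norm_mult)
  then show "integrable lborel (\<lambda>t. iexp (s * t) * of_real (exp (- t\<^sup>2 / 2)))"
    unfolding e by (rule integrable_mult_right)
  have "(LINT t|lborel. std_normal_density t *\<^sub>R iexp (s * t)) = char std_normal_distribution s"
    unfolding char_def by (subst integral_density) auto
  then show "(LINT t|lborel. iexp (s * t) * of_real (exp (- t\<^sup>2 / 2))) = of_real (sqrt (2 * pi) * exp (- s\<^sup>2 / 2))"
    unfolding e integral_mult_right_zero by (simp add: char_std_normal_distribution)
qed

lemma gauss_one_prod:
  fixes z :: "real^'n::finite"
  shows "iexp (z \<bullet> x) * of_real (gauss 1 x) = (\<Prod>i\<in>UNIV. iexp (z $ i * x $ i) * of_real (exp (- (x $ i)\<^sup>2 / 2)))"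
proof -
  have 1: "gauss 1 x = (\<Prod>i\<in>UNIV. exp (- (x $ i)\<^sup>2 / 2))"
    unfolding gauss_def exp_sum[OF finite, symmetric]
    by (simp add: sum_negf sum_divide_distrib[symmetric] norm_vec_def L2_set_def sum_nonneg)
  have 2: "iexp (z \<bullet> x) = (\<Prod>i\<in>UNIV. iexp (z $ i * x $ i))"
    by (simp add: exp_sum[symmetric] inner_vec_def sum_distrib_left)
  show ?thesis unfolding 1 2 by (simp add: prod.distrib del: exp_of_real)
qed

lemma fourier_gauss:
  fixes z :: "real^'n::finite"
  assumes "0 < \<epsilon>"
  shows "integrable lborel (gauss \<epsilon> :: real^'n \<Rightarrow> real)"
    and "(LINT x|lborel. iexp (z \<bullet> x) * of_real (gauss \<epsilon> x)) = of_real (gauss_kernel \<epsilon> z)"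
proof -
  have one_i: "integrable lborel (\<lambda>x::real^'n. iexp (z \<bullet> x) * of_real (gauss 1 x))" for z
    unfolding gauss_one_prod by (rule prod_integral_cart(1)[where f="\<lambda>i t. iexp (z $ i * t) * of_real (exp (- t\<^sup>2 / 2))"])
      (rule fourier_gauss_1D)
  have one: "(LINT x|lborel. iexp (z \<bullet> x) * of_real (gauss 1 x)) = of_real (sqrt (2 * pi) ^ CARD('n) * gauss 1 z)" for z :: "real^'n"
  proof -
    have "(LINT x|lborel. iexp (z \<bullet> x) * of_real (gauss 1 x))
       = (\<Prod>i\<in>UNIV. LINT t|lborel. iexp (z $ i * t) * of_real (exp (- t\<^sup>2 / 2)))"
      unfolding gauss_one_prod by (rule prod_integral_cart(2)[where f="\<lambda>i t. iexp (z $ i * t) * of_real (exp (- t\<^sup>2 / 2))"])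
      (rule fourier_gauss_1D)
    also have "\<dots> = (\<Prod>i\<in>(UNIV::'n set). of_real (sqrt (2 * pi)) * of_real (exp (- (z $ i)\<^sup>2 / 2)))"
      by (simp only: fourier_gauss_1D of_real_mult[of "sqrt (2 * pi)"])
    also have "\<dots> = of_real (sqrt (2 * pi)) ^ CARD('n) * (iexp (0 \<bullet> z) * of_real (gauss 1 z))"
      unfolding gauss_one_prod by (simp add: prod.distrib)
    finally show ?thesis by simp
  qed
  have g: "gauss 1 (\<epsilon> *\<^sub>R x) = gauss \<epsilon> x" for x :: "real^'n" using assms by (simp add: gauss_def)
  have "integrable lborel (\<lambda>x::real^'n. complex_of_real (gauss 1 x))" using one_i[of 0] by simp
  then have "integrable lborel (gauss 1 :: real^'n \<Rightarrow> real)" by (simp add: complex_of_real_integrable_eq)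
  then show "integrable lborel (gauss \<epsilon> :: real^'n \<Rightarrow> real)"
    using integral_affine(1)[of \<epsilon> "gauss 1 :: real^'n \<Rightarrow> real" 0] assms by (simp add: g)
  have "of_real (sqrt (2 * pi) ^ CARD('n) * gauss 1 (z /\<^sub>R \<epsilon>))
     = \<epsilon> ^ CARD('n) *\<^sub>R (LINT x|lborel. iexp (z \<bullet> x) * of_real (gauss \<epsilon> x))"
  proof -
    have zx: "(z /\<^sub>R \<epsilon>) \<bullet> (\<epsilon> *\<^sub>R x) = z \<bullet> x" for x using assms by simp
    show ?thesis
      unfolding one[symmetric]
      by (subst integral_affine(2)[of \<epsilon> _ 0]) (use assms in \<open>simp_all only: zx g add_0_left abs_of_pos DIM_cart DIM_real mult_1_right\<close>)
  qed
  then have L: "of_real (sqrt (2 * pi) ^ CARD('n) * gauss 1 (z /\<^sub>R \<epsilon>)) = of_real (\<epsilon> ^ CARD('n)) * (LINT x|lborel. iexp (z \<bullet> x) * of_real (gauss \<epsilon> x))"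
    (is "?L = ?E * ?I") unfolding scaleR_conv_of_real .
  have "?E \<noteq> 0" using assms by simp
  then have "?I = (?E * ?I) / ?E" by (rule nonzero_mult_div_cancel_left[symmetric])
  also have "?E * ?I = ?L" by (rule L[symmetric])
  also have "gauss 1 (z /\<^sub>R \<epsilon>) = gauss (1 / \<epsilon>) z"
  proof -
    have "norm (z /\<^sub>R \<epsilon>) = inverse \<epsilon> * norm z" using assms by simp
    also have "\<dots> = 1 / \<epsilon> * norm z" by (simp add: inverse_eq_divide)
    finally show ?thesis by (simp only: gauss_def mult_1_left)
  qed
  also have "of_real (sqrt (2 * pi) ^ CARD('n) * gauss (1 / \<epsilon>) z) / ?E = of_real (gauss_kernel \<epsilon> z)"
    unfolding of_real_divide[symmetric] gauss_kernel_def power_divide by simp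
  finally show "?I = of_real (gauss_kernel \<epsilon> z)" .
qed

lemma gauss_kernel_integral:
  assumes "0 < \<epsilon>"
  shows "integrable lborel (gauss_kernel \<epsilon> :: real^'n::finite \<Rightarrow> real)"
    "(LINT x|lborel. gauss_kernel \<epsilon> (x::real^'n)) = (2 * pi) ^ CARD('n)"
proof -
  have e: "0 < 1 / \<epsilon>" using assms by simp
  show "integrable lborel (gauss_kernel \<epsilon> :: real^'n \<Rightarrow> real)"
    unfolding gauss_kernel_def[abs_def] by (intro integrable_mult_right fourier_gauss(1) e)
  have "complex_of_real (LINT x|lborel. gauss (1 / \<epsilon>) (x::real^'n)) = of_real (gauss_kernel (1 / \<epsilon>) (0::real^'n))"
    using fourier_gauss(2)[OF e, of "0::real^'n"] by simp
  then have "(LINT x|lborel. gauss (1 / \<epsilon>) (x::real^'n)) = (sqrt (2 * pi) * \<epsilon>) ^ CARD('n)"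
    by (simp only: of_real_eq_iff) (simp add: gauss_kernel_def gauss_def)
  then have "(LINT x|lborel. gauss_kernel \<epsilon> (x::real^'n)) = (sqrt (2 * pi) / \<epsilon>) ^ CARD('n) * (sqrt (2 * pi) * \<epsilon>) ^ CARD('n)"
    unfolding gauss_kernel_def by simp
  also have "\<dots> = ((sqrt (2 * pi))\<^sup>2) ^ CARD('n)"
    by (simp only: power_mult_distrib[symmetric]) (use assms in \<open>simp add: power2_eq_square\<close>)
  finally show "(LINT x|lborel. gauss_kernel \<epsilon> (x::real^'n)) = (2 * pi) ^ CARD('n)" by simp
qed

text \<open>The Gaussian makes the double integral absolutely convergent for every integrable
  \<open>f\<close>, although \<open>fourier f\<close> may fail to be integrable. Exchanging the
  integrals turns damped inversion into convolution with an approximate identity.\<close>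

lemma fourier_gauss_swap:
  fixes f :: "real^'n::finite \<Rightarrow> complex"
  assumes f: "integrable lborel f" and e: "0 < \<epsilon>"
  shows "(LINT \<xi>|lborel. fourier f \<xi> * (iexp (x \<bullet> \<xi>) * of_real (gauss \<epsilon> \<xi>))) = (LINT y|lborel. f y * of_real (gauss_kernel \<epsilon> (x - y)))"
proof -
  have [measurable]: "f \<in> borel_measurable borel" using f by auto
  have "(LINT \<xi>|lborel. fourier f \<xi> * (iexp (x \<bullet> \<xi>) * of_real (gauss \<epsilon> \<xi>)))
     = (LINT \<xi>|lborel. LINT y|lborel. f y * (iexp ((x - y) \<bullet> \<xi>) * of_real (gauss \<epsilon> \<xi>)))"
  proof (rule Bochner_Integration.integral_cong[OF refl])
    fix \<xi> :: "real^'n"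
    have "fourier f \<xi> * (iexp (x \<bullet> \<xi>) * of_real (gauss \<epsilon> \<xi>))
      = (LINT y|lborel. exp (- \<i> * of_real (y \<bullet> \<xi>)) * f y * (iexp (x \<bullet> \<xi>) * of_real (gauss \<epsilon> \<xi>)))"
      unfolding fourier_def by simp
    also have "\<dots> = (LINT y|lborel. f y * (iexp ((x - y) \<bullet> \<xi>) * of_real (gauss \<epsilon> \<xi>)))"
    proof (rule Bochner_Integration.integral_cong[OF refl])
      fix y
      have "iexp ((x - y) \<bullet> \<xi>) = exp (- \<i> * of_real (y \<bullet> \<xi>)) * iexp (x \<bullet> \<xi>)"
        unfolding exp_add[symmetric] by (simp add: inner_diff_left algebra_simps)
      then show "exp (- \<i> * of_real (y \<bullet> \<xi>)) * f y * (iexp (x \<bullet> \<xi>) * of_real (gauss \<epsilon> \<xi>)) = f y * (iexp ((x - y) \<bullet> \<xi>) * of_real (gauss \<epsilon> \<xi>))"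
        by (simp add: mult_ac)
    qed
    finally show "fourier f \<xi> * (iexp (x \<bullet> \<xi>) * of_real (gauss \<epsilon> \<xi>))
       = (LINT y|lborel. f y * (iexp ((x - y) \<bullet> \<xi>) * of_real (gauss \<epsilon> \<xi>)))" .
  qed
  also have "\<dots> = (LINT y|lborel. LINT \<xi>|lborel. f y * (iexp ((x - y) \<bullet> \<xi>) * of_real (gauss \<epsilon> \<xi>)))"
    by (rule Fubini_product_bound[where f="\<lambda>y. norm (f y)" and g="gauss \<epsilon>"])
      (use f fourier_gauss(1)[OF e] in \<open>auto simp: norm_mult\<close>)
  also have "\<dots> = (LINT y|lborel. f y * of_real (gauss_kernel \<epsilon> (x - y)))"
    by (simp add: fourier_gauss(2)[OF e])
  finally show ?thesis .
qed

lemma tendsto_gauss_approx: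
  fixes f :: "real^'n::finite \<Rightarrow> complex"
  assumes f: "f \<in> schwartz_space"
  shows "(\<lambda>k. LINT y|lborel. f y * of_real (gauss_kernel (1 / real (Suc k)) (x - y))) \<longlonglongrightarrow> (2 * of_real pi) ^ CARD('n) * f x"
proof -
  have [measurable]: "f \<in> borel_measurable borel" using f by (rule schwartz_measurable)
  obtain C where C: "\<And>x. norm (f x) \<le> C" using schwartz_decay[OF f, of 0] by auto
  define t where "t k = 1 / real (Suc k)" for k
  have t: "0 < t k" for k by (simp add: t_def)
  have t0: "t \<longlonglongrightarrow> 0" unfolding t_def using LIMSEQ_inverse_real_of_nat by (simp add: inverse_eq_divide)
  have eq: "(LINT y|lborel. f y * of_real (gauss_kernel (t k) (x - y))) = (LINT y|lborel. f (x + t k *\<^sub>R y) * of_real (gauss_kernel 1 y))" for k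
  proof -
    \<comment> \<open>The Jacobian of the substitution exactly undoes the scaling of the kernel, so
      that only the argument of \<open>f\<close> still depends on \<open>k\<close>.\<close>
    have g: "t k ^ CARD('n) *\<^sub>R gauss_kernel (t k) (- (t k *\<^sub>R y)) = gauss_kernel 1 y" for y :: "real^'n"
      using t[of k] by (simp add: gauss_kernel_def gauss_def power_divide)
    show ?thesis
      apply (subst integral_affine(2)[of "t k" _ x])
      using t[of k] apply simp
      using t[of k] apply (simp add: integral_scaleR_right[symmetric] g[symmetric] del: integral_scaleR_right)
      apply (simp add: scaleR_conv_of_real mult_ac)
      done
  qed
  have "(\<lambda>k. LINT y|lborel. f (x + t k *\<^sub>R y) * of_real (gauss_kernel 1 y)) \<longlonglongrightarrow> (LINT y|lborel. f x * of_real (gauss_kernel 1 (y::real^'n)))"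
  proof (rule integral_dominated_convergence)
    show "integrable lborel (\<lambda>y::real^'n. C * gauss_kernel 1 y)"
      by (intro integrable_mult_right gauss_kernel_integral) simp
    show "AE y in lborel. norm (f (x + t k *\<^sub>R y) * of_real (gauss_kernel 1 y)) \<le> C * gauss_kernel 1 y" for k
      by (auto simp: norm_mult gauss_kernel_nonneg intro!: AE_I2 mult_right_mono C)
    show "AE y in lborel. (\<lambda>k. f (x + t k *\<^sub>R y) * of_real (gauss_kernel 1 y)) \<longlonglongrightarrow> f x * of_real (gauss_kernel 1 y)"
    proof (rule AE_I2, rule tendsto_mult[OF _ tendsto_const])
      fix y :: "real^'n"
      have "(\<lambda>k. x + t k *\<^sub>R y) \<longlonglongrightarrow> x + 0 *\<^sub>R y" by (intro tendsto_intros t0)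
      then have "(\<lambda>k. f (x + t k *\<^sub>R y)) \<longlonglongrightarrow> f (x + 0 *\<^sub>R y)"
        using schwartz_continuous[OF f, of UNIV] by (intro continuous_on_tendsto_compose[of UNIV f]) auto
      then show "(\<lambda>k. f (x + t k *\<^sub>R y)) \<longlonglongrightarrow> f x" by simp
    qed
  qed auto
  moreover have "(LINT y|lborel. f x * of_real (gauss_kernel 1 (y::real^'n))) = (2 * of_real pi) ^ CARD('n) * f x"
    using gauss_kernel_integral(2)[of 1, where 'n='n] by (simp add: mult.commute)
  ultimately show ?thesis by (simp only: eq[unfolded t_def] t_def)
qed

text \<open>The damped inversion integral has two limits as the damping disappears: convolution with
  the Gaussian kernel tends to a multiple of \<open>f x\<close>, while domination by the integrable
  \<open>fourier f\<close> gives the undamped integral.\<close>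

theorem fourier_inversion:
  fixes f :: "real^'n::finite \<Rightarrow> complex"
  assumes f: "f \<in> schwartz_space"
  shows "fourier_inv (fourier f) = f"
proof
  fix x
  have [measurable]: "fourier f \<in> borel_measurable borel" by (intro schwartz_measurable fourier_schwartz f)
  define t where "t k = 1 / real (Suc k)" for k
  have t: "0 < t k" for k by (simp add: t_def)
  have t0: "t \<longlonglongrightarrow> 0" unfolding t_def using LIMSEQ_inverse_real_of_nat by (simp add: inverse_eq_divide)
  have "(\<lambda>k. LINT \<xi>|lborel. fourier f \<xi> * (iexp (x \<bullet> \<xi>) * of_real (gauss (t k) \<xi>))) \<longlonglongrightarrow> (2 * of_real pi) ^ CARD('n) * f x"
    unfolding fourier_gauss_swap[OF schwartz_integrable[OF f] t] unfolding t_def by (rule tendsto_gauss_approx[OF f])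
  moreover have "(\<lambda>k. LINT \<xi>|lborel. fourier f \<xi> * (iexp (x \<bullet> \<xi>) * of_real (gauss (t k) \<xi>)))
     \<longlonglongrightarrow> (LINT \<xi>|lborel. iexp (x \<bullet> \<xi>) * fourier f \<xi>)"
  proof (rule integral_dominated_convergence)
    show "integrable lborel (\<lambda>\<xi>. norm (fourier f \<xi>))"
      by (intro integrable_norm schwartz_integrable fourier_schwartz f)
    show "AE \<xi> in lborel. norm (fourier f \<xi> * (iexp (x \<bullet> \<xi>) * of_real (gauss (t k) \<xi>))) \<le> norm (fourier f \<xi>)" for k
      by (auto simp: norm_mult intro!: AE_I2 mult_left_le gauss_le_one)
    show "AE \<xi> in lborel. (\<lambda>k. fourier f \<xi> * (iexp (x \<bullet> \<xi>) * of_real (gauss (t k) \<xi>))) \<longlonglongrightarrow> iexp (x \<bullet> \<xi>) * fourier f \<xi>"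
    proof (rule AE_I2)
      fix \<xi> :: "real^'n"
      have "(\<lambda>k. exp (- (t k * norm \<xi>)\<^sup>2 / 2)) \<longlonglongrightarrow> exp (- (0 * norm \<xi>)\<^sup>2 / 2)" by (intro tendsto_intros t0) simp
      then have "(\<lambda>k. gauss (t k) \<xi>) \<longlonglongrightarrow> 1" by (simp add: gauss_def)
      then have "(\<lambda>k. fourier f \<xi> * (iexp (x \<bullet> \<xi>) * of_real (gauss (t k) \<xi>))) \<longlonglongrightarrow> fourier f \<xi> * (iexp (x \<bullet> \<xi>) * of_real 1)"
        by (intro tendsto_intros)
      then show "(\<lambda>k. fourier f \<xi> * (iexp (x \<bullet> \<xi>) * of_real (gauss (t k) \<xi>))) \<longlonglongrightarrow> iexp (x \<bullet> \<xi>) * fourier f \<xi>"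
        by (simp add: mult.commute)
    qed
  qed auto
  ultimately have "(2 * of_real pi) ^ CARD('n) * f x = (LINT \<xi>|lborel. iexp (x \<bullet> \<xi>) * fourier f \<xi>)"
    by (rule LIMSEQ_unique)
  then show "fourier_inv (fourier f) x = f x"
    unfolding fourier_inv_def by (simp add: divide_eq_eq mult.commute)
qed

lemma fourier_reflect: "fourier (\<lambda>x. f (- x)) \<xi> = fourier f (- \<xi>)"
proof -
  have "fourier f (- \<xi>) = (LINT x|lborel. iexp (x \<bullet> \<xi>) * f x)"
    by (simp add: fourier_def)
  also have "\<dots> = fourier (\<lambda>x. f (- x)) \<xi>"
    by (subst integral_affine(2)[where c="-1" and t=0]) (simp_all add: fourier_def)
  finally show ?thesis by simp
qed

text \<open>Up to a constant, \<open>fourier_inv\<close> is \<open>fourier\<close> followed by a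
  reflection, and reflections commute with \<open>fourier\<close>; so the two orders of composition
  agree.\<close>

theorem fourier_inv_inversion:
  fixes f :: "real^'n::finite \<Rightarrow> complex"
  assumes f: "f \<in> schwartz_space"
  shows "fourier (fourier_inv f) = f"
proof
  fix x
  have "fourier (fourier_inv f) x = fourier (\<lambda>x. (1 / (2 * of_real pi) ^ CARD('n)) * fourier f (- x)) x"
    by (simp add: fourier_inv_eq[abs_def])
  also have "\<dots> = (1 / (2 * of_real pi) ^ CARD('n)) * fourier (fourier f) (- x)"
    unfolding fourier_cmult fourier_reflect ..
  also have "\<dots> = fourier_inv (fourier f) x"
    by (simp add: fourier_inv_eq)
  finally show "fourier (fourier_inv f) x = f x" by (simp add: fourier_inversion[OF f])
qed

subsection \<open>Plancherel\<close>

lemma integral_norm_bound_nn_integral: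
  fixes f :: "'a \<Rightarrow> 'b::{banach,second_countable_topology}"
  shows "ennreal (norm (integral\<^sup>L M f)) \<le> (\<integral>\<^sup>+x. ennreal (norm (f x)) \<partial>M)"
  by (cases "integrable M f") (auto simp: integral_norm_bound_ennreal not_integrable_integral_eq)

lemma measurable_cnj [measurable]: "cnj \<in> borel_measurable borel"
  by (intro borel_measurable_continuous_onI continuous_intros)

lemma measurable_fourier [measurable]:
  assumes [measurable]: "f \<in> borel_measurable borel"
  shows "fourier (f :: real^'n::finite \<Rightarrow> complex) \<in> borel_measurable borel"
  unfolding fourier_def[abs_def] by measurable

lemma gauss_kernel_minus: "gauss_kernel \<epsilon> (- x) = gauss_kernel \<epsilon> x"
  by (simp add: gauss_kernel_def gauss_def)

lemma nn_integral_gauss_kernel: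
  assumes "0 < \<epsilon>"
  shows "(\<integral>\<^sup>+y. ennreal (gauss_kernel \<epsilon> (x - y)) \<partial>(lborel :: (real^'n::finite) measure)) = ennreal ((2 * pi) ^ CARD('n))"
    "(\<integral>\<^sup>+y. ennreal (gauss_kernel \<epsilon> (y - x)) \<partial>(lborel :: (real^'n::finite) measure)) = ennreal ((2 * pi) ^ CARD('n))"
proof -
  have K: "(\<integral>\<^sup>+y. ennreal (gauss_kernel \<epsilon> y) \<partial>(lborel :: (real^'n::finite) measure)) = ennreal ((2 * pi) ^ CARD('n))"
    by (subst nn_integral_eq_integral) (auto simp: gauss_kernel_integral assms gauss_kernel_nonneg)
  show "(\<integral>\<^sup>+y. ennreal (gauss_kernel \<epsilon> (x - y)) \<partial>(lborel :: (real^'n::finite) measure)) = ennreal ((2 * pi) ^ CARD('n))"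
    unfolding K[symmetric] by (subst nn_integral_affine[of _ "-1" x], simp, simp)
      (simp add: gauss_kernel_minus[symmetric, of _ "x - _"])
  show "(\<integral>\<^sup>+y. ennreal (gauss_kernel \<epsilon> (y - x)) \<partial>(lborel :: (real^'n::finite) measure)) = ennreal ((2 * pi) ^ CARD('n))"
    unfolding K[symmetric] by (subst (2) nn_integral_affine[of _ "1" "- x"], simp, simp) (simp add: add.commute)
qed

text \<open>Writing the square as a product with the conjugate and exchanging integrals gives a
  double integral of g(x) and conj(g(y)) against the Gaussian kernel in x - y. Schur's test
  finishes: the product of moduli is at most half the sum of squares, and the kernel has mass
  \<open>(2 * pi) ^ CARD('n)\<close> in each variable.\<close>

lemma fourier_L1_L2_damped:
  fixes g :: "real^'n::finite \<Rightarrow> complex"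
  assumes g: "integrable lborel g" and g2: "square_integrable_on UNIV g" and e: "0 < \<epsilon>"
  shows "(\<integral>\<^sup>+\<xi>. ennreal ((norm (fourier g \<xi>))\<^sup>2 * gauss \<epsilon> \<xi>) \<partial>lborel) \<le> ennreal ((2 * pi) ^ CARD('n)) * (\<integral>\<^sup>+x. ennreal ((norm (g x))\<^sup>2) \<partial>lborel)"
proof -
  have [measurable]: "g \<in> borel_measurable borel" using g by auto
  define B where "B = (LINT x|lborel. norm (g x))"
  have B: "norm (fourier g \<xi>) \<le> B" for \<xi> unfolding B_def by (rule fourier_norm_le[OF g])
  have B0: "0 \<le> B" using B[of 0] norm_ge_zero order_trans by blast
  define A where "A \<xi> = cnj (fourier g \<xi>) * of_real (gauss \<epsilon> \<xi>)" for \<xi>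
  have [measurable]: "A \<in> borel_measurable borel" unfolding A_def by measurable
  have Ab: "norm (A \<xi>) \<le> B * gauss \<epsilon> \<xi>" for \<xi>
    unfolding A_def by (auto simp: norm_mult intro!: mult_right_mono B)
  have Ai: "integrable lborel A"
    by (rule Bochner_Integration.integrable_bound[of _ "\<lambda>\<xi>. B * gauss \<epsilon> \<xi>"])
      (use Ab B0 in \<open>auto intro!: AE_I2 integrable_mult_right fourier_gauss(1)[OF e] simp: abs_of_nonneg\<close>)
  define H where "H x = (LINT \<xi>|lborel. exp (- \<i> * of_real (x \<bullet> \<xi>)) * A \<xi>)" for x
  have H: "H x = cnj (LINT y|lborel. g y * of_real (gauss_kernel \<epsilon> (x - y)))" for x
    unfolding fourier_gauss_swap[OF g e, symmetric]
    unfolding Bochner_Integration.integral_cnj[symmetric] H_def A_def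
    by (intro Bochner_Integration.integral_cong refl) (simp add: exp_cnj mult_ac)
  have J: "(LINT \<xi>|lborel. fourier g \<xi> * A \<xi>) = (LINT x|lborel. g x * H x)"
  proof -
    have "(LINT \<xi>|lborel. fourier g \<xi> * A \<xi>) = (LINT \<xi>|lborel. LINT x|lborel. exp (- \<i> * of_real (x \<bullet> \<xi>)) * g x * A \<xi>)"
      unfolding fourier_def by simp
    also have "\<dots> = (LINT x|lborel. LINT \<xi>|lborel. exp (- \<i> * of_real (x \<bullet> \<xi>)) * g x * A \<xi>)"
      by (rule Fubini_product_bound[where f="\<lambda>x. norm (g x)" and g="\<lambda>\<xi>. norm (A \<xi>)"])
        (use g Ai in \<open>auto simp: norm_mult\<close>)
    also have "\<dots> = (LINT x|lborel. g x * H x)"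
      unfolding H_def by (simp add: mult.assoc mult.left_commute[of _ "g _"])
    finally show ?thesis .
  qed
  have sq: "ennreal (a * b) \<le> ennreal (a\<^sup>2 / 2) + ennreal (b\<^sup>2 / 2)" if "0 \<le> a" "0 \<le> b" for a b :: real
  proof -
    have "ennreal (a * b) \<le> ennreal (a\<^sup>2 / 2 + b\<^sup>2 / 2)"
      using sum_squares_bound[of a b] by (intro ennreal_leI) simp
    then show ?thesis by (simp add: ennreal_plus)
  qed
  let ?c = "(2 * pi) ^ CARD('n)"
  let ?N = "\<integral>\<^sup>+x. ennreal ((norm (g x))\<^sup>2 / 2) \<partial>lborel"
  have "(\<integral>\<^sup>+\<xi>. ennreal ((norm (fourier g \<xi>))\<^sup>2 * gauss \<epsilon> \<xi>) \<partial>lborel) = ennreal (norm (LINT \<xi>|lborel. fourier g \<xi> * A \<xi>))"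
  proof -
    have eq: "fourier g \<xi> * A \<xi> = of_real ((norm (fourier g \<xi>))\<^sup>2 * gauss \<epsilon> \<xi>)" for \<xi>
      by (simp only: A_def complex_norm_square of_real_mult mult.assoc)
    have i: "integrable lborel (\<lambda>\<xi>. fourier g \<xi> * A \<xi>)"
      by (rule Bochner_Integration.integrable_bound[of _ "\<lambda>\<xi>. B * norm (A \<xi>)"])
        (use Ai B B0 in \<open>auto intro!: AE_I2 integrable_mult_right mult_right_mono simp: norm_mult abs_of_nonneg\<close>)
    then have i': "integrable lborel (\<lambda>\<xi>. (norm (fourier g \<xi>))\<^sup>2 * gauss \<epsilon> \<xi>)"
      unfolding eq complex_of_real_integrable_eq .
    have "ennreal (norm (LINT \<xi>|lborel. fourier g \<xi> * A \<xi>)) = ennreal (LINT \<xi>|lborel. (norm (fourier g \<xi>))\<^sup>2 * gauss \<epsilon> \<xi>)"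
      unfolding eq integral_complex_of_real norm_of_real by (subst abs_of_nonneg) (auto intro!: integral_nonneg_AE)
    then show ?thesis by (subst nn_integral_eq_integral[OF i']) auto
  qed
  also have "\<dots> \<le> (\<integral>\<^sup>+x. ennreal (norm (g x * H x)) \<partial>lborel)"
    unfolding J by (rule integral_norm_bound_nn_integral)
  also have "\<dots> \<le> (\<integral>\<^sup>+x. (\<integral>\<^sup>+y. ennreal (norm (g x) * norm (g y)) * ennreal (gauss_kernel \<epsilon> (x - y)) \<partial>lborel) \<partial>lborel)"
  proof (rule nn_integral_mono)
    fix x
    have "ennreal (norm (H x)) \<le> (\<integral>\<^sup>+y. ennreal (norm (g y * of_real (gauss_kernel \<epsilon> (x - y)))) \<partial>lborel)"
      unfolding H complex_mod_cnj by (rule integral_norm_bound_nn_integral)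
    then have "ennreal (norm (g x * H x)) \<le> ennreal (norm (g x)) * (\<integral>\<^sup>+y. ennreal (norm (g y * of_real (gauss_kernel \<epsilon> (x - y)))) \<partial>lborel)"
      unfolding norm_mult by (simp add: ennreal_mult mult_left_mono)
    also have "\<dots> = (\<integral>\<^sup>+y. ennreal (norm (g x) * norm (g y)) * ennreal (gauss_kernel \<epsilon> (x - y)) \<partial>lborel)"
      by (subst nn_integral_cmult[symmetric])
        (auto intro!: nn_integral_cong simp: norm_mult ennreal_mult gauss_kernel_nonneg e mult.assoc)
    finally show "ennreal (norm (g x * H x)) \<le> (\<integral>\<^sup>+y. ennreal (norm (g x) * norm (g y)) * ennreal (gauss_kernel \<epsilon> (x - y)) \<partial>lborel)" .
  qed
  also have "\<dots> \<le> (\<integral>\<^sup>+x. (\<integral>\<^sup>+y. ennreal ((norm (g x))\<^sup>2 / 2) * ennreal (gauss_kernel \<epsilon> (x - y)) + ennreal ((norm (g y))\<^sup>2 / 2) * ennreal (gauss_kernel \<epsilon> (x - y)) \<partial>lborel) \<partial>lborel)"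
    unfolding distrib_right[symmetric] by (intro nn_integral_mono mult_right_mono sq) auto
  also have "\<dots> = (\<integral>\<^sup>+x. (\<integral>\<^sup>+y. ennreal ((norm (g x))\<^sup>2 / 2) * ennreal (gauss_kernel \<epsilon> (x - y)) \<partial>lborel) \<partial>lborel)
      + (\<integral>\<^sup>+x. (\<integral>\<^sup>+y. ennreal ((norm (g y))\<^sup>2 / 2) * ennreal (gauss_kernel \<epsilon> (x - y)) \<partial>lborel) \<partial>lborel)"
    by (subst nn_integral_add[symmetric]) (auto intro!: nn_integral_cong nn_integral_add)
  also have "(\<integral>\<^sup>+x. (\<integral>\<^sup>+y. ennreal ((norm (g x))\<^sup>2 / 2) * ennreal (gauss_kernel \<epsilon> (x - y)) \<partial>lborel) \<partial>lborel) = ?N * ennreal ?c"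
    by (subst nn_integral_cmult) (auto simp: nn_integral_gauss_kernel(1)[OF e] nn_integral_multc)
  also have "(\<integral>\<^sup>+x. (\<integral>\<^sup>+y. ennreal ((norm (g y))\<^sup>2 / 2) * ennreal (gauss_kernel \<epsilon> (x - y)) \<partial>lborel) \<partial>lborel)
     = (\<integral>\<^sup>+y. (\<integral>\<^sup>+x. ennreal ((norm (g y))\<^sup>2 / 2) * ennreal (gauss_kernel \<epsilon> (x - y)) \<partial>lborel) \<partial>lborel)"
    by (rule lborel_pair.Fubini') measurable
  also have "\<dots> = ?N * ennreal ?c"
    by (subst nn_integral_cmult) (auto simp: nn_integral_gauss_kernel(2)[OF e] nn_integral_multc)
  also have "?N * ennreal ?c + ?N * ennreal ?c = ennreal ?c * (?N + ?N)"
    by (simp add: distrib_left mult.commute)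
  also have "?N + ?N = (\<integral>\<^sup>+x. ennreal ((norm (g x))\<^sup>2) \<partial>lborel)"
    by (subst nn_integral_add[symmetric]) (auto intro!: nn_integral_cong simp: ennreal_plus[symmetric] simp del: ennreal_plus)
  finally show ?thesis .
qed

text \<open>The damped bound does not depend on \<epsilon>, so Fatou's lemma removes the
  damping.\<close>

lemma fourier_L1_L2:
  fixes g :: "real^'n::finite \<Rightarrow> complex"
  assumes g: "integrable lborel g" and g2: "square_integrable_on UNIV g"
  shows "(\<integral>\<^sup>+\<xi>. ennreal ((norm (fourier g \<xi>))\<^sup>2) \<partial>lborel) \<le> ennreal ((2 * pi) ^ CARD('n)) * (\<integral>\<^sup>+x. ennreal ((norm (g x))\<^sup>2) \<partial>lborel)" (is "_ \<le> ?B")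
proof -
  have [measurable]: "g \<in> borel_measurable borel" using g by auto
  define t where "t k = 1 / real (Suc k)" for k
  have t: "0 < t k" for k by (simp add: t_def)
  have t0: "t \<longlonglongrightarrow> 0" unfolding t_def using LIMSEQ_inverse_real_of_nat by (simp add: inverse_eq_divide)
  have "(\<lambda>k. ennreal ((norm (fourier g \<xi>))\<^sup>2 * gauss (t k) \<xi>)) \<longlonglongrightarrow> ennreal ((norm (fourier g \<xi>))\<^sup>2)" for \<xi> :: "real^'n"
  proof (rule tendsto_ennrealI)
    have "(\<lambda>k. (norm (fourier g \<xi>))\<^sup>2 * exp (- (t k * norm \<xi>)\<^sup>2 / 2)) \<longlonglongrightarrow> (norm (fourier g \<xi>))\<^sup>2 * exp (- (0 * norm \<xi>)\<^sup>2 / 2)"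
      by (intro tendsto_intros t0) simp
    then show "(\<lambda>k. (norm (fourier g \<xi>))\<^sup>2 * gauss (t k) \<xi>) \<longlonglongrightarrow> (norm (fourier g \<xi>))\<^sup>2" by (simp add: gauss_def)
  qed
  then have "(\<integral>\<^sup>+\<xi>. ennreal ((norm (fourier g \<xi>))\<^sup>2) \<partial>lborel) = (\<integral>\<^sup>+\<xi>. liminf (\<lambda>k. ennreal ((norm (fourier g \<xi>))\<^sup>2 * gauss (t k) \<xi>)) \<partial>lborel)"
    by (intro nn_integral_cong) (metis lim_imp_Liminf sequentially_bot)
  also have "\<dots> \<le> liminf (\<lambda>k. \<integral>\<^sup>+\<xi>. ennreal ((norm (fourier g \<xi>))\<^sup>2 * gauss (t k) \<xi>) \<partial>lborel)"
    by (rule nn_integral_liminf) measurable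
  also have "\<dots> \<le> ?B"
    using fourier_L1_L2_damped[OF g g2 t] by (intro Liminf_le) (auto intro!: always_eventually)
  finally show ?thesis .
qed

lemma square_integrable_tail:
  fixes g :: "real^'n::finite \<Rightarrow> complex"
  assumes g: "square_integrable_on UNIV g"
  shows "(\<lambda>k. LINT x|lborel. (norm (if real k \<le> norm x then g x else 0))\<^sup>2) \<longlonglongrightarrow> 0"
proof -
  have [measurable]: "g \<in> borel_measurable borel" using g by (simp add: square_integrable_UNIV)
  have "(\<lambda>k. LINT x|lborel. (norm (if real k \<le> norm x then g x else 0))\<^sup>2) \<longlonglongrightarrow> (LINT x|lborel. (0::real) * norm (x::real^'n))"
  proof (rule integral_dominated_convergence)
    show "integrable lborel (\<lambda>x. (norm (g x))\<^sup>2)" using g by (simp add: square_integrable_UNIV)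
    show "AE x in lborel. (\<lambda>k. (norm (if real k \<le> norm x then g x else 0))\<^sup>2) \<longlonglongrightarrow> 0 * norm x"
    proof (rule AE_I2)
      fix x :: "real^'n"
      have "eventually (\<lambda>k. (norm (if real k \<le> norm x then g x else 0))\<^sup>2 = 0) sequentially"
        using eventually_gt_at_top[of "nat \<lceil>norm x\<rceil>"] by eventually_elim (auto, linarith)
      then show "(\<lambda>k. (norm (if real k \<le> norm x then g x else 0))\<^sup>2) \<longlonglongrightarrow> 0 * norm x"
        unfolding mult_zero_left by (rule tendsto_eventually)
    qed
  qed auto
  then show ?thesis by simp
qed

text \<open>The transform of a square integrable \<open>g\<close> is the limit of the transforms of \<open>g\<close> cut off at radii
  \<open>R k\<close>; these grow so fast that \<open>4 ^ k\<close> times the squared norms of the increments is still summable,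
  so that the root of \<open>\<Sum> 4 ^ k \<bar>D k\<bar>\<^sup>2\<close> dominates the telescoping series.\<close>

theorem plancherel_exists:
  fixes g :: "real^'n::finite \<Rightarrow> complex"
  assumes g: "square_integrable_on UNIV g"
  obtains h where "square_integrable_on UNIV h"
    "\<And>f. f \<in> schwartz_space \<Longrightarrow> (LINT x|lborel. g x * fourier f x) = (LINT x|lborel. h x * f x)"
proof -
  have gm[measurable]: "g \<in> borel_measurable borel" using g by (simp add: square_integrable_UNIV)
  have g2: "integrable lborel (\<lambda>x. (norm (g x))\<^sup>2)" using g by (simp add: square_integrable_UNIV)
  define T where "T k = (LINT x|lborel. (norm (if real k \<le> norm x then g x else 0))\<^sup>2)" for k
  have "\<exists>r. \<forall>m\<ge>r. T m \<le> 1 / 8 ^ k" for k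
    using order_tendstoD(2)[OF square_integrable_tail[OF g], of "1 / 8 ^ k"]
    unfolding T_def[symmetric] eventually_sequentially by (auto intro: less_imp_le)
  then obtain r where r: "\<And>k m. r k \<le> m \<Longrightarrow> T m \<le> 1 / 8 ^ k" by metis
  \<comment> \<open>The sum makes the radii monotone and at least \<open>r k\<close>; the summand
    \<open>k\<close> makes them exhaust the space.\<close>
  define R where "R k = k + (\<Sum>j\<le>k. r j)" for k
  have R_mono: "R k \<le> R (Suc k)" for k by (simp add: R_def)
  have R_ge: "k \<le> R k" for k by (simp add: R_def)
  have R_r: "r k \<le> R k" for k unfolding R_def by (meson atMost_iff finite_atMost le_refl member_le_sum trans_le_add2 zero_le)
  define G where "G k x = (if norm x < real (R k) then g x else 0)" for k x
  define D where "D k x = (if real (R k) \<le> norm x \<and> norm x < real (R (Suc k)) then g x else 0)" for k x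
  have [measurable]: "G k \<in> borel_measurable borel" "D k \<in> borel_measurable borel" for k
    unfolding G_def[abs_def] D_def[abs_def] by measurable
  have G_Suc: "G (Suc k) x = G k x + D k x" for k x
    using R_mono[of k] by (auto simp: G_def D_def)
  have ball: "integrable lborel (\<lambda>x::real^'n. indicator (cball 0 r) x :: real)" for r
    using emeasure_bounded_finite[OF bounded_cball] by (intro integrable_real_indicator) auto
  have loc: "integrable lborel (\<lambda>x. if P x then g x else 0) \<and> square_integrable_on UNIV (\<lambda>x. if P x then g x else 0)"
    if P: "\<And>x. P x \<Longrightarrow> norm x \<le> r" "Measurable.pred borel P" for P and r :: real
  proof
    have [measurable]: "Measurable.pred borel P" by fact
    show s: "square_integrable_on UNIV (\<lambda>x. if P x then g x else 0)"
      by (rule square_integrable_bound[OF g, of _ 1]) auto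
    show "integrable lborel (\<lambda>x. if P x then g x else 0)"
    proof (rule Bochner_Integration.integrable_bound)
      show "integrable lborel (\<lambda>x. indicator (cball 0 r) x + (norm (g x))\<^sup>2)" using ball g2 by simp
      show "AE x in lborel. norm (if P x then g x else 0) \<le> norm (indicator (cball 0 r) x + (norm (g x))\<^sup>2)"
      proof (rule AE_I2)
        fix x
        \<comment> \<open>On a bounded set square integrability implies integrability, so the
          cut-off functions have pointwise defined transforms.\<close>
        have "norm (g x) \<le> 1 + (norm (g x))\<^sup>2"
          using sum_squares_bound[of "norm (g x)" 1] norm_ge_zero[of "g x"] unfolding power_one mult_1_right by linarith
        then show "norm (if P x then g x else 0) \<le> norm (indicator (cball 0 r) x + (norm (g x))\<^sup>2)"
          using P(1)[of x] by (auto simp: indicator_def)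
      qed
    qed simp
  qed
  have G: "integrable lborel (G k)" "square_integrable_on UNIV (G k)" for k
    using loc[of "\<lambda>x. norm x < real (R k)" "real (R k)"] by (auto simp: G_def[abs_def])
  have D: "integrable lborel (D k)" "square_integrable_on UNIV (D k)" for k
    using loc[of "\<lambda>x. real (R k) \<le> norm x \<and> norm x < real (R (Suc k))" "real (R (Suc k))"] by (auto simp: D_def[abs_def])
  define c where "c = (2 * pi) ^ CARD('n)"
  have c0: "0 \<le> c" by (simp add: c_def)
  \<comment> \<open>The tail beyond \<open>R k\<close> is at most \<open>1 / 8 ^ k\<close>; the
    weight \<open>4 ^ k\<close> leaves the summable \<open>(1/2) ^ k\<close>.\<close>
  have FD: "(\<integral>\<^sup>+\<xi>. ennreal (4 ^ k * (norm (fourier (D k) \<xi>))\<^sup>2) \<partial>lborel) \<le> ennreal (c * (1/2) ^ k)" for k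
  proof -
    have "(\<integral>\<^sup>+x. ennreal ((norm (D k x))\<^sup>2) \<partial>lborel) \<le> ennreal (1 / 8 ^ k)"
    proof -
      have "(\<integral>\<^sup>+x. ennreal ((norm (D k x))\<^sup>2) \<partial>lborel) = ennreal (LINT x|lborel. (norm (D k x))\<^sup>2)"
        using D(2)[of k] by (intro nn_integral_eq_integral) (auto simp: square_integrable_UNIV)
      also have "(LINT x|lborel. (norm (D k x))\<^sup>2) \<le> T (R k)"
        unfolding T_def
      proof (rule integral_mono)
        show "integrable lborel (\<lambda>x. (norm (D k x))\<^sup>2)" using D(2) by (simp add: square_integrable_UNIV)
        have "square_integrable_on UNIV (\<lambda>x. if real (R k) \<le> norm x then g x else 0)"
          by (rule square_integrable_bound[OF g, of _ 1]) auto
        then show "integrable lborel (\<lambda>x. (norm (if real (R k) \<le> norm x then g x else 0))\<^sup>2)"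
          by (simp add: square_integrable_UNIV)
      qed (auto simp: D_def)
      also have "\<dots> \<le> 1 / 8 ^ k" by (rule r[OF R_r])
      finally show ?thesis by (simp add: ennreal_leI)
    qed
    then have "(\<integral>\<^sup>+\<xi>. ennreal ((norm (fourier (D k) \<xi>))\<^sup>2) \<partial>lborel) \<le> ennreal c * ennreal (1 / 8 ^ k)"
      using fourier_L1_L2[OF D] unfolding c_def[symmetric] by (meson mult_left_mono order_trans zero_le)
    then have "ennreal (4 ^ k) * (\<integral>\<^sup>+\<xi>. ennreal ((norm (fourier (D k) \<xi>))\<^sup>2) \<partial>lborel) \<le> ennreal (4 ^ k) * (ennreal c * ennreal (1 / 8 ^ k))"
      by (intro mult_left_mono) auto
    also have "\<dots> = ennreal (4 ^ k * (c * (1 / 8 ^ k)))"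
      by (subst ennreal_mult, simp, simp add: c0, subst ennreal_mult) (simp_all add: c0)
    also have "4 ^ k * (c * (1 / 8 ^ k)) = c * (1/2) ^ k"
    proof -
      have "(4::real) ^ k * (1 / 8 ^ k) = (4 * (1 / 8)) ^ k" by (simp only: power_mult_distrib power_one_over)
      then have "c * ((4::real) ^ k * (1 / 8 ^ k)) = c * (1/2) ^ k" by simp
      then show ?thesis by (simp only: mult.left_commute)
    qed
    finally show ?thesis
      by (simp add: ennreal_mult nn_integral_cmult)
  qed
  define E where "E \<xi> = (\<Sum>k. ennreal (4 ^ k * (norm (fourier (D k) \<xi>))\<^sup>2))" for \<xi>
  have [measurable]: "E \<in> borel_measurable borel" unfolding E_def by measurable
  have "(\<integral>\<^sup>+\<xi>. E \<xi> \<partial>lborel) = (\<Sum>k. \<integral>\<^sup>+\<xi>. ennreal (4 ^ k * (norm (fourier (D k) \<xi>))\<^sup>2) \<partial>lborel)"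
    unfolding E_def by (rule nn_integral_suminf) measurable
  also have "\<dots> \<le> (\<Sum>k. ennreal (c * (1/2) ^ k))"
    by (intro suminf_le FD) auto
  also have "\<dots> = ennreal (\<Sum>k. c * (1/2) ^ k)"
    using c0 by (intro suminf_ennreal2) (auto intro!: summable_mult summable_geometric)
  also have "\<dots> < \<infinity>" by simp
  finally have Ef: "(\<integral>\<^sup>+\<xi>. E \<xi> \<partial>lborel) < \<infinity>" .
  then have EAE: "AE \<xi> in lborel. E \<xi> \<noteq> \<infinity>" by (intro nn_integral_PInf_AE) auto
  \<comment> \<open>Where \<open>E\<close> is infinite this is 0 by default, which is harmless
    because that set is null.\<close>
  define e where "e \<xi> = enn2real (E \<xi>)" for \<xi>
  have [measurable]: "e \<in> borel_measurable borel" unfolding e_def by measurable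
  have e0: "0 \<le> e \<xi>" for \<xi> by (simp add: e_def)
  have ei: "integrable lborel e"
  proof (rule integrableI_bounded)
    have "(\<integral>\<^sup>+\<xi>. ennreal (norm (e \<xi>)) \<partial>lborel) \<le> (\<integral>\<^sup>+\<xi>. E \<xi> \<partial>lborel)"
    proof (rule nn_integral_mono)
      show "ennreal (norm (e x)) \<le> E x" for x
        by (cases "E x" rule: ennreal_cases) (auto simp: e_def)
    qed
    then show "(\<integral>\<^sup>+\<xi>. ennreal (norm (e \<xi>)) \<partial>lborel) < \<infinity>" using Ef by (rule le_less_trans)
  qed simp
  have De: "norm (fourier (D k) \<xi>) \<le> sqrt (e \<xi>) * (1/2) ^ k" if "E \<xi> \<noteq> \<infinity>" for k \<xi>
  proof -
    have "ennreal (4 ^ k * (norm (fourier (D k) \<xi>))\<^sup>2) \<le> E \<xi>"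
      unfolding E_def
      using sum_le_suminf[OF summableI finite.insertI[OF finite.emptyI], where f="\<lambda>k. ennreal (4 ^ k * (norm (fourier (D k) \<xi>))\<^sup>2)"]
      by (simp only: sum.insert[OF finite.emptyI] empty_iff not_False_eq_True sum.empty add_0_right zero_le)
    also have "E \<xi> = ennreal (e \<xi>)"
      unfolding e_def by (rule ennreal_enn2real[symmetric]) (use that in \<open>simp add: less_top\<close>)
    finally have "(2 ^ k * norm (fourier (D k) \<xi>))\<^sup>2 \<le> e \<xi>"
    proof -
      assume "ennreal (4 ^ k * (norm (fourier (D k) \<xi>))\<^sup>2) \<le> ennreal (e \<xi>)"
      then have "4 ^ k * (norm (fourier (D k) \<xi>))\<^sup>2 \<le> e \<xi>" using e0 by simp
      moreover have "((2::real) ^ k)\<^sup>2 = (2 * 2) ^ k" by (simp only: power2_eq_square power_mult_distrib)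
      ultimately show ?thesis by (simp add: power_mult_distrib)
    qed
    then have "2 ^ k * norm (fourier (D k) \<xi>) \<le> sqrt (e \<xi>)" by (rule real_le_rsqrt)
    then show ?thesis by (simp add: power_one_over field_simps)
  qed
  have F_Suc: "fourier (G (Suc k)) \<xi> = fourier (G k) \<xi> + fourier (D k) \<xi>" for k \<xi>
    using fourier_add[OF G(1) D(1), of k k \<xi>] by (simp add: G_Suc[abs_def])
  have F_sum: "fourier (G k) \<xi> = fourier (G 0) \<xi> + (\<Sum>j<k. fourier (D j) \<xi>)" for k \<xi>
    by (induction k) (auto simp: F_Suc)
  \<comment> \<open>Using \<open>lim\<close> everywhere makes \<open>h\<close> measurable at once;
    its value matters only where the sequence converges, hence almost everywhere.\<close>
  define h where "h \<xi> = lim (\<lambda>k. fourier (G k) \<xi>)" for \<xi>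
  have hm[measurable]: "h \<in> borel_measurable borel" unfolding h_def by measurable
  define H where "H \<xi> = norm (fourier (G 0) \<xi>) + 2 * sqrt (e \<xi>)" for \<xi>
  have [measurable]: "H \<in> borel_measurable borel" unfolding H_def by measurable
  have H0: "0 \<le> H \<xi>" for \<xi> by (simp add: H_def e0)
  have bound: "norm (fourier (G k) \<xi>) \<le> H \<xi>" if E: "E \<xi> \<noteq> \<infinity>" for k \<xi>
  proof -
    have "norm (fourier (G k) \<xi>) \<le> norm (fourier (G 0) \<xi>) + (\<Sum>j<k. norm (fourier (D j) \<xi>))"
      unfolding F_sum[of k] by (rule order_trans[OF norm_triangle_ineq add_left_mono[OF norm_sum]])
    also have "(\<Sum>j<k. norm (fourier (D j) \<xi>)) \<le> (\<Sum>j<k. sqrt (e \<xi>) * (1/2) ^ j)"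
      by (intro sum_mono De E)
    also have "\<dots> = sqrt (e \<xi>) * (\<Sum>j<k. (1/2) ^ j)" by (simp add: sum_distrib_left)
    also have "(\<Sum>j<k. (1/2::real) ^ j) \<le> 2"
      by (subst geometric_sum) (auto simp: divide_simps)
    finally show ?thesis using e0 by (simp add: H_def mult_left_mono mult.commute[of 2])
  qed
  have conv: "(\<lambda>k. fourier (G k) \<xi>) \<longlonglongrightarrow> h \<xi>" if E: "E \<xi> \<noteq> \<infinity>" for \<xi>
  proof -
    have "summable (\<lambda>j. fourier (D j) \<xi>)"
      by (rule summable_comparison_test'[where g="\<lambda>j. sqrt (e \<xi>) * (1/2) ^ j" and N=0])
        (auto intro!: summable_mult summable_geometric De E)
    then have "(\<lambda>k. fourier (G 0) \<xi> + (\<Sum>j<k. fourier (D j) \<xi>)) \<longlonglongrightarrow> fourier (G 0) \<xi> + (\<Sum>j. fourier (D j) \<xi>)"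
      by (intro tendsto_intros summable_LIMSEQ)
    then have "convergent (\<lambda>k. fourier (G k) \<xi>)" unfolding convergent_def F_sum[symmetric] by blast
    then show ?thesis unfolding h_def by (simp add: convergent_LIMSEQ_iff)
  qed
  have H2: "integrable lborel (\<lambda>\<xi>. (H \<xi>)\<^sup>2)"
  proof (rule Bochner_Integration.integrable_bound)
    have "integrable lborel (\<lambda>\<xi>. (norm (fourier (G 0) \<xi>))\<^sup>2)"
    proof (rule integrableI_bounded)
      have "(\<integral>\<^sup>+x. ennreal ((norm (G 0 x))\<^sup>2) \<partial>lborel) < \<infinity>"
        using G(2)[of 0] by (simp add: square_integrable_UNIV integrable_iff_bounded)
      then show "(\<integral>\<^sup>+\<xi>. ennreal (norm ((norm (fourier (G 0) \<xi>))\<^sup>2)) \<partial>lborel) < \<infinity>"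
        using fourier_L1_L2[OF G, of 0] by (simp add: ennreal_mult_less_top le_less_trans)
    qed simp
    then show "integrable lborel (\<lambda>\<xi>. 2 * (norm (fourier (G 0) \<xi>))\<^sup>2 + 8 * e \<xi>)" using ei by simp
    have "(H \<xi>)\<^sup>2 \<le> 2 * (norm (fourier (G 0) \<xi>))\<^sup>2 + 8 * e \<xi>" for \<xi>
    proof -
      have "(a + b)\<^sup>2 \<le> 2 * a\<^sup>2 + 2 * b\<^sup>2" for a b :: real
        using sum_squares_bound[of a b] by (simp add: power2_sum)
      from this[of "norm (fourier (G 0) \<xi>)" "2 * sqrt (e \<xi>)"] show ?thesis
        by (simp add: H_def power_mult_distrib e0)
    qed
    then show "AE \<xi> in lborel. norm ((H \<xi>)\<^sup>2) \<le> norm (2 * (norm (fourier (G 0) \<xi>))\<^sup>2 + 8 * e \<xi>)"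
      using e0 by (auto intro!: AE_I2)
  qed simp
  have hH: "AE \<xi> in lborel. norm (h \<xi>) \<le> H \<xi>"
    using EAE
  proof eventually_elim
    case (elim \<xi>)
    show ?case
      by (rule LIMSEQ_le_const2[OF tendsto_norm[OF conv[OF elim]]]) (use bound[OF elim] in blast)
  qed
  have h2: "square_integrable_on UNIV h"
    unfolding square_integrable_UNIV
  proof (intro conjI hm Bochner_Integration.integrable_bound[OF H2])
    show "AE \<xi> in lborel. norm ((norm (h \<xi>))\<^sup>2) \<le> norm ((H \<xi>)\<^sup>2)"
      using hH by eventually_elim (auto intro!: power_mono)
  qed simp
  moreover have "(LINT x|lborel. g x * fourier f x) = (LINT x|lborel. h x * f x)" if f: "f \<in> schwartz_space" for f
  proof -
    have [measurable]: "f \<in> borel_measurable borel" using f by (rule schwartz_measurable)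
    have Ff: "fourier f \<in> schwartz_space" using f by (rule fourier_schwartz)
    have swap: "(LINT x|lborel. G k x * fourier f x) = (LINT \<xi>|lborel. fourier (G k) \<xi> * f \<xi>)" for k
    proof -
      have "(LINT x|lborel. G k x * fourier f x) = (LINT x|lborel. LINT y|lborel. G k x * (exp (- \<i> * of_real (y \<bullet> x)) * f y))"
        unfolding fourier_def by simp
      also have "\<dots> = (LINT y|lborel. LINT x|lborel. G k x * (exp (- \<i> * of_real (y \<bullet> x)) * f y))"
        by (rule Fubini_product_bound[where f="\<lambda>x. norm (f x)" and g="\<lambda>y. norm (G k y)"])
          (use G(1)[of k] schwartz_integrable[OF f] in \<open>auto simp: norm_mult mult.commute\<close>)
      also have "\<dots> = (LINT \<xi>|lborel. fourier (G k) \<xi> * f \<xi>)"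
        unfolding fourier_def by (simp add: inner_commute mult_ac)
      finally show ?thesis .
    qed
    have "(\<lambda>k. LINT x|lborel. G k x * fourier f x) \<longlonglongrightarrow> (LINT x|lborel. g x * fourier f x)"
    proof (rule integral_dominated_convergence)
      show "integrable lborel (\<lambda>x. norm (g x * fourier f x))"
        by (intro integrable_norm square_integrable_mult g schwartz_square_integrable Ff)
      show "AE x in lborel. norm (G k x * fourier f x) \<le> norm (g x * fourier f x)" for k
        by (auto simp: G_def)
      show "AE x in lborel. (\<lambda>k. G k x * fourier f x) \<longlonglongrightarrow> g x * fourier f x"
      proof (rule AE_I2, rule tendsto_mult[OF _ tendsto_const])
        fix x
        have "eventually (\<lambda>k. G k x = g x) sequentially"
          using eventually_gt_at_top[of "nat \<lceil>norm x\<rceil>"]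
        proof eventually_elim
          case (elim k)
          then have "norm x < real (R k)" using R_ge[of k] by linarith
          then show ?case by (simp add: G_def)
        qed
        then show "(\<lambda>k. G k x) \<longlonglongrightarrow> g x" by (rule tendsto_eventually)
      qed
    qed auto
    moreover have "(\<lambda>k. LINT \<xi>|lborel. fourier (G k) \<xi> * f \<xi>) \<longlonglongrightarrow> (LINT \<xi>|lborel. h \<xi> * f \<xi>)"
    proof (rule integral_dominated_convergence)
      have "square_integrable_on UNIV (\<lambda>\<xi>. complex_of_real (H \<xi>))"
        using H2 by (simp add: square_integrable_UNIV)
      then have "integrable lborel (\<lambda>\<xi>. of_real (H \<xi>) * f \<xi>)"
        by (rule square_integrable_mult[OF _ schwartz_square_integrable[OF f]])
      then show "integrable lborel (\<lambda>\<xi>. norm (of_real (H \<xi>) * f \<xi>))" by (rule integrable_norm)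
      show "AE \<xi> in lborel. norm (fourier (G k) \<xi> * f \<xi>) \<le> norm (of_real (H \<xi>) * f \<xi>)" for k
        using EAE by eventually_elim (auto simp: norm_mult H0 intro!: mult_right_mono bound)
      show "AE \<xi> in lborel. (\<lambda>k. fourier (G k) \<xi> * f \<xi>) \<longlonglongrightarrow> h \<xi> * f \<xi>"
        using EAE by eventually_elim (auto intro!: tendsto_mult conv)
    qed auto
    ultimately show ?thesis unfolding swap by (rule LIMSEQ_unique)
  qed
  ultimately show ?thesis using that by blast
qed

subsection \<open>Sobolev spaces on the Fourier side\<close>

lemma symbols_sum: "finite A \<Longrightarrow> (\<And>i. i \<in> A \<Longrightarrow> f i \<in> symbols) \<Longrightarrow> (\<lambda>x. \<Sum>i\<in>A. f i x) \<in> symbols"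
  by (induction A rule: finite_induct) (auto intro: symbols.const symbols.add)

lemma symbols_one_plus_squares: "(\<lambda>x. 1 + (\<Sum>i\<in>A. (complex_of_real (x $ i))\<^sup>2)) \<in> symbols"
  unfolding power2_eq_square by (intro symbols.add symbols.const symbols_sum symbols.mult symbols.coord) simp

lemma sqrt_powr: "0 \<le> x \<Longrightarrow> sqrt x powr s = x powr (s / 2)"
  by (simp add: powr_half_sqrt[symmetric] powr_powr)

text \<open>The square root is absorbed into the exponent, because \<open>symbols.powr\<close> wants
  as base a polynomial with real part at least 1.\<close>

lemma symbols_sqrt_powr:
  fixes A :: "'n::finite set"
  shows "(\<lambda>x. complex_of_real (sqrt (1 + (\<Sum>i\<in>A. (x $ i)\<^sup>2)) powr s)) \<in> symbols"
proof -
  have "(\<lambda>x::real^'n. (1 + (\<Sum>i\<in>A. (complex_of_real (x $ i))\<^sup>2)) powr of_real (s / 2)) \<in> symbols"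
    by (rule symbols.powr[OF symbols_one_plus_squares]) (simp add: sum_nonneg)
  moreover have "(1 + (\<Sum>i\<in>A. (complex_of_real (x $ i))\<^sup>2)) powr of_real (s / 2)
     = complex_of_real (sqrt (1 + (\<Sum>i\<in>A. (x $ i)\<^sup>2)) powr s)" for x :: "real^'n"
  proof -
    have nn: "0 \<le> 1 + (\<Sum>i\<in>A. (x $ i)\<^sup>2)" by (simp add: add_nonneg_nonneg sum_nonneg)
    have "1 + (\<Sum>i\<in>A. (complex_of_real (x $ i))\<^sup>2) = of_real (1 + (\<Sum>i\<in>A. (x $ i)\<^sup>2))" by simp
    then show ?thesis using nn by (simp only: powr_of_real sqrt_powr)
  qed
  ultimately show ?thesis by simp
qed

lemma norm_sq_vec: "(norm x)\<^sup>2 = (\<Sum>i\<in>UNIV. (x $ i)\<^sup>2)" for x :: "real^'n::finite"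
  by (simp add: norm_vec_def L2_set_def sum_nonneg)

lemma symbols_bracket: "(\<lambda>\<xi>::real^'n::finite. complex_of_real (bracket \<xi> powr s)) \<in> symbols"
  unfolding bracket_def norm_sq_vec by (rule symbols_sqrt_powr)

lemma one_le_bracket': "1 \<le> bracket' \<xi>"
  by (simp add: bracket'_def sum_nonneg)

lemma symbols_bracket': "(\<lambda>\<xi>::real^'n::{finite,linorder}. complex_of_real (bracket' \<xi>)) \<in> symbols"
proof -
  have "bracket' \<xi> = bracket' \<xi> powr 1" for \<xi> :: "(real, 'n) vec"
    using one_le_bracket'[of \<xi>] by simp
  moreover have "(\<lambda>\<xi>::(real, 'n) vec. complex_of_real (bracket' \<xi> powr 1)) \<in> symbols"
    unfolding bracket'_def by (rule symbols_sqrt_powr)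
  ultimately show ?thesis by simp
qed

text \<open>The symbol of \<open>\<Xi>\<^sub>+\<^sup>t\<close> for \<open>\<sigma> = 1\<close> and of \<open>\<Xi>\<^sub>-\<^sup>t\<close> for \<open>\<sigma> = -1\<close>.\<close>

definition xi_symbol :: "real \<Rightarrow> real \<Rightarrow> real^'n::{finite,linorder} \<Rightarrow> complex" where
  "xi_symbol \<sigma> t \<xi> = (of_real (bracket' \<xi>) + \<i> * of_real (\<sigma> * last_coord \<xi>)) powr of_real t"

lemma symbols_xi_base: "(\<lambda>\<xi>::real^'n::{finite,linorder}. of_real (bracket' \<xi>) + \<i> * of_real (\<sigma> * last_coord \<xi>)) \<in> symbols"
  using symbols.add[OF symbols_bracket' symbols.mult[OF symbols.const[of "\<i> * of_real \<sigma>"] symbols.coord]]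
  by (simp add: last_coord_def mult.assoc)

lemma symbols_xi: "xi_symbol \<sigma> t \<in> symbols"
  unfolding xi_symbol_def[abs_def] by (rule symbols.powr[OF symbols_xi_base]) (simp add: one_le_bracket')

lemma xi_base_nonzero: "of_real (bracket' \<xi>) + \<i> * of_real (\<sigma> * last_coord \<xi>) \<noteq> 0"
  using one_le_bracket'[of \<xi>] by (auto simp: complex_eq_iff)

lemma xi_symbol_add: "xi_symbol \<sigma> (s + t) \<xi> = xi_symbol \<sigma> s \<xi> * xi_symbol \<sigma> t \<xi>"
  by (simp add: xi_symbol_def powr_add)

lemma xi_symbol_0: "xi_symbol \<sigma> 0 \<xi> = 1"
  using xi_base_nonzero[of \<xi> \<sigma>] by (simp add: xi_symbol_def)

lemma xi_symbol_minus: "xi_symbol \<sigma> (- t) \<xi> * xi_symbol \<sigma> t \<xi> = 1"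
  using xi_symbol_add[of \<sigma> "- t" t \<xi>] by (simp add: xi_symbol_0)

lemma norm_xi_symbol:
  assumes "\<bar>\<sigma>\<bar> = 1"
  shows "norm (xi_symbol \<sigma> t \<xi>) = bracket \<xi> powr t"
proof -
  have "\<sigma>\<^sup>2 = 1" using assms by (metis one_power2 power2_abs)
  then have "norm (of_real (bracket' \<xi>) + \<i> * of_real (\<sigma> * last_coord \<xi>)) = sqrt ((bracket' \<xi>)\<^sup>2 + (last_coord \<xi>)\<^sup>2)"
    by (simp add: cmod_def power_mult_distrib)
  also have "(bracket' \<xi>)\<^sup>2 + (last_coord \<xi>)\<^sup>2 = 1 + (norm \<xi>)\<^sup>2"
    unfolding norm_sq_vec last_coord_def
    by (subst sum.remove[of UNIV "Max UNIV"]) (simp_all add: bracket'_def sum_nonneg add_nonneg_nonneg)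
  finally have "norm (of_real (bracket' \<xi>) + \<i> * of_real (\<sigma> * last_coord \<xi>)) = bracket \<xi>"
    by (simp add: bracket_def)
  then show ?thesis by (simp add: xi_symbol_def norm_powr_real_powr')
qed

text \<open>Off the branch cut, conjugation commutes with the principal power, so the factors are
  complex conjugates and their product is a squared modulus.\<close>

lemma xi_symbol_mult_conj: "xi_symbol 1 a \<xi> * xi_symbol (- 1) a \<xi> = of_real (bracket \<xi> powr (2 * a))"
proof -
  have "xi_symbol (- 1) a \<xi> = cnj (xi_symbol 1 a \<xi>)"
    using one_le_bracket'[of \<xi>] unfolding xi_symbol_def
    by (subst cnj_powr) (auto simp: complex_nonpos_Reals_iff)
  then have "xi_symbol 1 a \<xi> * xi_symbol (- 1) a \<xi> = of_real ((norm (xi_symbol 1 a \<xi>))\<^sup>2)"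
    by (simp only: complex_norm_square)
  also have "(norm (xi_symbol 1 a \<xi>))\<^sup>2 = bracket \<xi> powr (2 * a)"
    by (simp add: norm_xi_symbol power2_eq_square powr_add[symmetric])
  finally show ?thesis .
qed

section \<open>Weighted square integrability of Fourier transforms\<close>

text \<open>The functions that occur as Fourier transforms of elements of \<open>sobolev s\<close>;
  the correspondence is \<open>sobolev_iff_spectral\<close>.\<close>

definition weighted_L2 :: "real \<Rightarrow> (real^'n::finite \<Rightarrow> complex) \<Rightarrow> bool" where
  "weighted_L2 s h \<longleftrightarrow> square_integrable_on UNIV (\<lambda>\<xi>. of_real (bracket \<xi> powr s) * h \<xi>)"

lemma weighted_L2_measurable:
  assumes "weighted_L2 s h"
  shows "h \<in> borel_measurable borel"
proof -
  have [measurable]: "(\<lambda>\<xi>. of_real (bracket \<xi> powr s) * h \<xi>) \<in> borel_measurable borel"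
    using assms by (simp add: weighted_L2_def square_integrable_UNIV)
  have "(\<lambda>\<xi>. of_real (bracket \<xi> powr (- s)) * (of_real (bracket \<xi> powr s) * h \<xi>)) \<in> borel_measurable borel"
    by measurable
  then show ?thesis by (simp add: mult.assoc[symmetric] of_real_mult[symmetric] powr_add[symmetric] less_imp_neq[THEN not_sym] del: of_real_mult)
qed

lemma weighted_L2_0: "weighted_L2 0 h \<longleftrightarrow> square_integrable_on UNIV h"
  by (simp add: weighted_L2_def less_imp_neq[THEN not_sym])

lemma weighted_L2_mult:
  assumes h: "weighted_L2 s h" and [measurable]: "m \<in> borel_measurable borel"
    and m: "\<And>\<xi>. norm (m \<xi>) \<le> C * bracket \<xi> powr t"
  shows "weighted_L2 (s - t) (\<lambda>\<xi>. m \<xi> * h \<xi>)"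
proof -
  have [measurable]: "h \<in> borel_measurable borel" by (rule weighted_L2_measurable[OF h])
  show ?thesis
    unfolding weighted_L2_def
  proof (rule square_integrable_bound[OF h[unfolded weighted_L2_def]])
    fix \<xi>
    have "norm (of_real (bracket \<xi> powr (s - t)) * (m \<xi> * h \<xi>)) = bracket \<xi> powr (s - t) * norm (m \<xi>) * norm (h \<xi>)"
      by (simp add: norm_mult)
    also have "\<dots> \<le> bracket \<xi> powr (s - t) * (C * bracket \<xi> powr t) * norm (h \<xi>)"
      by (intro mult_right_mono mult_left_mono m) auto
    also have "\<dots> = C * norm (of_real (bracket \<xi> powr s) * h \<xi>)"
      by (simp add: norm_mult powr_diff)
    finally show "norm (of_real (bracket \<xi> powr (s - t)) * (m \<xi> * h \<xi>)) \<le> C * norm (of_real (bracket \<xi> powr s) * h \<xi>)" .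
  qed measurable
qed

lemma weighted_L2_xi:
  assumes "weighted_L2 s h" "\<bar>\<sigma>\<bar> = 1"
  shows "weighted_L2 (s - t) (\<lambda>\<xi>. xi_symbol \<sigma> t \<xi> * h \<xi>)"
  by (rule weighted_L2_mult[OF assms(1) symbol_measurable[OF symbols_xi], where C=1])
    (simp add: norm_xi_symbol[OF assms(2)])

lemma weighted_L2_mono:
  assumes "weighted_L2 s h" "t \<le> s"
  shows "weighted_L2 t h"
proof -
  have "weighted_L2 (s - (s - t)) (\<lambda>\<xi>. 1 * h \<xi>)"
    by (rule weighted_L2_mult[OF assms(1), where C=1])
      (use ge_one_powr_ge_zero[OF one_le_bracket, of "s - t"] assms(2) in auto)
  then show ?thesis by simp
qed

lemma weighted_L2_add:
  assumes "weighted_L2 s f" "weighted_L2 s g"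
  shows "weighted_L2 s (\<lambda>\<xi>. f \<xi> + g \<xi>)"
  using square_integrable_add[OF assms[unfolded weighted_L2_def]] by (simp add: weighted_L2_def distrib_left)

lemma weighted_L2_diff:
  assumes f: "weighted_L2 s f" and g: "weighted_L2 t g"
  shows "weighted_L2 (min s t) (\<lambda>\<xi>. f \<xi> - g \<xi>)"
proof -
  have "weighted_L2 (t - 0) (\<lambda>\<xi>. (- 1) * g \<xi>)"
    by (rule weighted_L2_mult[OF g, where C=1]) auto
  then show ?thesis
    using weighted_L2_add[OF weighted_L2_mono[OF f] weighted_L2_mono, of "min s t" t "\<lambda>\<xi>. - g \<xi>"] by simp
qed

lemma bracket_powr_inverse: "complex_of_real (bracket \<xi> powr s) * (of_real (bracket \<xi> powr (- s)) * z) = z"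
proof -
  have "bracket \<xi> powr s * bracket \<xi> powr (- s) = 1"
    using bracket_pos[of \<xi>] by (simp add: powr_add[symmetric] del: bracket_pos)
  then show ?thesis by (metis mult.assoc mult_1 of_real_1 of_real_mult)
qed

lemma weighted_L2_mult_schwartz:
  assumes h: "weighted_L2 s h" and f: "f \<in> schwartz_space"
  shows "integrable lborel (\<lambda>\<xi>. h \<xi> * f \<xi>)"
proof -
  have "integrable lborel (\<lambda>\<xi>. (of_real (bracket \<xi> powr s) * h \<xi>) * (of_real (bracket \<xi> powr (- s)) * f \<xi>))"
    using h unfolding weighted_L2_def
    by (rule square_integrable_mult) (intro schwartz_square_integrable schwartz_symbol_mult symbols_bracket f)
  moreover have "(of_real (bracket \<xi> powr s) * h \<xi>) * (of_real (bracket \<xi> powr (- s)) * f \<xi>) = h \<xi> * f \<xi>" for \<xi>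
    using bracket_powr_inverse[of \<xi> s "h \<xi> * f \<xi>"] by (simp only: mult_ac)
  ultimately show ?thesis by simp
qed

text \<open>The inverse Fourier transform of \<open>h\<close>, as a distribution.\<close>

definition spectral :: "(real^'n::finite \<Rightarrow> complex) \<Rightarrow> 'n dist" where
  "spectral h = (\<lambda>\<phi>. if \<phi> \<in> schwartz_space then LINT \<xi>|lborel. h \<xi> * fourier_inv \<phi> \<xi> else 0)"

text \<open>On test functions the transforms cancel by inversion. Membership in
  \<open>symbols\<close> keeps \<open>p\<close> times \<open>fourier_inv \<phi>\<close> a Schwartz
  function; outside the Schwartz space every distribution here takes the value 0.\<close>

lemma Op_spectral:
  assumes p: "p \<in> symbols"
  shows "Op p (spectral h) = spectral (\<lambda>\<xi>. p \<xi> * h \<xi>)"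
proof
  fix \<phi>
  show "Op p (spectral h) \<phi> = spectral (\<lambda>\<xi>. p \<xi> * h \<xi>) \<phi>"
  proof (cases "\<phi> \<in> schwartz_space")
    case True
    have 1: "fourier_inv \<phi> \<in> schwartz_space" by (rule fourier_inv_schwartz[OF True])
    have 2: "(\<lambda>\<xi>. p \<xi> * fourier_inv \<phi> \<xi>) \<in> schwartz_space" by (rule schwartz_symbol_mult[OF p 1])
    have 3: "fourier (\<lambda>\<xi>. p \<xi> * fourier_inv \<phi> \<xi>) \<in> schwartz_space" by (rule fourier_schwartz[OF 2])
    show ?thesis
      using True 1 2 3 by (simp add: Op_def dist_fourier_inv_def dist_mult_def dist_fourier_def spectral_def fourier_inversion mult_ac)
  qed (simp add: Op_def dist_fourier_inv_def spectral_def)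
qed

lemma fourier_inv_add: "f \<in> schwartz_space \<Longrightarrow> g \<in> schwartz_space \<Longrightarrow> fourier_inv (\<lambda>x. f x + g x) \<xi> = fourier_inv f \<xi> + fourier_inv g \<xi>"
  by (simp add: fourier_inv_eq fourier_add schwartz_integrable add_divide_distrib)

lemma fourier_inv_cmult: "fourier_inv (\<lambda>x. c * f x) \<xi> = c * fourier_inv f \<xi>"
  by (simp add: fourier_inv_eq fourier_cmult)

lemma tempered_spectral:
  fixes h :: "real^'n::finite \<Rightarrow> complex"
  assumes h: "weighted_L2 s h"
  shows "spectral h \<in> tempered"
proof -
  define n where "n = CARD('n)"
  \<comment> \<open>The first summand undoes the weight \<open>bracket \<xi> powr s\<close>. The
    second undoes the factor \<open>1 / bracket \<xi> ^ (2 * n)\<close> in \<open>H\<close>, which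
    is square integrable and makes \<open>H\<close> integrable.\<close>
  define m where "m = nat \<lceil>\<bar>s\<bar>\<rceil> + 2 * n"
  define N where "N = max m (2 * n)"
  obtain C where C: "\<And>(f :: real^'n \<Rightarrow> complex) \<xi>. f \<in> schwartz_space \<Longrightarrow>
    norm (fourier f \<xi>) * bracket \<xi> ^ m \<le> C * (\<Sum>k\<le>N. \<Sum>js\<in>{js. length js \<le> N}. schwartz_seminorm k js f)"
    using fourier_decay_seminorm[where 'n='n and m=m] unfolding N_def n_def by blast
  define H where "H \<xi> = norm (of_real (bracket \<xi> powr s) * h \<xi>) * (1 / bracket \<xi> ^ (2 * n))" for \<xi>
  have "square_integrable_on UNIV (\<lambda>\<xi>::real^'n. of_real (1 / bracket \<xi> ^ (2 * n)))"
  proof (rule square_integrable_decay[where C=1])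
    show "norm (of_real (1 / bracket \<xi> ^ (2 * n)) :: complex) * bracket \<xi> ^ CARD('n) \<le> 1" for \<xi> :: "real^'n"
      using power_increasing[OF _ one_le_bracket, of n "2 * n" \<xi>] unfolding norm_of_real
      by (simp add: n_def pos_divide_le_eq)
  qed measurable
  from integrable_norm[OF square_integrable_mult[OF h[unfolded weighted_L2_def] this]]
  have H: "integrable lborel H" unfolding H_def by (simp add: norm_mult norm_divide norm_power)
  have b: "norm (spectral h \<phi>) \<le> ((LINT \<xi>|lborel. H \<xi>) * C / (2 * pi) ^ n) * (\<Sum>k\<le>N. \<Sum>js\<in>{js. length js \<le> N}. schwartz_seminorm k js \<phi>)"
    if \<phi>: "\<phi> \<in> schwartz_space" for \<phi>
  proof -
    define Q where "Q = (\<Sum>k\<le>N. \<Sum>js\<in>{js. length js \<le> N}. schwartz_seminorm k js \<phi>)"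
    have p: "norm (h \<xi> * fourier_inv \<phi> \<xi>) \<le> H \<xi> * (C * Q / (2 * pi) ^ n)" for \<xi>
    proof -
      have 1: "norm (fourier_inv \<phi> \<xi>) * bracket \<xi> ^ m \<le> C * Q / (2 * pi) ^ n"
        using C[OF \<phi>, of "- \<xi>"] unfolding Q_def
        by (simp add: fourier_inv_eq norm_divide norm_power norm_mult n_def divide_right_mono)
      have "1 \<le> bracket \<xi> powr s * (1 / bracket \<xi> ^ (2 * n)) * bracket \<xi> ^ m"
      proof -
        have "bracket \<xi> powr (- s) \<le> bracket \<xi> powr real (nat \<lceil>\<bar>s\<bar>\<rceil>)"
          by (intro powr_mono one_le_bracket) linarith
        then have "1 \<le> bracket \<xi> powr s * bracket \<xi> ^ nat \<lceil>\<bar>s\<bar>\<rceil>"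
          unfolding powr_realpow[OF bracket_pos] by (simp add: powr_minus field_simps)
        then show ?thesis by (simp add: m_def power_add)
      qed
      then have "norm (h \<xi> * fourier_inv \<phi> \<xi>) * 1 \<le> norm (h \<xi> * fourier_inv \<phi> \<xi>) * (bracket \<xi> powr s * (1 / bracket \<xi> ^ (2 * n)) * bracket \<xi> ^ m)"
        by (intro mult_left_mono) auto
      also have "\<dots> = H \<xi> * (norm (fourier_inv \<phi> \<xi>) * bracket \<xi> ^ m)"
        by (simp add: H_def norm_mult)
      also have "\<dots> \<le> H \<xi> * (C * Q / (2 * pi) ^ n)"
        by (intro mult_left_mono 1) (auto simp: H_def)
      finally show ?thesis by simp
    qed
    have "norm (LINT \<xi>|lborel. h \<xi> * fourier_inv \<phi> \<xi>) \<le> (LINT \<xi>|lborel. norm (h \<xi> * fourier_inv \<phi> \<xi>))"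
      by (rule integral_norm_bound)
    also have "\<dots> \<le> (LINT \<xi>|lborel. H \<xi> * (C * Q / (2 * pi) ^ n))"
      by (intro integral_mono p integrable_norm weighted_L2_mult_schwartz[OF h] fourier_inv_schwartz \<phi> integrable_mult_left) (rule H)
    also have "\<dots> = ((LINT \<xi>|lborel. H \<xi>) * C / (2 * pi) ^ n) * Q" by simp
    finally show ?thesis using \<phi> by (simp add: spectral_def Q_def)
  qed
  have i: "integrable lborel (\<lambda>\<xi>. h \<xi> * fourier_inv \<phi> \<xi>)" if "\<phi> \<in> schwartz_space" for \<phi>
    by (intro weighted_L2_mult_schwartz[OF h] fourier_inv_schwartz that)
  have add: "spectral h (\<lambda>x. \<phi> x + \<psi> x) = spectral h \<phi> + spectral h \<psi>" if "\<phi> \<in> schwartz_space" "\<psi> \<in> schwartz_space" for \<phi> \<psi>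
    using that by (simp add: spectral_def schwartz_add fourier_inv_add distrib_left i)
  have cmult: "spectral h (\<lambda>x. c * \<phi> x) = c * spectral h \<phi>" if "\<phi> \<in> schwartz_space" for c \<phi>
    using that by (simp add: spectral_def schwartz_cmult fourier_inv_cmult mult.left_commute)
  show ?thesis
    unfolding tempered_def
  proof (intro CollectI conjI allI ballI impI)
    show "spectral h \<phi> = 0" if "\<phi> \<notin> schwartz_space" for \<phi>
      using that by (simp add: spectral_def)
    show "\<exists>C N. \<forall>\<phi>\<in>schwartz_space. norm (spectral h \<phi>) \<le> C * (\<Sum>k\<le>N. \<Sum>js\<in>{js. length js \<le> N}. schwartz_seminorm k js \<phi>)"
      using b by blast
  qed (simp_all add: add cmult)
qed

text \<open>Dividing the square integrable weighted transform by the weight gives \<open>h\<close>.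
  The equivalence turns every statement about Sobolev distributions into one about functions of the
  frequency.\<close>

lemma sobolev_iff_spectral:
  fixes u :: "'n::finite dist"
  shows "u \<in> sobolev s \<longleftrightarrow> (\<exists>h. weighted_L2 s h \<and> u = spectral h)"
proof
  assume u: "u \<in> sobolev s"
  then obtain g where g: "square_integrable_on UNIV g"
    and ug: "dist_mult (\<lambda>\<xi>. of_real (bracket \<xi> powr s)) (dist_fourier u) = regular_dist schwartz_space UNIV g"
    by (auto simp: sobolev_def L2_Rn_def)
  define h where "h \<xi> = of_real (bracket \<xi> powr (- s)) * g \<xi>" for \<xi>
  have "weighted_L2 s h" using g by (simp only: weighted_L2_def h_def bracket_powr_inverse)
  moreover have "u = spectral h"
  proof
    fix \<phi>
    show "u \<phi> = spectral h \<phi>"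
    proof (cases "\<phi> \<in> schwartz_space")
      case True
      \<comment> \<open>Chosen so that the weight and the transform both cancel when the equation
        for \<open>g\<close> is tested against \<open>\<psi>\<close>, leaving
        \<open>u \<phi>\<close>.\<close>
      define \<psi> where "\<psi> \<xi> = of_real (bracket \<xi> powr (- s)) * fourier_inv \<phi> \<xi>" for \<xi>
      have \<psi>: "\<psi> \<in> schwartz_space" unfolding \<psi>_def[abs_def]
        by (intro schwartz_symbol_mult symbols_bracket fourier_inv_schwartz True)
      have w: "(\<lambda>\<xi>. of_real (bracket \<xi> powr s) * \<psi> \<xi>) = fourier_inv \<phi>"
        by (simp only: \<psi>_def bracket_powr_inverse)
      have "dist_mult (\<lambda>\<xi>. of_real (bracket \<xi> powr s)) (dist_fourier u) \<psi> = u \<phi>"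
        using \<psi> True by (simp add: dist_mult_def dist_fourier_def w fourier_inv_schwartz fourier_inv_inversion)
      moreover have "regular_dist schwartz_space UNIV g \<psi> = spectral h \<phi>"
        using \<psi> True by (simp add: regular_dist_def spectral_def set_lebesgue_integral_def \<psi>_def h_def mult_ac)
      ultimately show ?thesis using ug by simp
    next
      case False
      then show ?thesis using u by (auto simp: sobolev_def tempered_def spectral_def)
    qed
  qed
  ultimately show "\<exists>h. weighted_L2 s h \<and> u = spectral h" by blast
next
  assume "\<exists>h. weighted_L2 s h \<and> u = spectral h"
  then obtain h where h: "weighted_L2 s h" and u: "u = spectral h" by blast
  have "dist_mult (\<lambda>\<xi>. of_real (bracket \<xi> powr s)) (dist_fourier u)
     = regular_dist schwartz_space UNIV (\<lambda>\<xi>. of_real (bracket \<xi> powr s) * h \<xi>)"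
  proof
    fix \<phi> :: "real^'n \<Rightarrow> complex"
    show "dist_mult (\<lambda>\<xi>. of_real (bracket \<xi> powr s)) (dist_fourier u) \<phi>
     = regular_dist schwartz_space UNIV (\<lambda>\<xi>. of_real (bracket \<xi> powr s) * h \<xi>) \<phi>"
    proof (cases "\<phi> \<in> schwartz_space")
      case True
      then have 1: "(\<lambda>\<xi>. of_real (bracket \<xi> powr s) * \<phi> \<xi>) \<in> schwartz_space"
        by (intro schwartz_symbol_mult symbols_bracket)
      with True show ?thesis
        by (simp add: u dist_mult_def dist_fourier_def regular_dist_def spectral_def fourier_schwartz fourier_inversion set_lebesgue_integral_def mult_ac)
    qed (simp add: dist_mult_def regular_dist_def)
  qed
  then show "u \<in> sobolev s"
    using tempered_spectral[OF h] h unfolding u sobolev_def L2_Rn_def weighted_L2_def by blast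
qed

lemma regular_dist_spectral:
  fixes g :: "real^'n::finite \<Rightarrow> complex"
  assumes g: "square_integrable_on UNIV g"
  obtains h where "square_integrable_on UNIV h" "regular_dist schwartz_space UNIV g = spectral h"
proof -
  from plancherel_exists[OF g] obtain h where h: "square_integrable_on UNIV h"
    and gh: "\<And>f. f \<in> schwartz_space \<Longrightarrow> (LINT x|lborel. g x * fourier f x) = (LINT x|lborel. h x * f x)" by blast
  have "regular_dist schwartz_space UNIV g = spectral h"
  proof
    fix \<phi> :: "real^'n \<Rightarrow> complex"
    show "regular_dist schwartz_space UNIV g \<phi> = spectral h \<phi>"
      using gh[OF fourier_inv_schwartz, of \<phi>]
      by (auto simp: regular_dist_def spectral_def set_lebesgue_integral_def fourier_inv_inversion)
  qed
  with h show ?thesis using that by blast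
qed

lemma square_integrable_reflect:
  "square_integrable_on UNIV g \<Longrightarrow> square_integrable_on UNIV (\<lambda>x. g (- x))"
  using integral_affine(1)[where c="-1" and t=0 and f="\<lambda>x. (norm (g x))\<^sup>2"]
  by (auto simp: square_integrable_UNIV)

text \<open>The inverse transform is a multiple of the transform of the reflection, so
  \<open>plancherel_exists\<close> applied to the reflected \<open>h\<close> serves this direction
  as well.\<close>

lemma spectral_regular_dist:
  fixes h :: "real^'n::finite \<Rightarrow> complex"
  assumes h: "square_integrable_on UNIV h"
  obtains g where "square_integrable_on UNIV g" "spectral h = regular_dist schwartz_space UNIV g"
proof -
  define c :: complex where "c = 1 / (2 * of_real pi) ^ CARD('n)"
  have "square_integrable_on UNIV (\<lambda>\<xi>. c * h (- \<xi>))"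
    by (intro square_integrable_cmult square_integrable_reflect h)
  from plancherel_exists[OF this] obtain g where g: "square_integrable_on UNIV g"
    and hg: "\<And>f. f \<in> schwartz_space \<Longrightarrow> (LINT x|lborel. c * h (- x) * fourier f x) = (LINT x|lborel. g x * f x)" by blast
  have "spectral h = regular_dist schwartz_space UNIV g"
  proof
    fix \<phi> :: "real^'n \<Rightarrow> complex"
    have "(LINT \<xi>|lborel. h \<xi> * fourier_inv \<phi> \<xi>) = (LINT \<xi>|lborel. c * h (- \<xi>) * fourier \<phi> \<xi>)"
      by (subst integral_affine(2)[where c="-1" and t=0]) (simp_all add: fourier_inv_eq c_def)
    then show "spectral h \<phi> = regular_dist schwartz_space UNIV g \<phi>"
      using hg[of \<phi>] by (simp add: regular_dist_def spectral_def set_lebesgue_integral_def)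
  qed
  with g show ?thesis using that by blast
qed

subsection \<open>Smooth bump functions\<close>

text \<open>The polynomial makes the family closed under differentiation: the derivative replaces
  \<open>p\<close> by \<open>[:0, 0, 1:] * (p - pderiv p)\<close>. The bump itself is
  \<open>flat 1\<close>.\<close>

definition flat :: "real poly \<Rightarrow> real \<Rightarrow> real" where
  "flat p t = (if 0 < t then poly p (1 / t) * exp (- (1 / t)) else 0)"

lemma poly_times_exp_tendsto_0: "((\<lambda>x. poly p x * exp (- x)) \<longlongrightarrow> 0) at_top" for p :: "real poly"
proof -
  have "((\<lambda>x. \<Sum>i\<le>degree p. coeff p i * (x ^ i / exp x)) \<longlongrightarrow> (\<Sum>i\<le>degree p. coeff p i * 0)) at_top"
    by (intro tendsto_intros tendsto_power_div_exp_0)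
  then show ?thesis
    by (simp add: poly_altdef exp_minus divide_inverse sum_distrib_right mult.assoc)
qed

lemma flat_derivative: "(flat p has_real_derivative flat ([:0, 0, 1:] * (p - pderiv p)) t) (at t)"
proof (cases "t = 0")
  case False
  show ?thesis
  proof (cases "0 < t")
    case True
    have "((\<lambda>t. poly p (1 / t) * exp (- (1 / t))) has_real_derivative flat ([:0, 0, 1:] * (p - pderiv p)) t) (at t)"
      using True
      by (auto intro!: derivative_eq_intros DERIV_chain2[OF poly_DERIV] simp: flat_def field_simps power2_eq_square)
    then show ?thesis
      by (rule has_field_derivative_transform_within_open[of _ _ _ "{0<..}"]) (use True in \<open>auto simp: flat_def\<close>)
  next
    case F: False
    with False have "t < 0" by simp
    have "((\<lambda>t. 0) has_real_derivative flat ([:0, 0, 1:] * (p - pderiv p)) t) (at t)"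
      using F by (simp add: flat_def)
    then show ?thesis
      by (rule has_field_derivative_transform_within_open[of _ _ _ "{..<0}"]) (use \<open>t < 0\<close> in \<open>auto simp: flat_def\<close>)
  qed
next
  case True
  have "((\<lambda>h. (flat p h - flat p 0) / h) \<longlongrightarrow> 0) (at 0)"
  proof (rule filterlim_split_at)
    have "eventually (\<lambda>h. (flat p h - flat p 0) / h = 0) (at_left 0)"
      by (auto simp: flat_def eventually_at_filter)
    then show "((\<lambda>h. (flat p h - flat p 0) / h) \<longlongrightarrow> 0) (at_left 0)"
      by (rule tendsto_eventually)
    \<comment> \<open>Dividing by \<open>h\<close> multiplies the polynomial in \<open>1 / h\<close>
      by its variable, which is what \<open>pCons 0\<close> does.\<close>
    have "((\<lambda>h. poly (pCons 0 p) (inverse h) * exp (- inverse h)) \<longlongrightarrow> 0) (at_right 0)"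
      by (rule filterlim_compose[OF poly_times_exp_tendsto_0 filterlim_inverse_at_top_right])
    then show "((\<lambda>h. (flat p h - flat p 0) / h) \<longlongrightarrow> 0) (at_right 0)"
      by (rule Lim_transform_eventually)
        (auto simp: flat_def eventually_at_filter inverse_eq_divide intro!: always_eventually)
  qed
  then show ?thesis
    using True by (simp add: DERIV_def flat_def)
qed

inductive_set smooth_products :: "(real ^ 'n::finite \<Rightarrow> complex) set" where
  prod: "smooth f \<Longrightarrow> smooth g \<Longrightarrow> (\<lambda>x. f x * g x) \<in> smooth_products"
| sum: "f \<in> smooth_products \<Longrightarrow> g \<in> smooth_products \<Longrightarrow> (\<lambda>x. f x + g x) \<in> smooth_products"

lemma smooth_products_differentiable: "f \<in> smooth_products \<Longrightarrow> f differentiable (at x)"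
  by (induction rule: smooth_products.induct) (simp_all add: smooth_differentiable)

lemma smooth_mult:
  assumes "smooth f" "smooth g"
  shows "smooth (\<lambda>x. f x * g x)"
proof (rule smooth_coinduct[OF smooth_products.prod[OF assms]])
  fix h :: "real^'a \<Rightarrow> complex" and i assume "h \<in> smooth_products"
  then show "partial i h \<in> smooth_products"
  proof (induction rule: smooth_products.induct)
    case (prod f g)
    have "partial i (\<lambda>x. f x * g x) = (\<lambda>x. partial i f x * g x + f x * partial i g x)"
      by (rule partial_mult) (simp_all add: smooth_differentiable prod)
    then show ?case
      using smooth_products.sum[OF smooth_products.prod[OF smooth_partial[OF prod(1)] prod(2)]
          smooth_products.prod[OF prod(1) smooth_partial[OF prod(2)]]] by simp
  next
    case (sum f g)
    have "partial i (\<lambda>x. f x + g x) = (\<lambda>x. partial i f x + partial i g x)"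
      by (rule partial_add) (simp_all add: smooth_products_differentiable sum)
    then show ?case using smooth_products.sum[OF sum.IH] by simp
  qed
qed (rule smooth_products_differentiable)

lemma smooth_const: "smooth (\<lambda>x. c)"
proof (rule smooth_coinduct[of _ "range (\<lambda>c x. c)"])
  fix g :: "real^'a \<Rightarrow> complex" and i assume "g \<in> range (\<lambda>c x. c)"
  then obtain c where "g = (\<lambda>x. c)" by blast
  then show "partial i g \<in> range (\<lambda>c x. c)" by simp
qed auto

lemma smooth_prod: "finite A \<Longrightarrow> (\<And>i. i \<in> A \<Longrightarrow> smooth (f i)) \<Longrightarrow> smooth (\<lambda>x. \<Prod>i\<in>A. f i x)"
  by (induction A rule: finite_induct) (auto intro: smooth_const smooth_mult)

lemma smooth_flat: "smooth (\<lambda>x::real^'n::finite. complex_of_real (flat p (c * x $ i + d)))"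
proof (rule smooth_coinduct[of _ "{(\<lambda>x. complex_of_real (k * flat p (c * x $ i + d))) | k p. True}"])
  show "(\<lambda>x::real^'n. complex_of_real (flat p (c * x $ i + d))) \<in> {(\<lambda>x. complex_of_real (k * flat p (c * x $ i + d))) | k p. True}"
    by (intro CollectI exI[of _ 1] exI[of _ p]) simp
next
  have D: "((\<lambda>x::real^'n. complex_of_real (k * flat p (c * x $ i + d))) has_derivative
     (\<lambda>h. complex_of_real (k * (flat ([:0, 0, 1:] * (p - pderiv p)) (c * x $ i + d) * (c * h $ i))))) (at x)" for k p x
  proof -
    have 1: "((\<lambda>x::real^'n. c * x $ i + d) has_derivative (\<lambda>h. c * h $ i)) (at x)"
      by (auto intro!: derivative_eq_intros bounded_linear_imp_has_derivative bounded_linear_vec_nth)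
    show ?thesis
      by (intro has_derivative_of_real has_derivative_mult_right
          has_derivative_compose[OF 1 flat_derivative[unfolded has_field_derivative_def]])
  qed
  fix g :: "real^'n \<Rightarrow> complex"
  assume "g \<in> {(\<lambda>x. complex_of_real (k * flat p (c * x $ i + d))) | k p. True}"
  then obtain k p where g: "g = (\<lambda>x. complex_of_real (k * flat p (c * x $ i + d)))" by blast
  show "g differentiable (at x)" for x unfolding g using D differentiable_def by blast
  fix j
  have "partial j g = (\<lambda>x. complex_of_real ((k * c * axis j 1 $ i) * flat ([:0, 0, 1:] * (p - pderiv p)) (c * x $ i + d)))"
    unfolding g by (rule ext, rule partial_eqI[OF D, THEN trans]) (simp add: mult_ac)
  then show "partial j g \<in> {(\<lambda>x. complex_of_real (k * flat p (c * x $ i + d))) | k p. True}" by blast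
qed

text \<open>For \<open>0 < k\<close> the bump is positive exactly on \<open>box a b\<close>, and as
  \<open>k\<close> grows it tends to the indicator of the box. The arguments are spelled out in the
  affine form that \<open>smooth_flat\<close> expects.\<close>

definition box_bump :: "real \<Rightarrow> real^'n::finite \<Rightarrow> real^'n \<Rightarrow> real^'n \<Rightarrow> real" where
  "box_bump k a b x = (\<Prod>i\<in>UNIV. flat 1 (k * x $ i + - (k * a $ i)) * flat 1 (- k * x $ i + k * b $ i))"

lemma flat_1: "0 \<le> flat 1 t" "flat 1 t \<le> 1" "flat 1 t = 0 \<longleftrightarrow> t \<le> 0"
  by (auto simp: flat_def)

lemma box_bump_bounds: "0 \<le> box_bump k a b x" "box_bump k a b x \<le> 1"
  unfolding box_bump_def by (auto intro!: prod_nonneg prod_le_1 mult_nonneg_nonneg mult_le_one simp: flat_1)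

lemma box_bump_eq_0_iff: "0 < k \<Longrightarrow> box_bump k a b x = 0 \<longleftrightarrow> x \<notin> box a b"
proof -
  assume k: "0 < k"
  have "k * x $ i + - (k * a $ i) \<le> 0 \<longleftrightarrow> x $ i \<le> a $ i" "- k * x $ i + k * b $ i \<le> 0 \<longleftrightarrow> b $ i \<le> x $ i" for i
    using k by (auto simp: mult_le_cancel_left)
  then show ?thesis
    unfolding box_bump_def by (auto simp: flat_1 mem_box_cart not_less)
qed

lemma smooth_box_bump: "smooth (\<lambda>x. complex_of_real (box_bump k a b x))"
  unfolding box_bump_def of_real_prod of_real_mult by (intro smooth_prod smooth_mult smooth_flat) simp

lemma measurable_box_bump [measurable]: "box_bump k a b \<in> borel_measurable borel"
proof -
  have "(\<lambda>x. complex_of_real (box_bump k a b x)) \<in> borel_measurable borel"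
    by (intro borel_measurable_continuous_onI continuous_at_imp_continuous_on)
      (simp add: smooth_differentiable[OF smooth_box_bump] differentiable_imp_continuous_within)
  from measurable_compose[OF this borel_measurable_Re] show ?thesis by simp
qed

lemma box_bump_test:
  assumes "cbox a b \<subseteq> U" "0 < k"
  shows "(\<lambda>x. complex_of_real (box_bump k a b x)) \<in> test_functions U"
proof -
  have "closure {x. complex_of_real (box_bump k a b x) \<noteq> 0} = closure (box a b)"
    using assms(2) by (simp add: box_bump_eq_0_iff)
  also have "\<dots> \<subseteq> cbox a b" by (intro closure_minimal box_subset_cbox closed_cbox)
  finally have c: "closure {x. complex_of_real (box_bump k a b x) \<noteq> 0} \<subseteq> cbox a b" .
  moreover have "compact (closure {x. complex_of_real (box_bump k a b x) \<noteq> 0})"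
    using compact_Int_closed[OF compact_cbox[of a b] closed_closure, of "{x. complex_of_real (box_bump k a b x) \<noteq> 0}"] c
    by (simp add: inf.absorb2)
  ultimately show ?thesis using assms by (auto simp: test_functions_def smooth_box_bump)
qed

lemma box_bump_tendsto: "(\<lambda>k. box_bump (real (Suc k)) a b x) \<longlonglongrightarrow> indicator (box a b) x"
proof (cases "x \<in> box a b")
  case True
  have "(\<lambda>k. flat 1 (real (Suc k) * t)) \<longlonglongrightarrow> 1" if "0 < t" for t
  proof -
    have "(\<lambda>k. exp (- (inverse (real (Suc k)) * (1 / t)))) \<longlonglongrightarrow> exp (- (0 * (1 / t)))"
      by (intro tendsto_intros LIMSEQ_inverse_real_of_nat)
    then show ?thesis using that by (simp add: flat_def inverse_eq_divide)
  qed
  from tendsto_mult[OF this this, of "x $ i - a $ i" "b $ i - x $ i" for i]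
  have "(\<lambda>k. flat 1 (real (Suc k) * (x $ i - a $ i)) * flat 1 (real (Suc k) * (b $ i - x $ i))) \<longlonglongrightarrow> 1" for i
    using True by (simp add: mem_box_cart)
  then have "(\<lambda>k. \<Prod>i\<in>UNIV. flat 1 (real (Suc k) * (x $ i - a $ i)) * flat 1 (real (Suc k) * (b $ i - x $ i))) \<longlonglongrightarrow> (\<Prod>i\<in>(UNIV::'a set). 1)"
    by (intro tendsto_prod)
  then show ?thesis using True by (simp add: box_bump_def algebra_simps)
qed (simp add: box_bump_eq_0_iff[THEN iffD2])

lemma test_functions_mono: "U \<subseteq> V \<Longrightarrow> test_functions U \<subseteq> test_functions V"
  by (auto simp: test_functions_def)

lemma test_functions_mult:
  assumes f: "f \<in> test_functions U" and g: "smooth g"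
  shows "(\<lambda>x. f x * g x) \<in> test_functions U"
proof -
  have s: "closure {x. f x * g x \<noteq> 0} \<subseteq> closure {x. f x \<noteq> 0}" by (intro closure_mono) auto
  have "compact (closure {x. f x * g x \<noteq> 0})"
    using compact_Int_closed[of "closure {x. f x \<noteq> 0}" "closure {x. f x * g x \<noteq> 0}"] f s
    by (simp add: test_functions_def inf.absorb2)
  with f g s show ?thesis by (auto simp: test_functions_def smooth_mult)
qed

subsection \<open>The fundamental lemma of the calculus of variations\<close>

text \<open>Boxes form an intersection-stable generator of the Borel sets, so all Borel sets have
  integral 0; complements use that the total integral is 0, obtained by exhaustion with boxes. The
  sets where \<open>f\<close> is nonnegative and nonpositive then force \<open>f\<close> to vanish
  almost everywhere.\<close>

lemma AE_zero_if_box_integrals_zero: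
  fixes f :: "real^'n::finite \<Rightarrow> real"
  assumes f: "integrable lborel f"
    and z: "\<And>a b. (LINT x:box a b|lborel. f x) = 0"
  shows "AE x in lborel. f x = 0"
proof -
  have fm[measurable]: "f \<in> borel_measurable borel" using f by auto
  have si: "set_integrable lborel A f" if "A \<in> sets borel" for A
    using f that unfolding set_integrable_def by (intro integrable_mult_indicator) auto
  have univ: "(LINT x|lborel. f x) = 0"
  proof -
    have "(\<lambda>k. LINT x:box (\<chi> i. - real k) (\<chi> i. real k)|lborel. f x) \<longlonglongrightarrow> (LINT x|lborel. f x)"
      unfolding set_lebesgue_integral_def
    proof (rule integral_dominated_convergence)
      show "integrable lborel (\<lambda>x. norm (f x))" using f by simp
      show "AE x in lborel. (\<lambda>k. indicator (box (\<chi> i. - real k) (\<chi> i. real k)) x *\<^sub>R f x) \<longlonglongrightarrow> f x"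
      proof (rule AE_I2, rule tendsto_eventually)
        fix x :: "real^'n"
        show "eventually (\<lambda>k. indicator (box (\<chi> i. - real k) (\<chi> i. real k)) x *\<^sub>R f x = f x) sequentially"
          using eventually_gt_at_top[of "nat \<lceil>norm x\<rceil>"]
        proof eventually_elim
          case (elim k)
          have "\<bar>x $ i\<bar> < real k" for i
            using elim component_le_norm_cart[of x i] by linarith
          then show ?case by (simp add: mem_box_cart abs_less_iff minus_less_iff)
        qed
      qed
    qed (auto simp: indicator_def)
    then show ?thesis by (simp add: z LIMSEQ_const_iff)
  qed
  have "(LINT x:A|lborel. f x) = 0" if "A \<in> sets borel" for A
  proof -
    have S: "Int_stable (range (\<lambda>(a, b). box a b :: (real^'n) set))"
      by (auto simp: Int_stable_def box_Int_box)
    have A: "A \<in> sigma_sets UNIV (range (\<lambda>(a, b). box a b))"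
      using that by (simp add: borel_eq_box)
    show ?thesis
    proof (rule sigma_sets_induct_disjoint[OF S _ A])
      fix A assume "A \<in> sigma_sets UNIV (range (\<lambda>(a, b). box a b :: (real^'n) set))"
        and IH: "(LINT x:A|lborel. f x) = 0"
      then have [measurable]: "A \<in> sets borel" by (simp add: borel_eq_box)
      have "(LINT x:A \<union> (UNIV - A)|lborel. f x) = (LINT x:A|lborel. f x) + (LINT x:UNIV - A|lborel. f x)"
        by (intro set_integral_Un si) auto
      then show "(LINT x:UNIV - A|lborel. f x) = 0"
        using IH univ by (simp add: Un_UNIV_right set_lebesgue_integral_def)
    next
      fix A :: "nat \<Rightarrow> (real^'n) set"
      assume d: "disjoint_family A" and r: "range A \<subseteq> sigma_sets UNIV (range (\<lambda>(a, b). box a b))"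
        and IH: "\<And>i. (LINT x:A i|lborel. f x) = 0"
      have [measurable]: "A i \<in> sets borel" for i
        using r by (auto simp: borel_eq_box)
      have "(LINT x:(\<Union>i. A i)|lborel. f x) = (\<Sum>i. LINT x:A i|lborel. f x)"
        by (rule lebesgue_integral_countable_add) (use d si in \<open>auto simp: disjoint_family_on_def\<close>)
      then show "(LINT x:(\<Union>i. A i)|lborel. f x) = 0" by (simp add: IH)
    qed (use z in \<open>auto simp: set_lebesgue_integral_def\<close>)
  qed
  note zA = this
  have "AE x in lborel. indicator {x. 0 \<le> f x} x * f x = 0"
  proof (subst integral_nonneg_eq_0_iff_AE[symmetric])
    show "(LINT x|lborel. indicator {x. 0 \<le> f x} x * f x) = 0"
      using zA[of "{x. 0 \<le> f x}"] by (simp add: set_lebesgue_integral_def)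
  qed (use si[of "{x. 0 \<le> f x}"] in \<open>auto simp: set_integrable_def indicator_def\<close>)
  moreover have "AE x in lborel. - (indicator {x. f x \<le> 0} x * f x) = 0"
  proof (subst integral_nonneg_eq_0_iff_AE[symmetric])
    show "(LINT x|lborel. - (indicator {x. f x \<le> 0} x * f x)) = 0"
      using zA[of "{x. f x \<le> 0}"] by (simp add: set_lebesgue_integral_def)
  qed (use si[of "{x. f x \<le> 0}"] in \<open>auto simp: set_integrable_def indicator_def\<close>)
  ultimately show ?thesis
    by eventually_elim (auto simp: indicator_def split: if_splits)
qed

text \<open>Multiplying \<open>g\<close> by a fixed bump in \<open>U\<close> gives a globally
  integrable function whose products with all further bumps are still integrals against test
  functions on \<open>U\<close>. Those bumps converge to indicators of arbitrary boxes, so the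
  preceding lemma applies without further regard to \<open>U\<close>.\<close>

lemma fundamental_lemma:
  fixes g :: "real^'n::finite \<Rightarrow> complex"
  assumes g: "square_integrable_on UNIV g" and U: "open U"
    and z: "\<And>f. f \<in> test_functions U \<Longrightarrow> (LINT x|lborel. g x * f x) = 0"
  shows "AE x in lborel. x \<in> U \<longrightarrow> g x = 0"
proof -
  have gm[measurable]: "g \<in> borel_measurable borel" using g by (simp add: square_integrable_UNIV)
  have box: "AE x in lborel. x \<in> box a b \<longrightarrow> g x = 0" if ab: "cbox a b \<subseteq> U" for a b
  proof -
    define F where "F x = g x * of_real (box_bump 1 a b x)" for x
    have t: "(\<lambda>x. complex_of_real (box_bump 1 a b x)) \<in> test_functions U"
      by (rule box_bump_test[OF ab]) simp
    have Fi: "integrable lborel F"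
      unfolding F_def using t test_functions_schwartz
      by (intro square_integrable_mult g schwartz_square_integrable) blast
    then have [measurable]: "F \<in> borel_measurable borel" by auto
    have F0: "(LINT x:box c d|lborel. F x) = 0" for c d
    proof -
      have "(\<lambda>k. LINT x|lborel. box_bump (real (Suc k)) c d x *\<^sub>R F x) \<longlonglongrightarrow> (LINT x|lborel. indicator (box c d) x *\<^sub>R F x)"
      proof (rule integral_dominated_convergence)
        show "integrable lborel (\<lambda>x. norm (F x))" using Fi by simp
        show "(\<lambda>x. box_bump (real (Suc k)) c d x *\<^sub>R F x) \<in> borel_measurable lborel" for k by measurable
        show "AE x in lborel. norm (box_bump (real (Suc k)) c d x *\<^sub>R F x) \<le> norm (F x)" for k
          using box_bump_bounds[of "real (Suc k)" c d] by (auto intro!: AE_I2 mult_left_le_one_le simp: abs_of_nonneg)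
        show "AE x in lborel. (\<lambda>k. box_bump (real (Suc k)) c d x *\<^sub>R F x) \<longlonglongrightarrow> indicator (box c d) x *\<^sub>R F x"
          by (intro AE_I2 tendsto_scaleR box_bump_tendsto tendsto_const)
      qed simp
      moreover have "(LINT x|lborel. box_bump (real (Suc k)) c d x *\<^sub>R F x) = 0" for k
        using z[OF test_functions_mult[OF t smooth_box_bump, of "real (Suc k)" c d]]
        by (simp add: F_def scaleR_conv_of_real mult_ac)
      ultimately show ?thesis by (simp add: set_lebesgue_integral_def LIMSEQ_const_iff)
    qed
    have iA: "integrable lborel (\<lambda>x. indicator (box c d) x *\<^sub>R F x)" for c d
      using Fi by (intro integrable_mult_indicator) auto
    have "AE x in lborel. Re (F x) = 0"
    proof (rule AE_zero_if_box_integrals_zero)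
      show "(LINT x:box c d|lborel. Re (F x)) = 0" for c d
        using F0[of c d] Bochner_Integration.integral_Re[OF iA, of c d] by (simp add: set_lebesgue_integral_def)
    qed (use Fi in simp)
    moreover have "AE x in lborel. Im (F x) = 0"
    proof (rule AE_zero_if_box_integrals_zero)
      show "(LINT x:box c d|lborel. Im (F x)) = 0" for c d
        using F0[of c d] Bochner_Integration.integral_Im[OF iA, of c d] by (simp add: set_lebesgue_integral_def)
    qed (use Fi in simp)
    ultimately show ?thesis
    proof eventually_elim
      case (elim x)
      then have "F x = 0" by (simp add: complex_eq_iff)
      then show ?case using box_bump_eq_0_iff[of 1 a b x] by (auto simp: F_def)
    qed
  qed
  define \<B> where "\<B> = {box a b | a b :: real^'n. cbox a b \<subseteq> U}"
  \<comment> \<open>A countable subcover is needed so that the exceptional null sets can be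
    united.\<close>
  obtain \<B>' where B': "\<B>' \<subseteq> \<B>" "countable \<B>'" "\<Union>\<B>' = \<Union>\<B>"
    using Lindelof[of \<B>] by (auto simp: \<B>_def)
  have "AE x in lborel. \<forall>B\<in>\<B>'. x \<in> B \<longrightarrow> g x = 0"
  proof (rule AE_ball_countable[OF B'(2), THEN iffD2, rule_format])
    fix B assume "B \<in> \<B>'"
    with B'(1) obtain a b where B: "B = box a b" "cbox a b \<subseteq> U" unfolding \<B>_def by blast
    show "AE x in lborel. x \<in> B \<longrightarrow> g x = 0" unfolding B(1) by (rule box[OF B(2)])
  qed
  have "x \<in> \<Union>\<B>" if x: "x \<in> U" for x
  proof -
    obtain e where e: "0 < e" "cball x e \<subseteq> U"
      using open_contains_cball[THEN iffD1, OF U] x by blast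
    obtain a b where ab: "x \<in> box a b" "box a b \<subseteq> ball x e"
      using rational_boxes[OF e(1), of x] by blast
    have "cbox a b = closure (box a b)" using ab(1) by (subst closure_box) auto
    also have "\<dots> \<subseteq> cball x e"
      by (rule closure_minimal[OF order_trans[OF ab(2) ball_subset_cball] closed_cball])
    finally have "box a b \<in> \<B>" using e(2) unfolding \<B>_def by blast
    with ab(1) show ?thesis by blast
  qed
  note cover = this
  show ?thesis
    using \<open>AE x in lborel. \<forall>B\<in>\<B>'. x \<in> B \<longrightarrow> g x = 0\<close>
  proof eventually_elim
    case (elim x)
    show ?case
    proof
      assume "x \<in> U"
      then have "x \<in> \<Union>\<B>'" unfolding B'(3) by (rule cover)
      then obtain B where "B \<in> \<B>'" "x \<in> B" by (rule UnionE)
      with elim show "g x = 0" by blast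
    qed
  qed
qed

subsection \<open>Distributions vanishing near every point of an open set\<close>

lemma integral_exp_rescaled_bump:
  fixes \<rho> :: "real^'n::finite \<Rightarrow> complex"
  assumes "0 < \<epsilon>"
  shows "fourier_inv (\<lambda>y. \<rho> ((- x) /\<^sub>R \<epsilon> + (1 / \<epsilon>) *\<^sub>R y)) \<xi> = of_real (\<epsilon> ^ CARD('n)) * iexp (\<xi> \<bullet> x) * fourier_inv \<rho> (\<epsilon> *\<^sub>R \<xi>)"
proof -
  have "(LINT y|lborel. iexp (\<xi> \<bullet> y) * \<rho> ((- x) /\<^sub>R \<epsilon> + (1 / \<epsilon>) *\<^sub>R y))
     = \<epsilon> ^ CARD('n) *\<^sub>R (LINT w|lborel. iexp (\<xi> \<bullet> (x + \<epsilon> *\<^sub>R w)) * \<rho> ((- x) /\<^sub>R \<epsilon> + (1 / \<epsilon>) *\<^sub>R (x + \<epsilon> *\<^sub>R w)))"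
    using assms by (subst integral_affine(2)[of \<epsilon> _ x]) simp_all
  also have "(LINT w|lborel. iexp (\<xi> \<bullet> (x + \<epsilon> *\<^sub>R w)) * \<rho> ((- x) /\<^sub>R \<epsilon> + (1 / \<epsilon>) *\<^sub>R (x + \<epsilon> *\<^sub>R w)))
     = (LINT w|lborel. iexp (\<xi> \<bullet> x) * (iexp ((\<epsilon> *\<^sub>R \<xi>) \<bullet> w) * \<rho> w))"
  proof (rule Bochner_Integration.integral_cong[OF refl])
    fix w
    have "(- x) /\<^sub>R \<epsilon> + (1 / \<epsilon>) *\<^sub>R (x + \<epsilon> *\<^sub>R w) = w"
      using assms by (simp add: scaleR_add_right inverse_eq_divide)
    moreover have "iexp (\<xi> \<bullet> (x + \<epsilon> *\<^sub>R w)) = iexp (\<xi> \<bullet> x) * iexp ((\<epsilon> *\<^sub>R \<xi>) \<bullet> w)"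
      by (simp add: exp_add[symmetric] inner_add_right distrib_left)
    ultimately show "iexp (\<xi> \<bullet> (x + \<epsilon> *\<^sub>R w)) * \<rho> ((- x) /\<^sub>R \<epsilon> + (1 / \<epsilon>) *\<^sub>R (x + \<epsilon> *\<^sub>R w))
      = iexp (\<xi> \<bullet> x) * (iexp ((\<epsilon> *\<^sub>R \<xi>) \<bullet> w) * \<rho> w)"
      by (simp only: mult.assoc)
  qed
  also have "\<dots> = iexp (\<xi> \<bullet> x) * (LINT w|lborel. iexp ((\<epsilon> *\<^sub>R \<xi>) \<bullet> w) * \<rho> w)"
    by (rule integral_mult_right_zero)
  finally show ?thesis
    unfolding fourier_inv_def by (simp add: scaleR_conv_of_real)
qed

lemma rescaled_bump_test:
  fixes x :: "real^'n::finite"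
  defines "\<rho> \<equiv> \<lambda>y. complex_of_real (box_bump 1 (\<chi> i. - 1) (\<chi> i. 1) y)"
  assumes e: "0 < \<epsilon>" "\<epsilon> * real CARD('n) < \<delta>"
  shows "(\<lambda>y. \<rho> ((- x) /\<^sub>R \<epsilon> + (1 / \<epsilon>) *\<^sub>R y)) \<in> test_functions (ball x \<delta>)"
proof -
  let ?f = "\<lambda>y. \<rho> ((- x) /\<^sub>R \<epsilon> + (1 / \<epsilon>) *\<^sub>R y)"
  have "smooth ?f" unfolding \<rho>_def by (rule smooth_affine[OF smooth_box_bump])
  moreover have "closure {y. ?f y \<noteq> 0} \<subseteq> cball x (\<epsilon> * real CARD('n))"
  proof (rule closure_minimal)
    show "{y. ?f y \<noteq> 0} \<subseteq> cball x (\<epsilon> * real CARD('n))"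
    proof
      fix y assume y: "y \<in> {y. ?f y \<noteq> 0}"
      define w where "w = (- x) /\<^sub>R \<epsilon> + (1 / \<epsilon>) *\<^sub>R y"
      have "w \<in> box (\<chi> i. - 1) (\<chi> i. 1)"
        using y box_bump_eq_0_iff[of 1 "\<chi> i. - 1" "\<chi> i. 1" w] by (auto simp: \<rho>_def w_def)
      then have "\<bar>w $ i\<bar> \<le> 1" for i by (auto simp: mem_box_cart abs_le_iff less_imp_le minus_le_iff)
      \<comment> \<open>The cube with half-width 1 lies in the ball of radius
        \<open>CARD('n)\<close> by comparison with the sum norm; this is the origin of the
        hypothesis on \<open>\<epsilon> * real CARD('n)\<close>.\<close>
      then have "norm w \<le> real CARD('n)"
        using norm_le_l1_cart[of w] sum_bounded_above[of UNIV "\<lambda>i. \<bar>w $ i\<bar>" 1] by simp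
      moreover have "y - x = \<epsilon> *\<^sub>R w" using e(1) by (simp add: w_def scaleR_diff_right inverse_eq_divide)
      ultimately have "norm (y - x) \<le> \<epsilon> * real CARD('n)" using e(1) by simp
      then show "y \<in> cball x (\<epsilon> * real CARD('n))" by (simp add: dist_norm norm_minus_commute)
    qed
  qed simp
  moreover from this have "compact (closure {y. ?f y \<noteq> 0})"
    using compact_Int_closed[OF compact_cball[of x "\<epsilon> * real CARD('n)"] closed_closure, of "{y. ?f y \<noteq> 0}"]
    by (simp add: inf.absorb2)
  moreover have "cball x (\<epsilon> * real CARD('n)) \<subseteq> ball x \<delta>" using e(2) by auto
  ultimately show ?thesis by (simp add: test_functions_def)
qed

text \<open>Testing against the translates of a small bump \<open>\<rho>\<close> shows that the mollification of the distribution
  vanishes on the support of \<open>f\<close>; then the bump shrinks. This replaces a partition of unity.\<close>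

lemma spectral_vanishes_if_locally:
  fixes h :: "real^'n::finite \<Rightarrow> complex"
  assumes h: "weighted_L2 s h" and f: "f \<in> test_functions U"
    and loc: "\<And>x. x \<in> U \<Longrightarrow> \<exists>V. open V \<and> x \<in> V \<and> (\<forall>\<phi>\<in>test_functions V. spectral h \<phi> = 0)"
  shows "spectral h f = 0"
proof -
  define n where "n = CARD('n)"
  define K where "K = closure {x. f x \<noteq> 0}"
  have K: "compact K" "K \<subseteq> U" using f by (auto simp: test_functions_def K_def)
  have fS: "f \<in> schwartz_space" using f test_functions_schwartz by blast
  define \<G> where "\<G> = {V. open V \<and> (\<forall>\<phi>\<in>test_functions V. spectral h \<phi> = 0)}"
  have c: "K \<subseteq> \<Union>\<G>" using K(2) loc unfolding \<G>_def by blast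
  have op: "open V" if "V \<in> \<G>" for V using that by (simp add: \<G>_def)
  \<comment> \<open>A Lebesgue number of the cover: one bump size works around every point of
    \<open>K\<close>.\<close>
  obtain \<delta> where \<delta>: "0 < \<delta>" "\<And>x. x \<in> K \<Longrightarrow> \<exists>V\<in>\<G>. ball x \<delta> \<subseteq> V"
    by (rule Heine_Borel_lemma[OF K(1) c op]) auto
  define \<rho> where "\<rho> = (\<lambda>y::real^'n. complex_of_real (box_bump 1 (\<chi> i. - 1) (\<chi> i. 1) y))"
  have \<rho>S: "\<rho> \<in> schwartz_space"
    using box_bump_test[of "\<chi> i. - 1" "\<chi> i. 1" UNIV 1] test_functions_schwartz by (auto simp: \<rho>_def)
  define \<epsilon> where "\<epsilon> k = \<delta> / (real n + 1) * inverse (real (Suc k))" for k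
  have e0: "0 < \<epsilon> k" for k using \<delta>(1) by (simp add: \<epsilon>_def)
  have e1: "\<epsilon> k * real CARD('n) < \<delta>" for k
  proof -
    have "\<epsilon> k \<le> \<delta> / (real n + 1) * 1"
      unfolding \<epsilon>_def using \<delta>(1) by (intro mult_left_mono) (auto simp: inverse_eq_divide)
    then have "\<epsilon> k * (real n + 1) \<le> \<delta>" by (simp add: field_simps)
    moreover have "\<epsilon> k * real n < \<epsilon> k * (real n + 1)" using e0[of k] by simp
    ultimately show ?thesis by (simp add: n_def)
  qed
  have elim: "\<epsilon> \<longlonglongrightarrow> 0"
    using tendsto_mult[OF tendsto_const[of "\<delta> / (real n + 1)"] LIMSEQ_inverse_real_of_nat]
    unfolding \<epsilon>_def[abs_def] mult_zero_right .
  define \<rho>i where "\<rho>i = fourier_inv \<rho>"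
  have \<rho>i: "\<rho>i \<in> schwartz_space" unfolding \<rho>i_def by (rule fourier_inv_schwartz[OF \<rho>S])
  then have [measurable]: "\<rho>i \<in> borel_measurable borel" by (rule schwartz_measurable)
  have test: "(\<lambda>y. \<rho> ((- x) /\<^sub>R \<epsilon> k + (1 / \<epsilon> k) *\<^sub>R y)) \<in> test_functions (ball x \<delta>)" for x k
    unfolding \<rho>_def by (rule rescaled_bump_test[OF e0 e1])
  \<comment> \<open>The dilation is, up to a constant, the inverse transform of the rescaled bump
    centred at 0, hence Schwartz.\<close>
  have scaled: "(\<lambda>\<xi>. \<rho>i (\<epsilon> k *\<^sub>R \<xi>)) \<in> schwartz_space" for k
  proof -
    have "(\<lambda>y. \<rho> ((- 0) /\<^sub>R \<epsilon> k + (1 / \<epsilon> k) *\<^sub>R y)) \<in> schwartz_space"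
      using test[where x=0 and k=k] test_functions_schwartz by blast
    from schwartz_cmult[OF fourier_inv_schwartz[OF this], of "1 / of_real (\<epsilon> k ^ CARD('n))"]
    show ?thesis using e0[of k] unfolding integral_exp_rescaled_bump[OF e0] \<rho>i_def by (simp add: less_imp_neq[THEN not_sym])
  qed
  have hm[measurable]: "h \<in> borel_measurable borel" by (rule weighted_L2_measurable[OF h])
  have [measurable]: "f \<in> borel_measurable borel" by (rule schwartz_measurable[OF fS])
  have hi: "integrable lborel (\<lambda>\<xi>. h \<xi> * \<rho>i (\<epsilon> k *\<^sub>R \<xi>))" for k by (rule weighted_L2_mult_schwartz[OF h scaled])
  have zero: "(LINT \<xi>|lborel. h \<xi> * (iexp (\<xi> \<bullet> x) * \<rho>i (\<epsilon> k *\<^sub>R \<xi>))) = 0" if "x \<in> K" for x k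
  proof -
    let ?b = "\<lambda>y. \<rho> ((- x) /\<^sub>R \<epsilon> k + (1 / \<epsilon> k) *\<^sub>R y)"
    obtain V where V: "V \<in> \<G>" "ball x \<delta> \<subseteq> V" using \<delta>(2)[OF \<open>x \<in> K\<close>] by blast
    then have t: "?b \<in> test_functions V" using test test_functions_mono by blast
    then have "spectral h ?b = 0" using V(1) by (simp add: \<G>_def)
    moreover have "?b \<in> schwartz_space" using t test_functions_schwartz by blast
    ultimately have "(LINT \<xi>|lborel. h \<xi> * fourier_inv ?b \<xi>) = 0" by (simp add: spectral_def)
    moreover have eq: "h \<xi> * fourier_inv ?b \<xi> = of_real (\<epsilon> k ^ CARD('n)) * (h \<xi> * (iexp (\<xi> \<bullet> x) * \<rho>i (\<epsilon> k *\<^sub>R \<xi>)))" for \<xi>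
      unfolding integral_exp_rescaled_bump[OF e0] \<rho>i_def by (simp only: mult_ac)
    ultimately have "of_real (\<epsilon> k ^ CARD('n)) * (LINT \<xi>|lborel. h \<xi> * (iexp (\<xi> \<bullet> x) * \<rho>i (\<epsilon> k *\<^sub>R \<xi>))) = 0"
      by (simp only: eq integral_mult_right_zero)
    moreover have "complex_of_real (\<epsilon> k ^ CARD('n)) \<noteq> 0" using e0[of k] by simp
    ultimately show ?thesis by (simp only: mult_eq_0_iff) simp
  qed
  obtain C where C: "\<And>\<xi>. norm (\<rho>i \<xi>) \<le> C" using schwartz_decay[OF \<rho>i, of 0] by auto
  have Fi: "fourier_inv f \<in> schwartz_space" by (rule fourier_inv_schwartz[OF fS])
  then have Fm[measurable]: "fourier_inv f \<in> borel_measurable borel" by (rule schwartz_measurable)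
  \<comment> \<open>After exchanging integrals, \<open>f x\<close> multiplies the pairing with the
    bump at \<open>x\<close>: on \<open>K\<close> that pairing is 0, and off \<open>K\<close> the
    factor \<open>f x\<close> is 0.\<close>
  have "(LINT \<xi>|lborel. h \<xi> * \<rho>i (\<epsilon> k *\<^sub>R \<xi>) * fourier_inv f \<xi>) = 0" for k
  proof -
    have "(LINT \<xi>|lborel. h \<xi> * \<rho>i (\<epsilon> k *\<^sub>R \<xi>) * (LINT x|lborel. iexp (\<xi> \<bullet> x) * f x))
      = (LINT \<xi>|lborel. LINT x|lborel. f x * (h \<xi> * (iexp (\<xi> \<bullet> x) * \<rho>i (\<epsilon> k *\<^sub>R \<xi>))))"
      by (subst integral_mult_right_zero[symmetric]) (simp only: mult_ac)
    also have "\<dots> = (LINT x|lborel. LINT \<xi>|lborel. f x * (h \<xi> * (iexp (\<xi> \<bullet> x) * \<rho>i (\<epsilon> k *\<^sub>R \<xi>))))"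
      by (rule Fubini_product_bound[where f="\<lambda>x. norm (f x)" and g="\<lambda>\<xi>. norm (h \<xi> * \<rho>i (\<epsilon> k *\<^sub>R \<xi>))"])
        (use integrable_norm[OF hi[of k]] schwartz_integrable[OF fS] in \<open>auto simp: norm_mult\<close>)
    also have "\<dots> = (LINT x|lborel. f x * (LINT \<xi>|lborel. h \<xi> * (iexp (\<xi> \<bullet> x) * \<rho>i (\<epsilon> k *\<^sub>R \<xi>))))"
      by simp
    also have "\<dots> = (LINT x|(lborel :: (real^'n) measure). (0::complex))"
    proof (rule Bochner_Integration.integral_cong[OF refl])
      fix x :: "real^'n"
      show "f x * (LINT \<xi>|lborel. h \<xi> * (iexp (\<xi> \<bullet> x) * \<rho>i (\<epsilon> k *\<^sub>R \<xi>))) = 0"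
        using zero[where x=x and k=k] closure_subset[of "{x. f x \<noteq> 0}"] by (cases "f x = 0") (auto simp: K_def)
    qed
    finally have "(LINT \<xi>|lborel. h \<xi> * \<rho>i (\<epsilon> k *\<^sub>R \<xi>) * (LINT x|lborel. iexp (\<xi> \<bullet> x) * f x)) = 0" by simp
    then show ?thesis by (simp add: fourier_inv_def inner_commute)
  qed
  moreover have "(\<lambda>k. LINT \<xi>|lborel. h \<xi> * \<rho>i (\<epsilon> k *\<^sub>R \<xi>) * fourier_inv f \<xi>) \<longlonglongrightarrow> (LINT \<xi>|lborel. h \<xi> * \<rho>i 0 * fourier_inv f \<xi>)"
  proof (rule integral_dominated_convergence)
    show "integrable lborel (\<lambda>\<xi>. C * norm (h \<xi> * fourier_inv f \<xi>))"
      by (intro integrable_mult_right integrable_norm weighted_L2_mult_schwartz[OF h] Fi)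
    show "AE \<xi> in lborel. norm (h \<xi> * \<rho>i (\<epsilon> k *\<^sub>R \<xi>) * fourier_inv f \<xi>) \<le> C * norm (h \<xi> * fourier_inv f \<xi>)" for k
    proof (rule AE_I2)
      fix \<xi>
      have "norm (h \<xi> * \<rho>i (\<epsilon> k *\<^sub>R \<xi>) * fourier_inv f \<xi>) = norm (\<rho>i (\<epsilon> k *\<^sub>R \<xi>)) * norm (h \<xi> * fourier_inv f \<xi>)"
        by (simp add: norm_mult)
      also have "\<dots> \<le> C * norm (h \<xi> * fourier_inv f \<xi>)" by (rule mult_right_mono[OF C]) simp
      finally show "norm (h \<xi> * \<rho>i (\<epsilon> k *\<^sub>R \<xi>) * fourier_inv f \<xi>) \<le> C * norm (h \<xi> * fourier_inv f \<xi>)" .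
    qed
    show "AE \<xi> in lborel. (\<lambda>k. h \<xi> * \<rho>i (\<epsilon> k *\<^sub>R \<xi>) * fourier_inv f \<xi>) \<longlonglongrightarrow> h \<xi> * \<rho>i 0 * fourier_inv f \<xi>"
    proof (rule AE_I2)
      fix \<xi> :: "real^'n"
      have "(\<lambda>k. \<epsilon> k *\<^sub>R \<xi>) \<longlonglongrightarrow> 0 *\<^sub>R \<xi>" by (intro tendsto_intros elim)
      then have "(\<lambda>k. \<rho>i (\<epsilon> k *\<^sub>R \<xi>)) \<longlonglongrightarrow> \<rho>i 0"
        using continuous_on_tendsto_compose[OF schwartz_continuous[OF \<rho>i, of UNIV]] by simp
      then show "(\<lambda>k. h \<xi> * \<rho>i (\<epsilon> k *\<^sub>R \<xi>) * fourier_inv f \<xi>) \<longlonglongrightarrow> h \<xi> * \<rho>i 0 * fourier_inv f \<xi>"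
        by (intro tendsto_intros)
    qed
    show "(\<lambda>\<xi>. h \<xi> * \<rho>i 0 * fourier_inv f \<xi>) \<in> borel_measurable lborel" by measurable
    show "(\<lambda>\<xi>. h \<xi> * \<rho>i (\<epsilon> k *\<^sub>R \<xi>) * fourier_inv f \<xi>) \<in> borel_measurable lborel" for k by measurable
  qed
  ultimately have "(LINT \<xi>|lborel. h \<xi> * \<rho>i 0 * fourier_inv f \<xi>) = 0" by (simp add: LIMSEQ_const_iff)
  then have "\<rho>i 0 * (LINT \<xi>|lborel. h \<xi> * fourier_inv f \<xi>) = 0"
    by (simp add: mult_ac)
  \<comment> \<open>Up to a positive constant it is the integral of a nonnegative function that is
    positive on a box of positive measure.\<close>
  moreover have "\<rho>i 0 \<noteq> 0"
  proof
    assume "\<rho>i 0 = 0"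
    then have "complex_of_real (LINT y|lborel. box_bump 1 (\<chi> i. - 1) (\<chi> i. 1) (y::real^'n)) = 0"
      by (simp add: \<rho>i_def fourier_inv_def \<rho>_def)
    then have z: "(LINT y|lborel. box_bump 1 (\<chi> i. - 1) (\<chi> i. 1) (y::real^'n)) = 0" by (simp only: of_real_eq_0_iff)
    have "integrable lborel (box_bump 1 (\<chi> i. - 1) (\<chi> i. 1) :: real^'n \<Rightarrow> real)"
      using schwartz_integrable[OF \<rho>S] by (simp add: \<rho>_def complex_of_real_integrable_eq)
    then have "AE y in lborel. box_bump 1 (\<chi> i. - 1) (\<chi> i. 1) (y::real^'n) = 0"
      using z by (subst (asm) integral_nonneg_eq_0_iff_AE) (auto simp: box_bump_bounds)
    then have "AE y in lborel. y \<notin> box (\<chi> i. - 1) (\<chi> i. 1 :: real^'n)"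
      by eventually_elim (simp add: box_bump_eq_0_iff)
    then have "emeasure lborel (box (\<chi> i. - 1) (\<chi> i. 1) :: (real^'n) set) = 0"
      by (subst (asm) AE_iff_measurable[OF _ refl]) auto
    moreover have "0 < prod ((\<bullet>) ((\<chi> i. 1) - (\<chi> i. - 1))) (Basis :: (real^'n) set)"
      by (rule prod_pos) (auto simp: Basis_vec_def inner_axis)
    ultimately show False by (simp add: emeasure_lborel_box_eq Basis_vec_def inner_axis not_less[symmetric])
  qed
  ultimately show ?thesis using fS by (simp add: spectral_def)
qed

subsection \<open>Multipliers that preserve supports\<close>

text \<open>\<open>vanishes \<sigma> h\<close>: the distribution with Fourier transform \<open>h\<close> vanishes where \<open>\<sigma> x\<^sub>n < 0\<close>; \<open>\<sigma>\<close> is \<open>1\<close> or \<open>-1\<close>.\<close>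

definition vanishes :: "real \<Rightarrow> (real^'n::{finite,linorder} \<Rightarrow> complex) \<Rightarrow> bool" where
  "vanishes \<sigma> h \<longleftrightarrow> (\<exists>s. weighted_L2 s h)
     \<and> (\<forall>\<phi>\<in>test_functions {x. \<sigma> * last_coord x < 0}. spectral h \<phi> = 0)"

text \<open>Measurability and polynomial growth, rather than smoothness, are built in because these
  survive pointwise limits under a uniform bound.\<close>

definition preserving :: "real \<Rightarrow> (real^'n::{finite,linorder} \<Rightarrow> complex) set" where
  "preserving \<sigma> = {m. m \<in> borel_measurable borel \<and> (\<exists>C N. \<forall>\<xi>. norm (m \<xi>) \<le> C * bracket \<xi> ^ N)
     \<and> (\<forall>h. vanishes \<sigma> h \<longrightarrow> vanishes \<sigma> (\<lambda>\<xi>. m \<xi> * h \<xi>))}"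

lemma weighted_L2_mult_power:
  assumes "weighted_L2 s h" "m \<in> borel_measurable borel" "\<And>\<xi>. norm (m \<xi>) \<le> C * bracket \<xi> ^ N"
  shows "weighted_L2 (s - real N) (\<lambda>\<xi>. m \<xi> * h \<xi>)"
  by (rule weighted_L2_mult[OF assms(1,2), where C=C]) (simp add: powr_realpow assms(3))

lemma preservingD:
  assumes "m \<in> preserving \<sigma>"
  shows "m \<in> borel_measurable borel" "vanishes \<sigma> h \<Longrightarrow> vanishes \<sigma> (\<lambda>\<xi>. m \<xi> * h \<xi>)"
  using assms by (auto simp: preserving_def)

lemma preserving_bound:
  assumes "m \<in> preserving \<sigma>"
  obtains C N where "0 \<le> C" "\<And>\<xi>. norm (m \<xi>) \<le> C * bracket \<xi> ^ N"
proof -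
  obtain C N where b: "\<And>\<xi>. norm (m \<xi>) \<le> C * bracket \<xi> ^ N" using assms by (auto simp: preserving_def)
  have "norm (m \<xi>) \<le> \<bar>C\<bar> * bracket \<xi> ^ N" for \<xi>
    by (rule order_trans[OF b mult_right_mono]) auto
  then show ?thesis using that[of "\<bar>C\<bar>" N] by simp
qed

lemma spectral_eq: "\<phi> \<in> test_functions U \<Longrightarrow> spectral h \<phi> = (LINT \<xi>|lborel. h \<xi> * fourier_inv \<phi> \<xi>)"
  using test_functions_schwartz by (auto simp: spectral_def)

lemma test_fourier_inv: "\<phi> \<in> test_functions U \<Longrightarrow> fourier_inv \<phi> \<in> schwartz_space"
  using test_functions_schwartz by (auto intro: fourier_inv_schwartz)

lemma vanishes_spectral_add:
  assumes f: "weighted_L2 s f" and g: "weighted_L2 t g" and \<phi>: "\<phi> \<in> test_functions U"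
  shows "spectral (\<lambda>\<xi>. f \<xi> + g \<xi>) \<phi> = spectral f \<phi> + spectral g \<phi>"
    and "spectral (\<lambda>\<xi>. f \<xi> - g \<xi>) \<phi> = spectral f \<phi> - spectral g \<phi>"
  using weighted_L2_mult_schwartz[OF f test_fourier_inv[OF \<phi>]] weighted_L2_mult_schwartz[OF g test_fourier_inv[OF \<phi>]]
  by (simp_all add: spectral_eq[OF \<phi>] distrib_right left_diff_distrib)

lemma preserving_const: "(\<lambda>\<xi>. c) \<in> preserving \<sigma>"
proof -
  have "vanishes \<sigma> (\<lambda>\<xi>. c * h \<xi>)" if h: "vanishes \<sigma> h" for h :: "(real, 'a) vec \<Rightarrow> complex"
  proof -
    obtain s where "weighted_L2 s h" using h by (auto simp: vanishes_def)
    then have "weighted_L2 (s - 0) (\<lambda>\<xi>. c * h \<xi>)"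
      by (rule weighted_L2_mult[where C="norm c"]) auto
    moreover have "spectral (\<lambda>\<xi>. c * h \<xi>) \<phi> = c * spectral h \<phi>" for \<phi>
      by (simp add: spectral_def mult.assoc)
    ultimately show ?thesis using h by (auto simp: vanishes_def)
  qed
  then show ?thesis
    unfolding preserving_def by (intro CollectI conjI exI[of _ "norm c"] exI[of _ 0]) auto
qed

lemma preserving_mult:
  assumes f: "f \<in> preserving \<sigma>" and g: "g \<in> preserving \<sigma>"
  shows "(\<lambda>\<xi>. f \<xi> * g \<xi>) \<in> preserving \<sigma>"
proof -
  obtain C N where C: "0 \<le> C" "\<And>\<xi>. norm (f \<xi>) \<le> C * bracket \<xi> ^ N" using preserving_bound[OF f] by blast
  obtain D M where D: "0 \<le> D" "\<And>\<xi>. norm (g \<xi>) \<le> D * bracket \<xi> ^ M" using preserving_bound[OF g] by blast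
  have "norm (f \<xi> * g \<xi>) \<le> (C * D) * bracket \<xi> ^ (N + M)" for \<xi>
    using mult_mono[OF C(2) D(2), of \<xi> \<xi>] C(1) by (simp add: norm_mult power_add mult_ac)
  moreover have "vanishes \<sigma> (\<lambda>\<xi>. f \<xi> * g \<xi> * h \<xi>)" if "vanishes \<sigma> h" for h
    using preservingD(2)[OF f preservingD(2)[OF g that]] by (simp add: mult.assoc)
  moreover have "(\<lambda>\<xi>. f \<xi> * g \<xi>) \<in> borel_measurable borel"
    using preservingD(1)[OF f] preservingD(1)[OF g] by measurable
  ultimately show ?thesis unfolding preserving_def by blast
qed

lemma preserving_add:
  assumes f: "f \<in> preserving \<sigma>" and g: "g \<in> preserving \<sigma>"
  shows "(\<lambda>\<xi>. f \<xi> + g \<xi>) \<in> preserving \<sigma>"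
proof -
  have m: "(\<lambda>\<xi>. f \<xi> + g \<xi>) \<in> borel_measurable borel"
    using preservingD(1)[OF f] preservingD(1)[OF g] by measurable
  obtain C N where C: "0 \<le> C" "\<And>\<xi>. norm (f \<xi>) \<le> C * bracket \<xi> ^ N" using preserving_bound[OF f] by blast
  obtain D M where D: "0 \<le> D" "\<And>\<xi>. norm (g \<xi>) \<le> D * bracket \<xi> ^ M" using preserving_bound[OF g] by blast
  have b: "norm (f \<xi> + g \<xi>) \<le> (C + D) * bracket \<xi> ^ (N + M)" for \<xi>
  proof -
    have "norm (f \<xi> + g \<xi>) \<le> C * bracket \<xi> ^ N + D * bracket \<xi> ^ M"
      by (rule order_trans[OF norm_triangle_ineq add_mono[OF C(2) D(2)]])
    also have "\<dots> \<le> C * bracket \<xi> ^ (N + M) + D * bracket \<xi> ^ (N + M)"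
      using C(1) D(1) by (intro add_mono mult_left_mono power_increasing one_le_bracket) auto
    finally show ?thesis by (simp add: distrib_right)
  qed
  have "vanishes \<sigma> (\<lambda>\<xi>. (f \<xi> + g \<xi>) * h \<xi>)" if h: "vanishes \<sigma> h" for h
  proof -
    obtain s where s: "weighted_L2 s h" using h by (auto simp: vanishes_def)
    have vf: "vanishes \<sigma> (\<lambda>\<xi>. f \<xi> * h \<xi>)" and vg: "vanishes \<sigma> (\<lambda>\<xi>. g \<xi> * h \<xi>)"
      using preservingD(2)[OF f h] preservingD(2)[OF g h] .
    obtain s1 s2 where w: "weighted_L2 s1 (\<lambda>\<xi>. f \<xi> * h \<xi>)" "weighted_L2 s2 (\<lambda>\<xi>. g \<xi> * h \<xi>)"
      using vf vg by (auto simp: vanishes_def)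
    have "spectral (\<lambda>\<xi>. (f \<xi> + g \<xi>) * h \<xi>) \<phi> = 0" if "\<phi> \<in> test_functions {x. \<sigma> * last_coord x < 0}" for \<phi>
      using vanishes_spectral_add(1)[OF w that] vf vg that by (simp add: distrib_right vanishes_def)
    with weighted_L2_mult_power[OF s m b] show ?thesis unfolding vanishes_def by blast
  qed
  with m b show ?thesis unfolding preserving_def by blast
qed

lemma preserving_sum: "finite A \<Longrightarrow> (\<And>i. i \<in> A \<Longrightarrow> f i \<in> preserving \<sigma>) \<Longrightarrow> (\<lambda>\<xi>. \<Sum>i\<in>A. f i \<xi>) \<in> preserving \<sigma>"
  by (induction A rule: finite_induct) (auto intro: preserving_const preserving_add)

lemma preserving_power: "f \<in> preserving \<sigma> \<Longrightarrow> (\<lambda>\<xi>. f \<xi> ^ k) \<in> preserving \<sigma>"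
  by (induction k) (auto intro: preserving_const preserving_mult)

text \<open>The common bound \<open>C * bracket \<xi> ^ N\<close> times \<open>h\<close> is again in
  a weighted space, so its product with the Schwartz function \<open>fourier_inv \<phi>\<close> is
  an integrable majorant, and vanishing of the pairings passes to the limit.\<close>

lemma preserving_limit:
  assumes f: "\<And>k. f k \<in> preserving \<sigma>"
    and b: "\<And>k \<xi>. norm (f k \<xi>) \<le> C * bracket \<xi> ^ N"
    and l: "\<And>\<xi>. (\<lambda>k. f k \<xi>) \<longlonglongrightarrow> m \<xi>"
  shows "m \<in> preserving \<sigma>"
proof -
  have fm[measurable]: "f k \<in> borel_measurable borel" for k by (rule preservingD(1)[OF f])
  have mm[measurable]: "m \<in> borel_measurable borel"
    by (rule borel_measurable_LIMSEQ_metric[OF _ l]) measurable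
  have mb: "norm (m \<xi>) \<le> C * bracket \<xi> ^ N" for \<xi>
    by (rule LIMSEQ_le_const2[OF tendsto_norm[OF l]]) (use b in blast)
  have "vanishes \<sigma> (\<lambda>\<xi>. m \<xi> * h \<xi>)" if h: "vanishes \<sigma> h" for h
  proof -
    obtain s where s: "weighted_L2 s h" using h by (auto simp: vanishes_def)
    have hm[measurable]: "h \<in> borel_measurable borel" by (rule weighted_L2_measurable[OF s])
    have "spectral (\<lambda>\<xi>. m \<xi> * h \<xi>) \<phi> = 0" if \<phi>: "\<phi> \<in> test_functions {x. \<sigma> * last_coord x < 0}" for \<phi>
    proof -
      have Fm[measurable]: "fourier_inv \<phi> \<in> borel_measurable borel" by (rule schwartz_measurable[OF test_fourier_inv[OF \<phi>]])
      have "weighted_L2 (s - real N) (\<lambda>\<xi>. of_real (C * bracket \<xi> ^ N) * h \<xi>)"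
        by (rule weighted_L2_mult_power[OF s, where C="\<bar>C\<bar>"]) (simp_all add: abs_mult norm_mult norm_power)
      from integrable_norm[OF weighted_L2_mult_schwartz[OF this test_fourier_inv[OF \<phi>]]]
      have dom: "integrable lborel (\<lambda>\<xi>. norm (of_real (C * bracket \<xi> ^ N) * h \<xi> * fourier_inv \<phi> \<xi>))" .
      have "(\<lambda>k. LINT \<xi>|lborel. f k \<xi> * h \<xi> * fourier_inv \<phi> \<xi>) \<longlonglongrightarrow> (LINT \<xi>|lborel. m \<xi> * h \<xi> * fourier_inv \<phi> \<xi>)"
      proof (rule integral_dominated_convergence[OF _ _ dom])
        show "AE \<xi> in lborel. norm (f k \<xi> * h \<xi> * fourier_inv \<phi> \<xi>) \<le> norm (of_real (C * bracket \<xi> ^ N) * h \<xi> * fourier_inv \<phi> \<xi>)" for k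
        proof (rule AE_I2)
          fix \<xi>
          have "norm (f k \<xi>) \<le> norm (complex_of_real (C * bracket \<xi> ^ N))"
            unfolding norm_of_real by (rule order_trans[OF b abs_ge_self])
          then show "norm (f k \<xi> * h \<xi> * fourier_inv \<phi> \<xi>) \<le> norm (of_real (C * bracket \<xi> ^ N) * h \<xi> * fourier_inv \<phi> \<xi>)"
            unfolding norm_mult[of "_ * _"] norm_mult[of "f k \<xi>"] norm_mult[of "complex_of_real (C * bracket \<xi> ^ N)"]
            by (intro mult_right_mono) auto
        qed
        show "AE \<xi> in lborel. (\<lambda>k. f k \<xi> * h \<xi> * fourier_inv \<phi> \<xi>) \<longlonglongrightarrow> m \<xi> * h \<xi> * fourier_inv \<phi> \<xi>"
          by (intro AE_I2 tendsto_intros l)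
        show "(\<lambda>\<xi>. m \<xi> * h \<xi> * fourier_inv \<phi> \<xi>) \<in> borel_measurable lborel" by measurable
        show "(\<lambda>\<xi>. f k \<xi> * h \<xi> * fourier_inv \<phi> \<xi>) \<in> borel_measurable lborel" for k by measurable
      qed
      moreover have "(LINT \<xi>|lborel. f k \<xi> * h \<xi> * fourier_inv \<phi> \<xi>) = 0" for k
      proof -
        have "spectral (\<lambda>\<xi>. f k \<xi> * h \<xi>) \<phi> = 0"
          using preservingD(2)[OF f h, of k] \<phi> unfolding vanishes_def by blast
        then show ?thesis by (simp add: spectral_eq[OF \<phi>])
      qed
      ultimately show ?thesis by (simp add: spectral_eq[OF \<phi>] LIMSEQ_const_iff)
    qed
    with weighted_L2_mult_power[OF s mm mb] show ?thesis unfolding vanishes_def by blast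
  qed
  with mm mb show ?thesis unfolding preserving_def by blast
qed

lemma fourier_inv_translate:
  "fourier_inv (\<lambda>x. \<phi> (y + x)) \<xi> = exp (- \<i> * of_real (y \<bullet> \<xi>)) * fourier_inv \<phi> \<xi>"
proof -
  have "(LINT x|lborel. iexp (\<xi> \<bullet> x) * \<phi> x) = (LINT x|lborel. iexp (\<xi> \<bullet> (y + x)) * \<phi> (y + x))"
    by (subst integral_affine(2)[where c=1 and t=y]) simp_all
  also have "\<dots> = (LINT x|lborel. iexp (y \<bullet> \<xi>) * (iexp (\<xi> \<bullet> x) * \<phi> (y + x)))"
    by (simp add: inner_add_right exp_add distrib_left inner_commute mult.assoc)
  finally have "fourier_inv \<phi> \<xi> = iexp (y \<bullet> \<xi>) * fourier_inv (\<lambda>x. \<phi> (y + x)) \<xi>"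
    by (simp add: fourier_inv_def)
  then show ?thesis by (simp add: exp_minus)
qed

text \<open>The exponential acts as translation by \<open>y\<close>. On the test function side it
  moves supports by \<open>- y\<close>, which takes the open half-space where
  \<open>\<sigma> * last_coord x < 0\<close> into itself.\<close>

lemma preserving_exp:
  fixes y :: "real^'n::{finite,linorder}"
  assumes y: "0 \<le> \<sigma> * last_coord y"
  shows "(\<lambda>\<xi>. exp (- \<i> * of_real (y \<bullet> \<xi>))) \<in> preserving \<sigma>"
proof -
  have m: "(\<lambda>\<xi>. exp (- \<i> * of_real (y \<bullet> \<xi>))) \<in> borel_measurable borel" by measurable
  have b: "norm (exp (- \<i> * of_real (y \<bullet> \<xi>))) \<le> 1 * bracket \<xi> ^ 0" for \<xi> by simp
  have "vanishes \<sigma> (\<lambda>\<xi>. exp (- \<i> * of_real (y \<bullet> \<xi>)) * h \<xi>)" if h: "vanishes \<sigma> h" for h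
  proof -
    obtain s where s: "weighted_L2 s h" using h by (auto simp: vanishes_def)
    have "spectral (\<lambda>\<xi>. exp (- \<i> * of_real (y \<bullet> \<xi>)) * h \<xi>) \<phi> = 0" if \<phi>: "\<phi> \<in> test_functions {x. \<sigma> * last_coord x < 0}" for \<phi>
    proof -
      have cl: "closure {x. \<phi> (y + x) \<noteq> 0} = (+) (- y) ` closure {x. \<phi> x \<noteq> 0}"
      proof -
        have "{x. \<phi> (y + x) \<noteq> 0} = (+) (- y) ` {x. \<phi> x \<noteq> 0}"
          by (auto simp: image_iff intro!: exI[of _ "y + _"])
        then show ?thesis by (simp only: closure_translation)
      qed
      have "smooth (\<lambda>x. \<phi> (y + x))"
        using smooth_affine[of \<phi> y 1] \<phi> by (simp add: test_functions_def)
      moreover have "closure {x. \<phi> (y + x) \<noteq> 0} \<subseteq> {x. \<sigma> * last_coord x < 0}"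
        unfolding cl using \<phi> y by (force simp: test_functions_def last_coord_def right_diff_distrib)
      moreover have "compact (closure {x. \<phi> (y + x) \<noteq> 0})"
        unfolding cl using \<phi> by (intro compact_translation) (simp add: test_functions_def)
      ultimately have t: "(\<lambda>x. \<phi> (y + x)) \<in> test_functions {x. \<sigma> * last_coord x < 0}" by (simp add: test_functions_def)
      have "spectral (\<lambda>\<xi>. exp (- \<i> * of_real (y \<bullet> \<xi>)) * h \<xi>) \<phi> = spectral h (\<lambda>x. \<phi> (y + x))"
        unfolding spectral_eq[OF \<phi>] spectral_eq[OF t] fourier_inv_translate by (simp only: mult_ac)
      also have "\<dots> = 0" using h t by (simp add: vanishes_def)
      finally show ?thesis .
    qed
    with weighted_L2_mult_power[OF s m b] show ?thesis unfolding vanishes_def by blast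
  qed
  with m b show ?thesis unfolding preserving_def by blast
qed

lemma preserving_exp_coord:
  fixes i :: "'n::{finite,linorder}"
  assumes "i \<noteq> Max UNIV \<or> 0 \<le> \<sigma> * t"
  shows "(\<lambda>\<xi>. exp (- \<i> * of_real (t * \<xi> $ i))) \<in> preserving \<sigma>"
proof -
  have "(\<lambda>\<xi>. exp (- \<i> * of_real ((t *\<^sub>R axis i 1) \<bullet> \<xi>))) \<in> preserving \<sigma>"
    using assms by (intro preserving_exp) (auto simp: last_coord_def axis_def)
  then show ?thesis by (simp add: inner_axis')
qed

subsection \<open>Multipliers in the tangential variables\<close>

text \<open>A continuous function of \<open>\<xi>'\<close> is a limit of polynomials in \<open>N sin (\<xi>\<^sub>i / N)\<close>, that is, of
  trigonometric polynomials in \<open>\<xi>'\<close>, which act by translations parallel to the boundary.\<close>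

definition tangential :: "(real, 'n::{finite,linorder}) vec \<Rightarrow> (real, 'n) vec" where
  "tangential \<xi> = (\<chi> i. if i = Max UNIV then 0 else \<xi> $ i)"

definition sin_approx :: "real \<Rightarrow> (real, 'n::{finite,linorder}) vec \<Rightarrow> (real, 'n) vec" where
  "sin_approx N \<xi> = (\<chi> i. if i = Max UNIV then 0 else N * sin (\<xi> $ i / N))"

lemma preserving_sin:
  fixes i :: "'n::{finite,linorder}"
  assumes "i \<noteq> Max UNIV"
  shows "(\<lambda>\<xi>. complex_of_real (sin (\<xi> $ i / N))) \<in> preserving \<sigma>"
proof -
  have "complex_of_real (sin (\<xi> $ i / N)) = (\<i> / 2) * exp (- \<i> * of_real ((1 / N) * \<xi> $ i)) + (- \<i> / 2) * exp (- \<i> * of_real ((- 1 / N) * \<xi> $ i))" for \<xi> :: "(real, 'n) vec"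
    unfolding sin_of_real[symmetric] sin_exp_eq by (simp add: field_simps)
  then show ?thesis
    using assms by (simp only:) (intro preserving_add preserving_mult preserving_const preserving_exp_coord, auto)
qed

lemma preserving_polynomial:
  fixes q :: "real^'n::{finite,linorder} \<Rightarrow> real"
  assumes "real_polynomial_function q"
  shows "(\<lambda>\<xi>. complex_of_real (q (sin_approx N \<xi>))) \<in> preserving \<sigma>"
  using assms
proof (induction rule: real_polynomial_function.induct)
  case (linear f)
  then interpret bounded_linear f .
  have expand: "f v = (\<Sum>i\<in>UNIV. v $ i * f (axis i 1))" for v
  proof -
    have "f v = f (\<Sum>i\<in>UNIV. (v $ i) *\<^sub>R axis i 1)"
      using basis_expansion[of v] by (simp add: scalar_mult_eq_scaleR)
    then show ?thesis by (simp add: sum scaleR)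
  qed
  have "complex_of_real (f (sin_approx N \<xi>))
    = (\<Sum>i\<in>UNIV - {Max UNIV}. of_real (N * f (axis i 1)) * of_real (sin (\<xi> $ i / N)))" for \<xi>
  proof -
    have "f (sin_approx N \<xi>) = (\<Sum>i\<in>UNIV - {Max UNIV}. sin_approx N \<xi> $ i * f (axis i 1))"
      unfolding expand[of "sin_approx N \<xi>"]
      by (rule sum.mono_neutral_right) (auto simp: sin_approx_def)
    also have "\<dots> = (\<Sum>i\<in>UNIV - {Max UNIV}. (N * f (axis i 1)) * sin (\<xi> $ i / N))"
      by (intro sum.cong refl) (simp add: sin_approx_def)
    finally show ?thesis by simp
  qed
  then show ?case
    by (simp only:) (intro preserving_sum preserving_mult preserving_const preserving_sin, auto)
qed (simp_all add: preserving_const preserving_add preserving_mult)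

lemma tendsto_sin_approx:
  "(\<lambda>k. sin_approx (real (Suc k)) \<xi>) \<longlonglongrightarrow> tangential \<xi>"
proof (rule vec_tendstoI)
  fix i
  have "(\<lambda>k. real (Suc k) * sin (x / real (Suc k))) \<longlonglongrightarrow> x" for x
    by real_asymp
  then show "(\<lambda>k. sin_approx (real (Suc k)) \<xi> $ i) \<longlonglongrightarrow> tangential \<xi> $ i"
    by (simp add: sin_approx_def tangential_def)
qed

lemma norm_sin_approx_le:
  assumes "0 < N"
  shows "norm (sin_approx N \<xi>) \<le> norm \<xi>" "norm (sin_approx N (\<xi> :: real^'n::{finite,linorder})) \<le> N * real CARD('n)"
proof -
  have "\<bar>N * sin (x / N)\<bar> \<le> \<bar>x\<bar>" for x
    using abs_sin_x_le_abs_x[of "x / N"] assms by (simp add: abs_mult field_simps)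
  then show "norm (sin_approx N \<xi>) \<le> norm \<xi>"
    by (intro norm_le_componentwise_cart) (simp add: sin_approx_def)
  have "\<bar>N * sin (x / N)\<bar> \<le> N" for x
    using assms abs_sin_le_one[of "x / N"] by (simp add: abs_mult)
  then have "\<bar>sin_approx N \<xi> $ i\<bar> \<le> N" for i using assms by (simp add: sin_approx_def)
  then show "norm (sin_approx N \<xi>) \<le> N * real CARD('n)"
    using norm_le_l1_cart[of "sin_approx N \<xi>"] sum_bounded_above[of UNIV "\<lambda>i. \<bar>sin_approx N \<xi> $ i\<bar>" N]
    by (simp add: mult.commute)
qed

text \<open>The sines serve twice: for each \<open>k\<close> they confine the argument to a compact
  ball, where Stone-Weierstrass gives uniform approximation, and they are bounded by the coordinates
  themselves, so the growth of \<open>m\<close> yields a bound independent of \<open>k\<close>. The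
  extra 1 in \<open>C + 1\<close> absorbs the approximation error.\<close>

lemma preserving_tangential:
  fixes m :: "real^'n::{finite,linorder} \<Rightarrow> real"
  assumes c: "continuous_on UNIV m" and b: "\<And>v. \<bar>m v\<bar> \<le> C * bracket v ^ K"
  shows "(\<lambda>\<xi>. complex_of_real (m (tangential \<xi>))) \<in> preserving \<sigma>"
proof -
  have C0: "0 \<le> C" using b[of 0] by (simp add: bracket_def)
  \<comment> \<open>The ball contains all values of \<open>sin_approx (real (Suc k))\<close>, by
    \<open>norm_sin_approx_le\<close>; the approximation is used nowhere else.\<close>
  define P where "P k q \<longleftrightarrow> real_polynomial_function q
    \<and> (\<forall>v\<in>cball 0 (real (Suc k) * real CARD('n)). \<bar>m v - q v\<bar> < 1 / real (Suc k))" for k q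
  have "\<exists>q. P k q" for k
  proof -
    have pos: "0 < 1 / real (Suc k)" by simp
    obtain q where "real_polynomial_function q"
      "\<And>v. v \<in> cball 0 (real (Suc k) * real CARD('n)) \<Longrightarrow> \<bar>m v - q v\<bar> < 1 / real (Suc k)"
      by (rule Stone_Weierstrass_real_polynomial_function[OF compact_cball[of 0 "real (Suc k) * real CARD('n)"]
            continuous_on_subset[OF c subset_UNIV] pos]) (rule that; simp)
    then have "P k q" by (simp add: P_def)
    then show ?thesis by (rule exI[of _ q])
  qed
  then have "\<forall>k. \<exists>q. P k q" by (rule allI)
  from choice[OF this] obtain q where "\<forall>k. P k (q k)" by (rule exE)
  then have q: "real_polynomial_function (q k) \<and> (\<forall>v\<in>cball 0 (real (Suc k) * real CARD('n)). \<bar>m v - q k v\<bar> < 1 / real (Suc k))" for k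
    by (simp add: P_def)
  define S where "S k \<xi> = sin_approx (real (Suc k)) \<xi>" for k and \<xi> :: "(real, 'n) vec"
  have close: "\<bar>m (S k \<xi>) - q k (S k \<xi>)\<bar> < 1 / real (Suc k)" for k \<xi>
    unfolding S_def
    by (rule q[THEN conjunct2, rule_format]) (use norm_sin_approx_le(2)[of "real (Suc k)" \<xi>] in simp)
  show ?thesis
  proof (rule preserving_limit[where f="\<lambda>k \<xi>. complex_of_real (q k (S k \<xi>))" and C="C + 1" and N=K])
    show "(\<lambda>\<xi>. complex_of_real (q k (S k \<xi>))) \<in> preserving \<sigma>" for k
      unfolding S_def by (rule preserving_polynomial[OF q[THEN conjunct1]])
    fix \<xi> :: "(real, 'n) vec"
    show "norm (complex_of_real (q k (S k \<xi>))) \<le> (C + 1) * bracket \<xi> ^ K" for k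
    proof -
      have "1 / real (Suc k) \<le> 1" by simp
      then have "\<bar>q k (S k \<xi>)\<bar> \<le> \<bar>m (S k \<xi>)\<bar> + 1" using close[of k \<xi>] by linarith
      also have "\<dots> \<le> C * bracket (S k \<xi>) ^ K + 1" using b by simp
      also have "\<dots> \<le> C * bracket \<xi> ^ K + bracket \<xi> ^ K"
        unfolding S_def using C0
        by (intro add_mono mult_left_mono power_mono bracket_mono norm_sin_approx_le one_le_power one_le_bracket) auto
      finally show ?thesis by (simp add: distrib_right)
    qed
    have "(\<lambda>k. m (S k \<xi>)) \<longlonglongrightarrow> m (tangential \<xi>)"
      unfolding S_def by (rule continuous_on_tendsto_compose[OF c tendsto_sin_approx]) auto
    moreover have "(\<lambda>k. q k (S k \<xi>) - m (S k \<xi>)) \<longlonglongrightarrow> 0"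
    proof (rule tendsto_rabs_zero_cancel, rule tendsto_sandwich[of "\<lambda>_. 0"])
      show "(\<lambda>k. 1 / real (Suc k)) \<longlonglongrightarrow> 0"
        using LIMSEQ_inverse_real_of_nat by (simp add: inverse_eq_divide)
      show "eventually (\<lambda>k. \<bar>q k (S k \<xi>) - m (S k \<xi>)\<bar> \<le> 1 / real (Suc k)) sequentially"
        using less_imp_le[OF close] by (intro always_eventually allI) (subst abs_minus_commute)
    qed auto
    ultimately have "(\<lambda>k. (q k (S k \<xi>) - m (S k \<xi>)) + m (S k \<xi>)) \<longlonglongrightarrow> 0 + m (tangential \<xi>)"
      by (rule tendsto_add[rotated])
    then show "(\<lambda>k. complex_of_real (q k (S k \<xi>))) \<longlonglongrightarrow> complex_of_real (m (tangential \<xi>))"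
      by (intro tendsto_of_real) simp
  qed
qed

lemma bracket_tangential: "bracket (tangential \<xi>) = bracket' \<xi>"
proof -
  have "(\<Sum>i\<in>UNIV. (tangential \<xi> $ i)\<^sup>2) = (\<Sum>i\<in>UNIV - {Max UNIV}. (\<xi> $ i)\<^sup>2)"
    by (subst sum.remove[of UNIV "Max UNIV"]) (auto simp: tangential_def intro!: sum.cong)
  then show ?thesis by (simp add: bracket_def bracket'_def norm_sq_vec)
qed

lemma preserving_bracket': "(\<lambda>\<xi>. complex_of_real (bracket' \<xi>)) \<in> preserving \<sigma>"
  using preserving_tangential[OF continuous_bracket, of 1 1 \<sigma>] by (simp add: bracket_tangential)

section \<open>Powers of the base symbol as limits of exponential sums\<close>

lemma gbinomial_neg_sign:
  fixes t :: real
  assumes "t < 0"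
  shows "0 \<le> (- 1) ^ k * (t gchoose k)"
proof -
  have "(- 1) ^ k * (\<Prod>i=0..<k. t - real i) = (\<Prod>i=0..<k. - (t - real i))"
    by (induction k) (simp_all add: algebra_simps)
  also have "\<dots> \<ge> 0" using assms by (intro prod_nonneg) auto
  finally show ?thesis by (simp add: gbinomial_prod_rev)
qed

text \<open>Replacing \<open>i \<sigma> \<xi>\<^sub>n\<close> by \<open>N (1 - exp (- i \<sigma> \<xi>\<^sub>n / N))\<close> turns a negative power of \<open>\<langle>\<xi>'\<rangle> + i \<sigma> \<xi>\<^sub>n\<close> into a
  binomial series in \<open>exp (- i \<sigma> \<xi>\<^sub>n / N)\<close>. Its coefficients are positive, so the partial sums are bounded
  by the value at \<open>\<xi>\<^sub>n = 0\<close>.\<close>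

definition xi_partial_sum :: "real \<Rightarrow> real \<Rightarrow> real \<Rightarrow> nat \<Rightarrow> real^'n::{finite,linorder} \<Rightarrow> complex" where
  "xi_partial_sum \<sigma> t N K \<xi> = (\<Sum>k<K. of_real ((bracket' \<xi> + N) powr t * (N / (bracket' \<xi> + N)) ^ k * ((- 1) ^ k * (t gchoose k)))
     * exp (- \<i> * of_real (\<sigma> * real k / N * last_coord \<xi>)))"

definition xi_difference :: "real \<Rightarrow> real \<Rightarrow> real^'n::{finite,linorder} \<Rightarrow> complex" where
  "xi_difference \<sigma> N \<xi> = of_real N * (1 - exp (- \<i> * of_real (\<sigma> / N * last_coord \<xi>)))"

lemma preserving_exp_last:
  assumes "0 \<le> \<sigma> * t"
  shows "(\<lambda>\<xi>. exp (- \<i> * of_real (t * last_coord \<xi>))) \<in> preserving \<sigma>"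
  unfolding last_coord_def using assms by (intro preserving_exp_coord) auto

lemma preserving_xi_partial_sum:
  assumes t: "t < 0" and N: "0 < N"
  shows "(xi_partial_sum \<sigma> t N K :: (real, 'n::{finite,linorder}) vec \<Rightarrow> complex) \<in> preserving \<sigma>"
proof -
  have "(\<lambda>\<xi>::(real, 'n) vec. of_real ((bracket' \<xi> + N) powr t * (N / (bracket' \<xi> + N)) ^ k * ((- 1) ^ k * (t gchoose k)))
     * exp (- \<i> * of_real (\<sigma> * real k / N * last_coord \<xi>))) \<in> preserving \<sigma>" for k
  proof (rule preserving_mult)
    define c where "c = (- 1) ^ k * (t gchoose k)"
    \<comment> \<open>Stated with \<open>bracket v\<close> and evaluated at
      \<open>tangential \<xi>\<close>, where \<open>bracket\<close> becomes \<open>bracket'\<close>;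
      this brings the coefficient into the form of \<open>preserving_tangential\<close>.\<close>
    define m where "m v = (bracket v + N) powr t * (N / (bracket v + N)) ^ k * c" for v :: "(real, 'n) vec"
    have pos: "0 < bracket v + N" for v :: "(real, 'n) vec" using N by (simp add: add_pos_pos)
    have "continuous_on UNIV m"
      unfolding m_def[abs_def] using pos
      by (intro continuous_intros) (auto simp: less_imp_neq[THEN not_sym])
    moreover have "\<bar>m v\<bar> \<le> \<bar>c\<bar> * bracket v ^ 0" for v
    proof -
      have "1 \<le> bracket v + N" using one_le_bracket[of v] N by linarith
      then have "(bracket v + N) powr t \<le> 1"
        using t powr_mono[of t 0 "bracket v + N"] pos[of v] by simp
      moreover have "(N / (bracket v + N)) ^ k \<le> 1"
        using N pos[of v] by (intro power_le_one) (auto simp: field_simps)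
      ultimately have "(bracket v + N) powr t * (N / (bracket v + N)) ^ k * \<bar>c\<bar> \<le> 1 * 1 * \<bar>c\<bar>"
        using N pos[of v] by (intro mult_mono mult_nonneg_nonneg) (auto intro!: zero_le_power divide_nonneg_pos)
      then show ?thesis
        using N pos[of v] by (simp add: m_def abs_mult power_abs)
    qed
    ultimately have "(\<lambda>\<xi>. complex_of_real (m (tangential \<xi>))) \<in> preserving \<sigma>"
      by (rule preserving_tangential)
    then show "(\<lambda>\<xi>::(real, 'n) vec. complex_of_real ((bracket' \<xi> + N) powr t * (N / (bracket' \<xi> + N)) ^ k * ((- 1) ^ k * (t gchoose k)))) \<in> preserving \<sigma>"
      by (simp only: m_def bracket_tangential c_def)
    have "0 \<le> \<sigma> * (\<sigma> * real k / N)" using N by (simp add: mult.assoc[symmetric])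
    then show "(\<lambda>\<xi>::(real, 'n) vec. exp (- \<i> * of_real (\<sigma> * real k / N * last_coord \<xi>))) \<in> preserving \<sigma>"
      by (rule preserving_exp_last)
  qed
  then show ?thesis
    unfolding xi_partial_sum_def[abs_def] by (intro preserving_sum) auto
qed

lemma xi_partial_sum_bound:
  assumes t: "t < 0" and N: "0 < N"
  shows "norm (xi_partial_sum \<sigma> t N K \<xi>) \<le> 1"
proof -
  define l where "l = bracket' \<xi> + N"
  define r where "r = N / l"
  have l: "1 \<le> bracket' \<xi>" "0 < l" using one_le_bracket'[of \<xi>] N by (auto simp: l_def)
  have r: "0 \<le> r" "r < 1" using l N by (auto simp: r_def l_def field_simps)
  define b where "b k = (- 1) ^ k * (t gchoose k)" for k
  have b: "0 \<le> b k" for k unfolding b_def by (rule gbinomial_neg_sign[OF t])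
  have "(\<lambda>k. (t gchoose k) * (- r) ^ k) sums (1 + - r) powr t"
    by (rule gen_binomial_real) (use r in auto)
  moreover have "(t gchoose k) * (- r) ^ k = b k * r ^ k" for k
    by (simp add: b_def power_minus[of r] mult_ac)
  ultimately have s: "(\<lambda>k. b k * r ^ k) sums (1 - r) powr t" by simp
  have "norm (xi_partial_sum \<sigma> t N K \<xi>) \<le> (\<Sum>k<K. l powr t * (b k * r ^ k))"
    unfolding xi_partial_sum_def l_def[symmetric] r_def[symmetric] b_def[symmetric]
  proof (rule order_trans[OF norm_sum sum_mono])
    fix k
    have "0 \<le> l powr t * r ^ k * b k" using b r by simp
    then show "norm (of_real (l powr t * r ^ k * b k) * exp (- \<i> * of_real (\<sigma> * real k / N * last_coord \<xi>))) \<le> l powr t * (b k * r ^ k)"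
      unfolding norm_mult[of "complex_of_real _"] norm_of_real
      by (simp only: abs_of_nonneg norm_exp_eq_Re) (simp add: mult_ac)
  qed
  also have "\<dots> = l powr t * (\<Sum>k<K. b k * r ^ k)" by (simp add: sum_distrib_left)
  also have "\<dots> \<le> l powr t * (1 - r) powr t"
    using sum_le_suminf[OF sums_summable[OF s], of "{..<K}"] b r
    unfolding sums_unique[OF s, symmetric] by (intro mult_left_mono) auto
  also have "\<dots> = (l * (1 - r)) powr t" using l r by (simp add: powr_mult)
  also have "l * (1 - r) = l - N" using l(2) by (simp add: right_diff_distrib r_def)
  also have "l - N = bracket' \<xi>" by (simp add: l_def)
  also have "bracket' \<xi> powr t \<le> 1" using t l powr_mono[of t 0 "bracket' \<xi>"] by simp
  finally show ?thesis .
qed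

lemma xi_partial_sum_tendsto:
  assumes N: "0 < N"
  shows "(\<lambda>K. xi_partial_sum \<sigma> t N K \<xi>) \<longlonglongrightarrow> (of_real (bracket' \<xi>) + xi_difference \<sigma> N \<xi>) powr of_real t"
proof -
  define l where "l = bracket' \<xi> + N"
  define r where "r = N / l"
  have l: "1 \<le> bracket' \<xi>" "0 < l" using one_le_bracket'[of \<xi>] N by (auto simp: l_def)
  have r: "0 \<le> r" "r < 1" using l N by (auto simp: r_def l_def field_simps)
  define z where "z = exp (- \<i> * of_real (\<sigma> / N * last_coord \<xi>))"
  have z: "norm z = 1" by (simp add: z_def)
  \<comment> \<open>Although \<open>z\<close> lies on the unit circle, \<open>r < 1\<close> because
    \<open>bracket' \<xi>\<close> is positive, so the binomial series converges.\<close>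
  have "norm (- (of_real r * z)) < 1" using r z by (simp add: norm_mult)
  from gen_binomial_complex[OF this, of "of_real t"]
  have "(\<lambda>k. of_real (l powr t) * ((of_real t gchoose k) * (- (of_real r * z)) ^ k)) sums (of_real (l powr t) * (1 + - (of_real r * z)) powr of_real t)"
    by (rule sums_mult)
  moreover have "of_real (l powr t) * ((of_real t gchoose k) * (- (of_real r * z)) ^ k)
     = of_real (l powr t * r ^ k * ((- 1) ^ k * (t gchoose k))) * exp (- \<i> * of_real (\<sigma> * real k / N * last_coord \<xi>))" for k
  proof -
    have "z ^ k = exp (- \<i> * of_real (\<sigma> * real k / N * last_coord \<xi>))"
      unfolding z_def exp_of_nat_mult[symmetric] by (simp add: mult_ac)
    moreover have "(of_real t gchoose k) = complex_of_real (t gchoose k)"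
      by (simp add: gbinomial_prod_rev)
    moreover have "(- (of_real r * z)) ^ k = (- 1) ^ k * of_real r ^ k * z ^ k"
      by (simp add: power_mult_distrib power_minus[of "_ * z"])
    ultimately show ?thesis by simp
  qed
  moreover have "of_real (l powr t) * (1 + - (of_real r * z)) powr of_real t = (of_real (bracket' \<xi>) + xi_difference \<sigma> N \<xi>) powr of_real t"
  proof -
    have "of_real (l powr t) * (1 + - (of_real r * z)) powr of_real t = (of_real l) powr of_real t * (1 + - (of_real r * z)) powr of_real t"
      using l by (simp add: powr_of_real)
    \<comment> \<open>A positive real factor leaves the argument unchanged, so the principal powers
      multiply.\<close>
    also have "\<dots> = (of_real l * (1 + - (of_real r * z))) powr of_real t"
      using l(2) by (subst powr_times_real_left) auto
    also have "of_real l * (1 + - (of_real r * z)) = of_real (bracket' \<xi>) + xi_difference \<sigma> N \<xi>"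
    proof -
      have "of_real l * complex_of_real r = of_real N" using l(2) by (simp add: r_def)
      moreover have "of_real l * (1 + - (of_real r * z)) = of_real l - (of_real l * of_real r) * z"
        by (simp add: algebra_simps)
      ultimately have "of_real l * (1 + - (of_real r * z)) = of_real l - of_real N * z" by (simp only:)
      also have "\<dots> = of_real (bracket' \<xi>) + xi_difference \<sigma> N \<xi>"
        unfolding xi_difference_def z_def[symmetric] l_def of_real_add by (simp add: right_diff_distrib)
      finally show ?thesis .
    qed
    finally show ?thesis .
  qed
  ultimately show ?thesis
    unfolding xi_partial_sum_def l_def[symmetric] r_def[symmetric] sums_def by simp
qed

lemma xi_difference_bound:
  assumes "0 < N" "\<bar>\<sigma>\<bar> = 1"
  shows "norm (xi_difference \<sigma> N \<xi>) \<le> bracket \<xi>"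
proof -
  have "norm (xi_difference \<sigma> N \<xi>) = N * norm (iexp (- (\<sigma> / N * last_coord \<xi>)) - (\<Sum>k\<le>0. (\<i> * of_real (- (\<sigma> / N * last_coord \<xi>))) ^ k / fact k))"
    using assms(1) by (simp add: xi_difference_def norm_mult norm_minus_commute)
  also have "\<dots> \<le> N * (\<bar>- (\<sigma> / N * last_coord \<xi>)\<bar> ^ Suc 0 / fact (Suc 0))"
    using assms(1) by (intro mult_left_mono iexp_approx1) auto
  also have "\<dots> = \<bar>last_coord \<xi>\<bar>" using assms by (simp add: abs_mult)
  also have "\<dots> \<le> bracket \<xi>" unfolding last_coord_def by (rule component_le_bracket)
  finally show ?thesis .
qed

lemma xi_difference_tendsto:
  "(\<lambda>k. xi_difference \<sigma> (real (Suc k)) \<xi>) \<longlonglongrightarrow> \<i> * of_real (\<sigma> * last_coord \<xi>)"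
proof -
  define x where "x = \<sigma> * last_coord \<xi>"
  have "((\<lambda>z. exp (- \<i> * (z * of_real x))) has_field_derivative (- \<i> * of_real x)) (at (of_real 0))"
    by (auto intro!: derivative_eq_intros)
  from has_vector_derivative_real_field[OF this]
  have "((\<lambda>s. exp (- \<i> * (of_real s * of_real x))) has_vector_derivative (- \<i> * of_real x)) (at 0)" by simp
  from has_vector_derivative_quotient_seq[OF this LIMSEQ_inverse_real_of_nat]
  have "(\<lambda>k. (exp (- \<i> * (of_real (inverse (real (Suc k))) * of_real x)) - 1) / of_real (inverse (real (Suc k)))) \<longlonglongrightarrow> - \<i> * of_real x"
    by simp
  from tendsto_minus[OF this] show ?thesis
    by (simp add: xi_difference_def x_def divide_inverse algebra_simps)
qed

text \<open>\<open>\<i> * \<sigma> * last_coord \<xi>\<close> is the limit of the difference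
  quotients \<open>xi_difference\<close>, dominated by \<open>bracket \<xi>\<close>. Since
  \<open>\<sigma> * \<sigma> = 1\<close>, the translations involved go in the admissible
  direction.\<close>

lemma preserving_xi_one:
  assumes "\<bar>\<sigma>\<bar> = 1"
  shows "(xi_symbol \<sigma> 1 :: (real, 'n::{finite,linorder}) vec \<Rightarrow> complex) \<in> preserving \<sigma>"
proof -
  have "\<sigma> * \<sigma> = 1" using assms by (metis abs_mult_self_eq mult_1)
  have "(\<lambda>\<xi>::(real, 'n) vec. \<i> * of_real (\<sigma> * last_coord \<xi>)) \<in> preserving \<sigma>"
  proof (rule preserving_limit[where f="\<lambda>k. xi_difference \<sigma> (real (Suc k))" and C=1 and N=1])
    show "xi_difference \<sigma> (real (Suc k)) \<in> preserving \<sigma>" for k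
    proof -
      have "0 \<le> \<sigma> * (\<sigma> / real (Suc k))" using \<open>\<sigma> * \<sigma> = 1\<close> by simp
      from preserving_mult[OF preserving_const preserving_add[OF preserving_const preserving_mult[OF preserving_const preserving_exp_last[OF this]]],
          of "of_real (real (Suc k))" 1 "- 1"]
      show ?thesis by (simp add: xi_difference_def[abs_def])
    qed
    show "norm (xi_difference \<sigma> (real (Suc k)) \<xi>) \<le> 1 * bracket \<xi> ^ 1" for k \<xi>
      using xi_difference_bound[OF _ assms, of "real (Suc k)" \<xi>] by simp
  qed (rule xi_difference_tendsto)
  from preserving_add[OF preserving_bracket' this]
  show ?thesis
    using xi_base_nonzero[of _ \<sigma>] by (simp add: xi_symbol_def[abs_def])
qed

text \<open>Two limits in succession: the binomial partial sums converge for fixed step, and then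
  the step tends to 0. The bound 1 on the partial sums is inherited by the first limit and so serves
  for the second.\<close>

lemma preserving_xi_neg:
  assumes \<sigma>: "\<bar>\<sigma>\<bar> = 1" and t: "t < 0"
  shows "(xi_symbol \<sigma> t :: (real, 'n::{finite,linorder}) vec \<Rightarrow> complex) \<in> preserving \<sigma>"
proof (rule preserving_limit[where f="\<lambda>k \<xi>. (of_real (bracket' \<xi>) + xi_difference \<sigma> (real (Suc k)) \<xi>) powr of_real t" and C=1 and N=0])
  fix k and \<xi> :: "(real, 'n) vec"
  show "norm ((of_real (bracket' \<xi>) + xi_difference \<sigma> (real (Suc k)) \<xi>) powr of_real t) \<le> 1 * bracket \<xi> ^ 0"
    unfolding power_0 mult_1_right
    by (rule LIMSEQ_le_const2[OF tendsto_norm[OF xi_partial_sum_tendsto]])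
      (use xi_partial_sum_bound[OF t, of "real (Suc k)" \<sigma> _ \<xi>] in simp_all)
next
  fix k
  show "(\<lambda>\<xi>::(real, 'n) vec. (of_real (bracket' \<xi>) + xi_difference \<sigma> (real (Suc k)) \<xi>) powr of_real t) \<in> preserving \<sigma>"
  proof (rule preserving_limit[where f="xi_partial_sum \<sigma> t (real (Suc k))" and C=1 and N=0])
    show "xi_partial_sum \<sigma> t (real (Suc k)) K \<in> preserving \<sigma>" for K
      by (rule preserving_xi_partial_sum[OF t]) simp
    show "norm (xi_partial_sum \<sigma> t (real (Suc k)) K \<xi>) \<le> 1 * bracket \<xi> ^ 0" for K and \<xi> :: "(real, 'n) vec"
      using xi_partial_sum_bound[OF t, of "real (Suc k)" \<sigma> K \<xi>] by simp
  qed (rule xi_partial_sum_tendsto, simp)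
next
  fix \<xi> :: "(real, 'n) vec"
  have "of_real (bracket' \<xi>) + \<i> * of_real (\<sigma> * last_coord \<xi>) \<notin> \<real>\<^sub>\<le>\<^sub>0"
    using one_le_bracket'[of \<xi>] by (auto simp: complex_nonpos_Reals_iff)
  then show "(\<lambda>k. (of_real (bracket' \<xi>) + xi_difference \<sigma> (real (Suc k)) \<xi>) powr of_real t) \<longlonglongrightarrow> xi_symbol \<sigma> t \<xi>"
    unfolding xi_symbol_def
    by (rule tendsto_powr_complex[OF _ tendsto_add[OF tendsto_const xi_difference_tendsto] tendsto_const])
qed

text \<open>Subtracting an integer \<open>k > t\<close> from the order gives a negative power, and
  the \<open>k\<close> missing orders are restored by the \<open>k\<close>-th power of the symbol of
  order 1.\<close>

theorem preserving_xi:
  assumes \<sigma>: "\<bar>\<sigma>\<bar> = 1"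
  shows "(xi_symbol \<sigma> t :: (real, 'n::{finite,linorder}) vec \<Rightarrow> complex) \<in> preserving \<sigma>"
proof -
  define k where "k = Suc (nat \<lceil>t\<rceil>)"
  have neg: "t - real k < 0" unfolding k_def by linarith
  have "xi_symbol \<sigma> (real j) \<xi> = xi_symbol \<sigma> 1 \<xi> ^ j" for j and \<xi> :: "(real, 'n) vec"
    by (induction j) (simp_all add: xi_symbol_0 xi_symbol_add)
  then have "xi_symbol \<sigma> t \<xi> = xi_symbol \<sigma> (t - real k) \<xi> * xi_symbol \<sigma> 1 \<xi> ^ k" for \<xi> :: "(real, 'n) vec"
    using xi_symbol_add[of \<sigma> "t - real k" "real k" \<xi>] by simp
  then have "(xi_symbol \<sigma> t :: (real, 'n) vec \<Rightarrow> complex) = (\<lambda>\<xi>. xi_symbol \<sigma> (t - real k) \<xi> * xi_symbol \<sigma> 1 \<xi> ^ k)"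
    by (rule ext)
  then show ?thesis
    using preserving_mult[OF preserving_xi_neg[OF \<sigma> neg] preserving_power[OF preserving_xi_one[OF \<sigma>]]] by simp
qed

section \<open>Restriction, support and extension by zero on the Fourier side\<close>

lemma continuous_last_coord: "continuous_on A (last_coord :: real^'n::{finite,linorder} \<Rightarrow> real)"
  unfolding last_coord_def by (intro continuous_intros)

lemma measurable_last_coord [measurable]: "(last_coord :: real^'n::{finite,linorder} \<Rightarrow> real) \<in> borel_measurable borel"
  by (intro borel_measurable_continuous_onI continuous_last_coord)

lemma open_signed_half_space: "open {x::real^'n::{finite,linorder}. \<sigma> * last_coord x < 0}"
  by (intro open_Collect_less continuous_intros continuous_last_coord)

lemma half_space_eq: "half_space = {x. - 1 * last_coord x < 0}"
  by (simp add: half_space_def)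

lemma measurable_half_space [measurable]: "half_space \<in> sets borel"
  unfolding half_space_def by measurable

text \<open>The sign -1 selects the open half-space of positive last coordinate. The orders may
  differ; the difference is then measured in the smaller one.\<close>

lemma r_plus_spectral_eq_iff:
  assumes f: "weighted_L2 s f" and g: "weighted_L2 t g"
  shows "r_plus (spectral f) = r_plus (spectral g) \<longleftrightarrow> vanishes (- 1) (\<lambda>\<xi>. f \<xi> - g \<xi>)"
proof -
  have "r_plus (spectral f) = r_plus (spectral g) \<longleftrightarrow> (\<forall>\<phi>\<in>test_functions half_space. spectral f \<phi> = spectral g \<phi>)"
    unfolding r_plus_def fun_eq_iff by auto
  also have "\<dots> \<longleftrightarrow> (\<forall>\<phi>\<in>test_functions half_space. spectral (\<lambda>\<xi>. f \<xi> - g \<xi>) \<phi> = 0)"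
    using vanishes_spectral_add(2)[OF f g] by simp
  also have "\<dots> \<longleftrightarrow> vanishes (- 1) (\<lambda>\<xi>. f \<xi> - g \<xi>)"
    unfolding vanishes_def half_space_eq using weighted_L2_diff[OF f g] by blast
  finally show ?thesis .
qed

text \<open>The complement of the support is a union of open sets of vanishing, so the forward
  direction needs the passage from local to global vanishing,
  \<open>spectral_vanishes_if_locally\<close>.\<close>

lemma dist_support_spectral_iff:
  fixes h :: "(real, 'n::{finite,linorder}) vec \<Rightarrow> complex"
  assumes h: "weighted_L2 s h"
  shows "dist_support (spectral h) \<subseteq> {x. 0 \<le> last_coord x} \<longleftrightarrow> vanishes 1 h"
proof
  assume supp: "dist_support (spectral h) \<subseteq> {x. 0 \<le> last_coord x}"
  have "spectral h \<phi> = 0" if \<phi>: "\<phi> \<in> test_functions {x. 1 * last_coord x < 0}" for \<phi>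
  proof (rule spectral_vanishes_if_locally[OF h \<phi>])
    fix x :: "(real, 'n) vec" assume "x \<in> {x. 1 * last_coord x < 0}"
    then have "x \<notin> dist_support (spectral h)" using supp by auto
    then show "\<exists>V. open V \<and> x \<in> V \<and> (\<forall>\<phi>\<in>test_functions V. spectral h \<phi> = 0)"
      unfolding dist_support_def by auto
  qed
  with h show "vanishes 1 h" unfolding vanishes_def by blast
next
  assume "vanishes 1 h"
  then have "\<forall>\<phi>\<in>test_functions {x. 1 * last_coord x < 0}. spectral h \<phi> = 0" by (simp add: vanishes_def)
  then have "{x. 1 * last_coord x < 0} \<subseteq> - dist_support (spectral h)"
    using open_signed_half_space[of 1] unfolding dist_support_def by blast
  moreover have "- {x::(real, 'n) vec. 1 * last_coord x < 0} = {x. 0 \<le> last_coord x}" by auto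
  ultimately show "dist_support (spectral h) \<subseteq> {x. 0 \<le> last_coord x}" by blast
qed

lemma sobolev_bar_iff:
  "w \<in> sobolev_bar s \<longleftrightarrow> (\<exists>h. weighted_L2 s h \<and> w = r_plus (spectral h))"
  unfolding sobolev_bar_def image_iff Bex_def sobolev_iff_spectral by blast

lemma sobolev_bar_mono: "s \<le> t \<Longrightarrow> sobolev_bar t \<subseteq> sobolev_bar s"
  using weighted_L2_mono unfolding subset_iff sobolev_bar_iff by blast

text \<open>The symbols of \<open>\<Xi>\<^sub>-\<^sup>t\<close> act on restrictions to the half-space, since they preserve vanishing there.\<close>

lemma sobolev_bar_xi_minus:
  assumes f: "weighted_L2 p f" and w: "r_plus (spectral f) \<in> sobolev_bar s"
  shows "r_plus (spectral (\<lambda>\<xi>. xi_symbol (- 1) t \<xi> * f \<xi>)) \<in> sobolev_bar (s - t)"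
proof -
  obtain g where g: "weighted_L2 s g" and eq: "r_plus (spectral f) = r_plus (spectral g)"
    using w unfolding sobolev_bar_iff by blast
  have xg: "weighted_L2 (s - t) (\<lambda>\<xi>. xi_symbol (- 1) t \<xi> * g \<xi>)"
    and xf: "weighted_L2 (p - t) (\<lambda>\<xi>. xi_symbol (- 1) t \<xi> * f \<xi>)"
    using f g by (auto intro: weighted_L2_xi)
  have "vanishes (- 1) (\<lambda>\<xi>. xi_symbol (- 1) t \<xi> * (f \<xi> - g \<xi>))"
    using eq unfolding r_plus_spectral_eq_iff[OF f g] by (rule preservingD(2)[OF preserving_xi, rotated]) simp
  then have "r_plus (spectral (\<lambda>\<xi>. xi_symbol (- 1) t \<xi> * f \<xi>)) = r_plus (spectral (\<lambda>\<xi>. xi_symbol (- 1) t \<xi> * g \<xi>))"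
    unfolding r_plus_spectral_eq_iff[OF xf xg] by (simp only: right_diff_distrib)
  with xg show ?thesis unfolding sobolev_bar_iff by blast
qed

lemma regular_dist_test:
  "r_plus (regular_dist schwartz_space UNIV g) = regular_dist (test_functions half_space) half_space g"
proof
  fix \<phi> :: "(real, 'a) vec \<Rightarrow> complex"
  show "r_plus (regular_dist schwartz_space UNIV g) \<phi> = regular_dist (test_functions half_space) half_space g \<phi>"
  proof (cases "\<phi> \<in> test_functions half_space")
    case True
    then have "\<phi> x = 0" if "x \<notin> half_space" for x
      using that closure_subset[of "{x. \<phi> x \<noteq> 0}"] by (auto simp: test_functions_def)
    then have "indicator half_space x *\<^sub>R (g x * \<phi> x) = g x * \<phi> x" for x
      by (auto simp: indicator_def)
    then show ?thesis
      using True test_functions_schwartz by (auto simp: r_plus_def regular_dist_def set_lebesgue_integral_def)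
  qed (simp add: r_plus_def regular_dist_def)
qed

lemma square_integrable_restrict:
  assumes "square_integrable_on half_space g"
  shows "square_integrable_on UNIV (\<lambda>x. if x \<in> half_space then g x else 0)"
proof -
  have [measurable]: "g \<in> borel_measurable borel"
    and i: "integrable lborel (\<lambda>x. indicator half_space x * (norm (g x))\<^sup>2)"
    using assms by (simp_all add: square_integrable_on_def set_integrable_def)
  have "indicator half_space x * (norm (g x))\<^sup>2 = (norm (if x \<in> half_space then g x else 0))\<^sup>2" for x
    by (simp add: indicator_def)
  with i show ?thesis unfolding square_integrable_UNIV by simp
qed

lemma regular_dist_restrict:
  "regular_dist X half_space (\<lambda>x. if x \<in> half_space then g x else 0) = regular_dist X half_space g"
  unfolding regular_dist_def set_lebesgue_integral_def
  by (intro ext if_cong refl Bochner_Integration.integral_cong) (simp add: indicator_def)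

text \<open>Plancherel in both directions; a function on the half-space is lifted to the whole space
  by zero.\<close>

lemma sobolev_bar_0: "sobolev_bar 0 = (L2_half :: 'n::{finite,linorder} dist set)"
proof
  show "sobolev_bar 0 \<subseteq> (L2_half :: 'n dist set)"
  proof
    fix w :: "'n dist" assume "w \<in> sobolev_bar 0"
    then obtain h where h: "square_integrable_on UNIV h" "w = r_plus (spectral h)"
      unfolding sobolev_bar_iff weighted_L2_0 by blast
    obtain g where g: "square_integrable_on UNIV g" "spectral h = regular_dist schwartz_space UNIV g"
      using spectral_regular_dist[OF h(1)] by blast
    have gi: "integrable lborel (\<lambda>x. (norm (g x))\<^sup>2)" and [measurable]: "g \<in> borel_measurable borel"
      using g(1) by (simp_all add: square_integrable_UNIV)
    have "square_integrable_on half_space g"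
      unfolding square_integrable_on_def set_integrable_def
      by (intro conjI integrable_mult_indicator gi) simp_all
    then show "w \<in> L2_half" unfolding L2_half_def h(2) g(2) regular_dist_test by blast
  qed
  show "L2_half \<subseteq> (sobolev_bar 0 :: 'n dist set)"
  proof
    fix w :: "'n dist" assume "w \<in> L2_half"
    then obtain g where g: "square_integrable_on half_space g" and w: "w = regular_dist (test_functions half_space) half_space g"
      unfolding L2_half_def by blast
    let ?G = "\<lambda>x. if x \<in> half_space then g x else 0"
    obtain h where "square_integrable_on UNIV h" "regular_dist schwartz_space UNIV ?G = spectral h"
      using regular_dist_spectral[OF square_integrable_restrict[OF g]] by blast
    moreover have "w = r_plus (regular_dist schwartz_space UNIV ?G)"
      unfolding w regular_dist_test regular_dist_restrict ..
    ultimately show "w \<in> sobolev_bar 0" unfolding sobolev_bar_iff weighted_L2_0 by auto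
  qed
qed

lemma e_plus_choice:
  assumes "w \<in> L2_half"
  obtains g where "square_integrable_on half_space g" "w = regular_dist (test_functions half_space) half_space g"
    "e_plus w = regular_dist schwartz_space UNIV (\<lambda>x. if x \<in> half_space then g x else 0)"
proof -
  define g where "g = (SOME g. square_integrable_on half_space g
                  \<and> w = regular_dist (test_functions half_space) half_space g)"
  have "\<exists>g. square_integrable_on half_space g \<and> w = regular_dist (test_functions half_space) half_space g"
    using assms unfolding L2_half_def by blast
  then have "square_integrable_on half_space g \<and> w = regular_dist (test_functions half_space) half_space g"
    unfolding g_def by (rule someI_ex)
  moreover have "e_plus w = regular_dist schwartz_space UNIV (\<lambda>x. if x \<in> half_space then g x else 0)"
    unfolding e_plus_def Let_def g_def ..
  ultimately show ?thesis using that by blast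
qed

text \<open>Whichever representative \<open>e_plus\<close> picks, its extension by zero is square
  integrable, pairs to 0 with test functions below the boundary, and agrees with \<open>w\<close>
  above it.\<close>

lemma e_plus_spectral:
  assumes "w \<in> L2_half"
  obtains k where "square_integrable_on UNIV k" "vanishes 1 k" "e_plus w = spectral k" "r_plus (spectral k) = w"
proof -
  obtain g where g: "square_integrable_on half_space g" "w = regular_dist (test_functions half_space) half_space g"
    "e_plus w = regular_dist schwartz_space UNIV (\<lambda>x. if x \<in> half_space then g x else 0)"
    using e_plus_choice[OF assms] by blast
  let ?G = "\<lambda>x. if x \<in> half_space then g x else 0"
  obtain k where k: "square_integrable_on UNIV k" "regular_dist schwartz_space UNIV ?G = spectral k"
    using regular_dist_spectral[OF square_integrable_restrict[OF g(1)]] by blast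
  have "spectral k \<phi> = 0" if \<phi>: "\<phi> \<in> test_functions {x. 1 * last_coord x < 0}" for \<phi>
  proof -
    have "\<phi> x = 0" if "x \<in> half_space" for x
      using that \<phi> closure_subset[of "{x. \<phi> x \<noteq> 0}"] by (force simp: test_functions_def half_space_def)
    then have z: "?G x * \<phi> x = 0" for x by simp
    show ?thesis
      unfolding k(2)[symmetric] regular_dist_def set_lebesgue_integral_def z by simp
  qed
  then have "vanishes 1 k"
    unfolding vanishes_def using k(1) weighted_L2_0 by blast
  moreover have "r_plus (spectral k) = w"
    unfolding k(2)[symmetric] regular_dist_test regular_dist_restrict g(2) ..
  ultimately show ?thesis using that k g(3) by simp
qed

lemma AE_last_coord_nonzero: "AE x::real^'n::{finite,linorder} in lborel. last_coord x \<noteq> 0"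
proof -
  have "negligible {x::(real, 'n) vec. x \<bullet> axis (Max UNIV) 1 = 0}"
    by (rule negligible_standard_hyperplane) (simp add: axis_in_Basis_iff)
  then have "{x::(real, 'n) vec. last_coord x = 0} \<in> null_sets lebesgue"
    by (simp add: negligible_iff_null_sets last_coord_def inner_axis)
  moreover have "{x::(real, 'n) vec. last_coord x = 0} \<in> sets lborel" by measurable
  ultimately have "{x::(real, 'n) vec. last_coord x = 0} \<in> null_sets lborel"
    by (simp add: null_sets_completion_iff)
  then show ?thesis by (rule AE_I') auto
qed

text \<open>A square integrable distribution cannot charge the boundary hyperplane. By the
  fundamental lemma its function is 0 almost everywhere below the boundary and equals the chosen
  representative almost everywhere above it, and the boundary itself is null.\<close>

lemma e_plus_r_plus_spectral:
  fixes k :: "real^'n::{finite,linorder} \<Rightarrow> complex"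
  assumes k: "square_integrable_on UNIV k" and v: "vanishes 1 k"
  shows "e_plus (r_plus (spectral k)) = spectral k"
proof -
  obtain g0 where g0: "square_integrable_on UNIV g0" "spectral k = regular_dist schwartz_space UNIV g0"
    using spectral_regular_dist[OF k] by blast
  have "r_plus (spectral k) \<in> L2_half"
    unfolding sobolev_bar_0[symmetric] sobolev_bar_iff weighted_L2_0 using k by blast
  then obtain g where g: "square_integrable_on half_space g"
    "r_plus (spectral k) = regular_dist (test_functions half_space) half_space g"
    "e_plus (r_plus (spectral k)) = regular_dist schwartz_space UNIV (\<lambda>x. if x \<in> half_space then g x else 0)"
    using e_plus_choice by blast
  define G where "G x = (if x \<in> half_space then g x else 0)" for x
  have G: "square_integrable_on UNIV G" unfolding G_def by (rule square_integrable_restrict[OF g(1)])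
  have [measurable]: "g0 \<in> borel_measurable borel" "G \<in> borel_measurable borel"
    using g0(1) G by (simp_all add: square_integrable_UNIV)
  have int: "integrable lborel (\<lambda>x. f x * \<phi> x)" if "square_integrable_on UNIV f" "\<phi> \<in> test_functions U" for f \<phi> U
    by (rule square_integrable_mult[OF that(1) schwartz_square_integrable[OF subsetD[OF test_functions_schwartz that(2)]]])
  have lower: "AE x in lborel. x \<in> {x. 1 * last_coord x < 0} \<longrightarrow> g0 x = 0"
  proof (rule fundamental_lemma[OF g0(1) open_signed_half_space])
    fix \<phi> :: "(real, 'n) vec \<Rightarrow> complex" assume \<phi>: "\<phi> \<in> test_functions {x. 1 * last_coord x < 0}"
    then have "spectral k \<phi> = 0" using v by (simp add: vanishes_def)
    then show "(LINT x|lborel. g0 x * \<phi> x) = 0"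
      using subsetD[OF test_functions_schwartz \<phi>] unfolding g0(2) by (simp add: regular_dist_def set_lebesgue_integral_def)
  qed
  have upper: "AE x in lborel. x \<in> half_space \<longrightarrow> G x + (- 1) * g0 x = 0"
  proof (rule fundamental_lemma)
    show "square_integrable_on UNIV (\<lambda>x. G x + (- 1) * g0 x)"
      by (rule square_integrable_add[OF G square_integrable_cmult[OF g0(1)]])
    show "open (half_space :: ((real, 'n) vec) set)" unfolding half_space_eq by (rule open_signed_half_space)
    fix \<phi> :: "(real, 'n) vec \<Rightarrow> complex" assume \<phi>: "\<phi> \<in> test_functions half_space"
    then have S: "\<phi> \<in> schwartz_space" using test_functions_schwartz by blast
    have "r_plus (regular_dist schwartz_space UNIV G) = r_plus (regular_dist schwartz_space UNIV g0)"
      unfolding g0(2)[symmetric] g(2) regular_dist_test G_def regular_dist_restrict ..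
    from fun_cong[OF this, of \<phi>] have "(LINT x|lborel. G x * \<phi> x) = (LINT x|lborel. g0 x * \<phi> x)"
      using \<phi> S by (simp add: r_plus_def regular_dist_def set_lebesgue_integral_def)
    then show "(LINT x|lborel. (G x + (- 1) * g0 x) * \<phi> x) = 0"
      using int[OF G \<phi>] int[OF g0(1) \<phi>] by (simp add: left_diff_distrib)
  qed
  have eq: "AE x in lborel. G x = g0 x"
    using lower upper AE_last_coord_nonzero
  proof eventually_elim
    case (elim x)
    then show ?case by (cases "0 < last_coord x") (auto simp: G_def half_space_def)
  qed
  have "regular_dist schwartz_space UNIV G = regular_dist schwartz_space UNIV g0"
  proof
    fix \<phi> :: "(real, 'n) vec \<Rightarrow> complex"
    have "(LINT x|lborel. G x * \<phi> x) = (LINT x|lborel. g0 x * \<phi> x)" if "\<phi> \<in> schwartz_space"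
    proof (rule integral_cong_AE)
      have [measurable]: "\<phi> \<in> borel_measurable borel" by (rule schwartz_measurable[OF that])
      show "(\<lambda>x. G x * \<phi> x) \<in> borel_measurable lborel" "(\<lambda>x. g0 x * \<phi> x) \<in> borel_measurable lborel" by measurable
    qed (use eq in eventually_elim, simp)
    then show "regular_dist schwartz_space UNIV G \<phi> = regular_dist schwartz_space UNIV g0 \<phi>"
      by (simp add: regular_dist_def set_lebesgue_integral_def)
  qed
  then show ?thesis using g(3) g0(2) by (simp add: G_def[abs_def])
qed

subsection \<open>The Dirichlet problem\<close>

lemma Xi_plus_spectral: "Xi_plus t (spectral h) = spectral (\<lambda>\<xi>. xi_symbol 1 t \<xi> * h \<xi>)"
  using Op_spectral[OF symbols_xi[of 1 t], of h] by (simp add: Xi_plus_def xi_symbol_def[abs_def])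

text \<open>With \<open>k\<close> as unknown in place of \<open>u\<close>, the right factor of the
  factorisation cancels and only the symbol that acts on restrictions is left.\<close>

lemma bessel_op_spectral:
  "bessel_op a (spectral (\<lambda>\<xi>. xi_symbol 1 (- a) \<xi> * k \<xi>)) = spectral (\<lambda>\<xi>. xi_symbol (- 1) a \<xi> * k \<xi>)"
proof -
  have "of_real (bracket \<xi> powr (2 * a)) * (xi_symbol 1 (- a) \<xi> * k \<xi>) = xi_symbol (- 1) a \<xi> * k \<xi>" for \<xi>
  proof -
    have "of_real (bracket \<xi> powr (2 * a)) * (xi_symbol 1 (- a) \<xi> * k \<xi>) = (xi_symbol 1 (- a) \<xi> * xi_symbol 1 a \<xi>) * (xi_symbol (- 1) a \<xi> * k \<xi>)"
      unfolding xi_symbol_mult_conj[symmetric] by (simp only: mult_ac)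
    then show ?thesis by (simp add: xi_symbol_minus)
  qed
  then show ?thesis unfolding bessel_op_def Op_spectral[OF symbols_bracket] by (simp only:)
qed

text \<open>Here \<open>k\<close> is the transform of \<open>Xi_plus a u\<close>: multiplication by
  \<open>xi_symbol 1 a\<close> shifts the order by \<open>a\<close> and keeps the support in the
  closed half-space, and \<open>xi_symbol 1 (- a)\<close> undoes it.\<close>

lemma sobolev_dot_iff:
  "u \<in> sobolev_dot a \<longleftrightarrow> (\<exists>k. square_integrable_on UNIV k \<and> vanishes 1 k \<and> u = spectral (\<lambda>\<xi>. xi_symbol 1 (- a) \<xi> * k \<xi>))"
proof
  assume "u \<in> sobolev_dot a"
  then obtain h where h: "weighted_L2 a h" "u = spectral h" "dist_support (spectral h) \<subseteq> {x. 0 \<le> last_coord x}"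
    unfolding sobolev_dot_def sobolev_iff_spectral by auto
  define k where "k \<xi> = xi_symbol 1 a \<xi> * h \<xi>" for \<xi>
  have "weighted_L2 (a - a) k" unfolding k_def by (rule weighted_L2_xi[OF h(1)]) simp
  then have "square_integrable_on UNIV k" by (simp add: weighted_L2_0)
  moreover have "vanishes 1 k"
    unfolding k_def using h(3) dist_support_spectral_iff[OF h(1)] by (intro preservingD(2)[OF preserving_xi]) auto
  moreover have "xi_symbol 1 (- a) \<xi> * k \<xi> = h \<xi>" for \<xi>
    by (simp add: k_def mult.assoc[symmetric] xi_symbol_minus)
  ultimately show "\<exists>k. square_integrable_on UNIV k \<and> vanishes 1 k \<and> u = spectral (\<lambda>\<xi>. xi_symbol 1 (- a) \<xi> * k \<xi>)"
    using h(2) by (intro exI[of _ k]) simp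
next
  assume "\<exists>k. square_integrable_on UNIV k \<and> vanishes 1 k \<and> u = spectral (\<lambda>\<xi>. xi_symbol 1 (- a) \<xi> * k \<xi>)"
  then obtain k where k: "square_integrable_on UNIV k" "vanishes 1 k" and u: "u = spectral (\<lambda>\<xi>. xi_symbol 1 (- a) \<xi> * k \<xi>)"
    by blast
  have "weighted_L2 (0 - - a) (\<lambda>\<xi>. xi_symbol 1 (- a) \<xi> * k \<xi>)"
    by (rule weighted_L2_xi) (simp_all add: weighted_L2_0 k)
  then have w: "weighted_L2 a (\<lambda>\<xi>. xi_symbol 1 (- a) \<xi> * k \<xi>)" by simp
  moreover have "vanishes 1 (\<lambda>\<xi>. xi_symbol 1 (- a) \<xi> * k \<xi>)"
    by (rule preservingD(2)[OF preserving_xi k(2)]) simp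
  ultimately show "u \<in> sobolev_dot a"
    unfolding sobolev_dot_def sobolev_iff_spectral u mem_Collect_eq dist_support_spectral_iff[OF w] by blast
qed

text \<open>Puts the transmission space in the form of \<open>sobolev_dot_iff\<close> with one
  further condition on \<open>r_plus (spectral k)\<close>. The hypothesis \<open>a \<le> t\<close>
  places \<open>sobolev_bar (t - a)\<close> inside \<open>L2_half\<close>, where
  \<open>e_plus\<close> is meaningful.\<close>

lemma transmission_iff:
  assumes "a \<le> t"
  shows "u \<in> transmission a t \<longleftrightarrow> (\<exists>k. square_integrable_on UNIV k \<and> vanishes 1 k
    \<and> r_plus (spectral k) \<in> sobolev_bar (t - a) \<and> u = spectral (\<lambda>\<xi>. xi_symbol 1 (- a) \<xi> * k \<xi>))"
proof
  assume "u \<in> transmission a t"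
  then obtain w where w: "w \<in> sobolev_bar (t - a)" "u = Xi_plus (- a) (e_plus w)"
    unfolding transmission_def by blast
  then have "w \<in> L2_half" using sobolev_bar_mono[of 0 "t - a"] assms by (auto simp: sobolev_bar_0)
  then obtain k where "square_integrable_on UNIV k" "vanishes 1 k" "e_plus w = spectral k" "r_plus (spectral k) = w"
    using e_plus_spectral by blast
  with w show "\<exists>k. square_integrable_on UNIV k \<and> vanishes 1 k
    \<and> r_plus (spectral k) \<in> sobolev_bar (t - a) \<and> u = spectral (\<lambda>\<xi>. xi_symbol 1 (- a) \<xi> * k \<xi>)"
    by (intro exI[of _ k]) (simp add: Xi_plus_spectral)
next
  assume "\<exists>k. square_integrable_on UNIV k \<and> vanishes 1 k
    \<and> r_plus (spectral k) \<in> sobolev_bar (t - a) \<and> u = spectral (\<lambda>\<xi>. xi_symbol 1 (- a) \<xi> * k \<xi>)"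
  then obtain k where k: "square_integrable_on UNIV k" "vanishes 1 k" "r_plus (spectral k) \<in> sobolev_bar (t - a)"
    and u: "u = spectral (\<lambda>\<xi>. xi_symbol 1 (- a) \<xi> * k \<xi>)" by blast
  have "u = Xi_plus (- a) (e_plus (r_plus (spectral k)))"
    by (simp add: u e_plus_r_plus_spectral[OF k(1,2)] Xi_plus_spectral)
  with k(3) show "u \<in> transmission a t" unfolding transmission_def by blast
qed

text \<open>Both directions are \<open>sobolev_bar_xi_minus\<close>, applied once with
  \<open>a\<close> and once with \<open>- a\<close>; the two symbols are inverse to each
  other.\<close>

lemma bessel_op_regularity_iff:
  assumes k: "square_integrable_on UNIV k"
  shows "r_plus (bessel_op a (spectral (\<lambda>\<xi>. xi_symbol 1 (- a) \<xi> * k \<xi>))) \<in> sobolev_bar s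
     \<longleftrightarrow> r_plus (spectral k) \<in> sobolev_bar (s + a)"
proof -
  have k0: "weighted_L2 0 k" using k by (simp add: weighted_L2_0)
  have xk: "weighted_L2 (0 - a) (\<lambda>\<xi>. xi_symbol (- 1) a \<xi> * k \<xi>)"
    by (rule weighted_L2_xi[OF k0]) simp
  have inv: "xi_symbol (- 1) (- a) \<xi> * (xi_symbol (- 1) a \<xi> * k \<xi>) = k \<xi>" for \<xi>
    by (simp add: mult.assoc[symmetric] xi_symbol_minus)
  show ?thesis
    unfolding bessel_op_spectral
    using sobolev_bar_xi_minus[OF k0, of "s + a" a] sobolev_bar_xi_minus[OF xk, of s "- a"]
    by (auto simp: inv)
qed

text \<open>The functions \<open>k\<close> supplied by \<open>sobolev_dot_iff\<close> and by
  \<open>transmission_iff\<close> are not compared: \<open>bessel_op_regularity_iff\<close> holds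
  for every \<open>k\<close> that represents \<open>u\<close>, and its left side depends on
  \<open>u\<close> alone.\<close>

lemma dirichlet_regularity:
  assumes u: "u \<in> sobolev_dot a" and s: "- a \<le> s"
  shows "r_plus (bessel_op a u) \<in> sobolev_bar s \<longleftrightarrow> u \<in> transmission a (s + 2 * a)"
proof -
  have t: "a \<le> s + 2 * a" "s + 2 * a - a = s + a" using s by auto
  obtain k where "square_integrable_on UNIV k" "vanishes 1 k" "u = spectral (\<lambda>\<xi>. xi_symbol 1 (- a) \<xi> * k \<xi>)"
    using u unfolding sobolev_dot_iff by blast
  then show ?thesis
    unfolding transmission_iff[OF t(1)] t(2) using bessel_op_regularity_iff by metis
qed

theorem theorem1p1:
  fixes a :: real
  assumes "0 < a" and "a < 1"
  shows "(\<forall>(f :: 'n::{finite,linorder} dist) (u :: 'n dist) (s :: real).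
            f \<in> sobolev_bar (- a) \<and> u \<in> sobolev_dot a \<and> r_plus (bessel_op a u) = f \<and> s \<ge> - a
            \<longrightarrow> (f \<in> sobolev_bar s \<longleftrightarrow> u \<in> transmission a (s + 2 * a)))
       \<and> Domain (dirichlet_realization a (bessel_op a :: 'n dist \<Rightarrow> 'n dist)) = transmission a (2 * a)"
proof (intro conjI allI impI)
  fix f u :: "'n dist" and s :: real
  assume "f \<in> sobolev_bar (- a) \<and> u \<in> sobolev_dot a \<and> r_plus (bessel_op a u) = f \<and> s \<ge> - a"
  then show "f \<in> sobolev_bar s \<longleftrightarrow> u \<in> transmission a (s + 2 * a)"
    using dirichlet_regularity by blast
next
  \<comment> \<open>The regularity equivalence presupposes \<open>u \<in> sobolev_dot a\<close>; for
    the equality of sets this must first be derived from membership in the transmission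
    space.\<close>
  have dot: "u \<in> sobolev_dot a" if "u \<in> transmission a (2 * a)" for u :: "'n dist"
    using that assms(1) unfolding sobolev_dot_iff by (subst (asm) transmission_iff) auto
  have "u \<in> Domain (dirichlet_realization a (bessel_op a)) \<longleftrightarrow> u \<in> sobolev_dot a \<and> r_plus (bessel_op a u) \<in> sobolev_bar 0" for u :: "'n dist"
    unfolding dirichlet_realization_def sobolev_bar_0 by blast
  then show "Domain (dirichlet_realization a (bessel_op a :: 'n dist \<Rightarrow> 'n dist)) = transmission a (2 * a)"
    using dirichlet_regularity[of _ a 0] dot assms(1) by auto
qed

end
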